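(* Let $\Phi,\Psi$ be two finite simplicial graphs. Assume that $\Psi$ is triangle-free. Then $C(\Phi)$ is isomorphic to a subgroup of $C(\Psi)$ if and only if the ball of radius $2\bigl(1+(1+2\cdot\#V(\Phi))\cdot\#V(\Psi)\bigr)$ centered at $1$ in $C(\Psi)$ contains a basis of a subgroup of $C(\Psi)$ isomorphic to $C(\Phi)$.
   Context: Given a simplicial graph $\Gamma$, $C(\Gamma)=\langle u\in V(\Gamma)\mid u^2=1\ (u\in V(\Gamma)),\ [u,v]=1 \text{ if } \{u,v\}\in E(\Gamma)\rangle$ is the right-angled Coxeter group. Balls in $C(\Psi)$ are taken with respect to the word metric associated to the generating set $V(\Psi)$. A basis of a group $H$ isomorphic to a right-angled Coxeter group is a generating set $S\subset H$ such that, if $\Delta$ denotes the graph with vertex-set $S$ whose edges link two distinct commuting elements of $S$, then the map sending each vertex of $\Delta$ to the element of $S$ it represents induces an isomorphism $C(\Delta)\to H$. *)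

theory Defs
  imports "HOL-Algebra.Generated_Groups"
begin

section \<open>Simplicial graphs\<close>

record 'a graph =
  verts :: "'a set"
  edges :: "'a set set"

definition simplicial_graph :: "'a graph \<Rightarrow> bool" where
  "simplicial_graph \<Gamma> \<longleftrightarrow> (\<forall>e\<in>edges \<Gamma>. e \<subseteq> verts \<Gamma> \<and> card e = 2)"

definition finite_simplicial_graph :: "'a graph \<Rightarrow> bool" where
  "finite_simplicial_graph \<Gamma> \<longleftrightarrow> simplicial_graph \<Gamma> \<and> finite (verts \<Gamma>)"

text \<open>In a simplicial graph the three vertices below are automatically distinct.\<close>

definition triangle_free :: "'a graph \<Rightarrow> bool" where
  "triangle_free \<Gamma> \<longleftrightarrow>
     \<not> (\<exists>u v w. {u, v} \<in> edges \<Gamma> \<and> {v, w} \<in> edges \<Gamma> \<and> {u, w} \<in> edges \<Gamma>)"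

section \<open>Groups given by generators and relators\<close>

text \<open>The letter \<open>(s, True)\<close> stands for the generator \<open>s\<close>, and \<open>(s, False)\<close> for its
  formal inverse.\<close>

type_synonym 'a gword = "('a \<times> bool) list"

definition gwords :: "'a set \<Rightarrow> 'a gword set" where
  "gwords S = lists (S \<times> UNIV)"

text \<open>The congruence on words over \<open>S\<close> generated by the free cancellations and by \<open>r = 1\<close>
  for every relator \<open>r\<close> in \<open>R\<close>.\<close>

inductive_set pres_rel :: "'a set \<Rightarrow> 'a gword set \<Rightarrow> ('a gword \<times> 'a gword) set"
  for S :: "'a set" and R :: "'a gword set" where
  refl: "x \<in> gwords S \<Longrightarrow> (x, x) \<in> pres_rel S R"
| sym: "(x, y) \<in> pres_rel S R \<Longrightarrow> (y, x) \<in> pres_rel S R"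
| trans: "(x, y) \<in> pres_rel S R \<Longrightarrow> (y, z) \<in> pres_rel S R \<Longrightarrow> (x, z) \<in> pres_rel S R"
| cancel: "x \<in> gwords S \<Longrightarrow> y \<in> gwords S \<Longrightarrow> s \<in> S \<Longrightarrow>
    (x @ [(s, b), (s, \<not> b)] @ y, x @ y) \<in> pres_rel S R"
| relator: "x \<in> gwords S \<Longrightarrow> y \<in> gwords S \<Longrightarrow> r \<in> R \<Longrightarrow> r \<in> gwords S \<Longrightarrow>
    (x @ r @ y, x @ y) \<in> pres_rel S R"

definition presented_group :: "'a set \<Rightarrow> 'a gword set \<Rightarrow> 'a gword set monoid" where
  "presented_group S R =
     \<lparr>carrier = gwords S // pres_rel S R,
      monoid.mult = (\<lambda>A B. \<Union>x\<in>A. \<Union>y\<in>B. pres_rel S R `` {x @ y}),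
      one = pres_rel S R `` {[]}\<rparr>"

section \<open>Right-angled Coxeter groups\<close>

definition racg_relators :: "'a graph \<Rightarrow> 'a gword set" where
  "racg_relators \<Gamma> =
     {[(u, True), (u, True)] | u. u \<in> verts \<Gamma>} \<union>
     {[(u, True), (v, True), (u, False), (v, False)] | u v. {u, v} \<in> edges \<Gamma>}"

definition racg :: "'a graph \<Rightarrow> 'a gword set monoid" where
  "racg \<Gamma> = presented_group (verts \<Gamma>) (racg_relators \<Gamma>)"

definition racg_gen :: "'a graph \<Rightarrow> 'a \<Rightarrow> 'a gword set" where
  "racg_gen \<Gamma> u = pres_rel (verts \<Gamma>) (racg_relators \<Gamma>) `` {[(u, True)]}"

definition commutation_graph :: "('g, 'm) monoid_scheme \<Rightarrow> 'g set \<Rightarrow> 'g graph" where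
  "commutation_graph H S =
     \<lparr>verts = S,
      edges = {{s, t} | s t. s \<in> S \<and> t \<in> S \<and> s \<noteq> t \<and> s \<otimes>\<^bsub>H\<^esub> t = t \<otimes>\<^bsub>H\<^esub> s}\<rparr>"

text \<open>A homomorphism on \<open>racg (commutation_graph H S)\<close> is determined by its values on the
  vertices, so the isomorphism below is the one induced by \<open>s \<mapsto> s\<close>.\<close>

definition racg_basis :: "('g, 'm) monoid_scheme \<Rightarrow> 'g set \<Rightarrow> bool" where
  "racg_basis H S \<longleftrightarrow>
     S \<subseteq> carrier H \<and> generate H S = carrier H \<and>
     (\<exists>\<phi> \<in> iso (racg (commutation_graph H S)) H.
        \<forall>s\<in>S. \<phi> (racg_gen (commutation_graph H S) s) = s)"

section \<open>Word metrics\<close>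

text \<open>The least element below exists whenever \<open>S\<close> generates \<open>G\<close>.\<close>

definition word_length :: "('g, 'm) monoid_scheme \<Rightarrow> 'g set \<Rightarrow> 'g \<Rightarrow> nat" where
  "word_length G S g =
     (LEAST n. \<exists>ws. set ws \<subseteq> S \<union> m_inv G ` S \<and> length ws = n \<and>
        foldr (\<otimes>\<^bsub>G\<^esub>) ws \<one>\<^bsub>G\<^esub> = g)"

definition word_dist :: "('g, 'm) monoid_scheme \<Rightarrow> 'g set \<Rightarrow> 'g \<Rightarrow> 'g \<Rightarrow> nat" where
  "word_dist G S g h = word_length G S (inv\<^bsub>G\<^esub> g \<otimes>\<^bsub>G\<^esub> h)"

definition word_ball :: "('g, 'm) monoid_scheme \<Rightarrow> 'g set \<Rightarrow> 'g \<Rightarrow> nat \<Rightarrow> 'g set" where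
  "word_ball G S g r = {h \<in> carrier G. word_dist G S g h \<le> r}"

definition racg_ball :: "'a graph \<Rightarrow> nat \<Rightarrow> 'a gword set set" where
  "racg_ball \<Gamma> r = word_ball (racg \<Gamma>) (racg_gen \<Gamma> ` verts \<Gamma>) \<one>\<^bsub>racg \<Gamma>\<^esub> r"

end

theory Submission
  imports Defs
begin

text \<open>
  Write \<open>W = C(\<Psi>)\<close> and \<open>m = #V(\<Phi>)\<close>, \<open>n = #V(\<Psi>)\<close>. As \<open>\<Psi>\<close> is triangle-free, an involution of \<open>W\<close> is a
  reflection or a product \<open>AB\<close> of two commuting reflections, and every element commuting with \<open>AB\<close>
  commutes with \<open>A\<close> and \<open>B\<close>. For an embedding of \<open>C(\<Phi>)\<close>, a generator \<open>u\<close> sent to such an \<open>AB\<close> therefore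
  has at most one neighbour \<open>v\<close>, sent to \<open>A\<close> or \<open>B\<close>, and the transvection \<open>u \<mapsto> uv\<close> turns \<open>u\<close> into a
  reflection; an isolated \<open>u\<close> is replaced by \<open>u p u\<close> with \<open>p\<close> a reflection, and if no generator is a
  reflection then \<open>C(\<Phi>)\<close> is a free product of groups of order 2, and \<open>W\<close> contains enough reflections with
  disjoint half-spaces. So \<open>C(\<Phi>)\<close> embeds with all generators
  mapped to reflections. Among these embeddings take one minimising the total distance from 1 to the
  walls. Partial conjugations show that the half-spaces beyond non-adjacent walls are then disjoint
  (ping-pong). If a wall were further than \<open>(1 + 2m) n\<close> away from 1, more than \<open>2m + 1\<close> walls of one
  colour would separate it from 1. Each wall of the system changes its position relative to such a
  chain (beyond, crossing, before) at most twice, so two walls of the chain are in the same position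
  with respect to the whole system, and the strip between them can be cut out, contradicting
  minimality.
\<close>

section \<open>Groups as a type class and words\<close>

text \<open>The geometry is combinatorial throughout: walls are reflections, a half-space is the set
  \<open>half r\<close> of group elements separated from 1 by \<open>r\<close>, and all of it is
  read off the cocycle \<open>N\<close>. Reflections are wanted because ping-pong needs half-spaces,
  and a product of two commuting reflections has none. That \<open>f\<close> embeds C(\<Phi>) is
  expressed by \<open>racg_model \<Phi> f\<close>, the very locale that also describes W; so
  lengths, half-spaces and ping-pong are available both in W and in the embedded copy of C(\<Phi>),
  each with its own reflections. Two facts special to right-angled groups carry the argument:
  conjugation preserves the colour, so conjugate generators are equal, and commuting reflections of
  one colour coincide, so walls of one colour never cross. A reflection conjugate to a letter by an
  element of length d has a word of length 2 d + 1, whence the radius 2 (1 + (1 + 2 m) n). Groups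
  live in a type class so that terms can be rewritten without membership conditions; an abstract
  group enters through its regular representation by bijections.\<close>

class mult_group = monoid_mult + inverse +
  assumes left_inv [simp]: "inverse x * x = 1"

lemma inv_mult_cancel [simp]: "inverse x * (x * y) = (y :: 'g::mult_group)"
  by (simp flip: mult.assoc)

lemma right_inv [simp]: "x * inverse x = (1 :: 'g::mult_group)"
proof -
  have "x * inverse x = inverse (inverse x) * (inverse x * (x * inverse x))"
    by (rule inv_mult_cancel[symmetric])
  also have "\<dots> = inverse (inverse x) * ((inverse x * x) * inverse x)"
    by (simp only: mult.assoc)
  finally show ?thesis by (simp only: left_inv mult_1_left)
qed

lemma mult_inv_cancel [simp]: "x * (inverse x * y) = (y :: 'g::mult_group)"
  by (simp flip: mult.assoc)

lemma inv_eqI: "x * y = 1 \<Longrightarrow> inverse x = (y :: 'g::mult_group)"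
  by (metis inv_mult_cancel mult.right_neutral)

lemma inv_inv [simp]: "inverse (inverse x) = (x :: 'g::mult_group)"
  by (rule inv_eqI) simp

lemma inv_one [simp]: "inverse 1 = (1 :: 'g::mult_group)"
  by (rule inv_eqI) simp

lemma inv_mult [simp]: "inverse (x * y) = inverse y * inverse (x :: 'g::mult_group)"
  by (rule inv_eqI) (simp add: mult.assoc)

lemma left_cancel [simp]: "x * y = x * z \<longleftrightarrow> y = (z :: 'g::mult_group)"
  by (metis inv_mult_cancel)

lemma right_cancel [simp]: "y * x = z * x \<longleftrightarrow> y = (z :: 'g::mult_group)"
  by (metis mult.assoc right_inv mult.right_neutral)

lemma inv_eq_iff [simp]: "inverse x = inverse y \<longleftrightarrow> x = (y :: 'g::mult_group)"
  by (metis inv_inv)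

lemma commute_inv: "x * y = y * x \<Longrightarrow> inverse x * y = y * inverse (x :: 'g::mult_group)"
  by (metis inv_mult_cancel mult.assoc mult.right_neutral right_inv)

lemma commute_mult: "x * z = z * x \<Longrightarrow> y * z = z * y \<Longrightarrow> (x * y) * z = z * (x * y :: 'g::mult_group)"
  by (metis mult.assoc)

lemma conj_commute_iff:
  "(g * x * inverse g) * (g * y * inverse g) = (g * y * inverse g) * (g * x * inverse g)
   \<longleftrightarrow> x * y = y * (x :: 'g::mult_group)"
proof -
  have "(g * x * inverse g) * (g * y * inverse g) = g * (x * y) * inverse g"
    "(g * y * inverse g) * (g * x * inverse g) = g * (y * x) * inverse g"
    by (simp_all add: mult.assoc)
  then show ?thesis by (simp only: left_cancel right_cancel)
qed

typedef 'x bijection = "{f :: 'x \<Rightarrow> 'x. bij f}" morphisms app Bij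
  by (rule exI[of _ id]) simp

lemma bij_app [simp]: "bij (app f)"
  using app by auto

instantiation bijection :: (type) mult_group
begin
definition "1 = Bij id"
definition "f * g = Bij (app f \<circ> app g)"
definition "inverse f = Bij (inv_into UNIV (app f))"
definition "divide f g = f * inverse (g :: 'a bijection)"
instance
  by standard
    (simp_all add: one_bijection_def times_bijection_def inverse_bijection_def Bij_inverse
      app_inverse bij_comp bij_imp_bij_inv comp_assoc bij_is_inj)
end

lemma app_one [simp]: "app 1 = id"
  by (simp add: one_bijection_def Bij_inverse)

lemma app_mult [simp]: "app (f * g) = app f \<circ> app g"
  by (simp add: times_bijection_def Bij_inverse bij_comp)

lemma app_Bij: "bij f \<Longrightarrow> app (Bij f) = f"
  by (simp add: Bij_inverse)

lemma app_Bij_invol: "(\<And>x. f (f x) = x) \<Longrightarrow> app (Bij f) = f"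
  by (simp add: Bij_inverse involuntory_imp_bij)

lemma bijection_eqI: "(\<And>x. app f x = app g x) \<Longrightarrow> f = g"
  by (metis app_inject ext)

abbreviation word_val :: "('a \<Rightarrow> 'g::monoid_mult) \<Rightarrow> 'a list \<Rightarrow> 'g" where
  "word_val f xs \<equiv> prod_list (map f xs)"

lemma word_val_in_commute:
  "(\<And>s. s \<in> set xs \<Longrightarrow> f s * y = y * (f s :: 'g::mult_group)) \<Longrightarrow> word_val f xs * y = y * word_val f xs"
  by (induction xs) (auto intro!: commute_mult)

definition racg_map :: "'a graph \<Rightarrow> ('a \<Rightarrow> 'g::monoid_mult) \<Rightarrow> bool" where
  "racg_map \<Gamma> f \<longleftrightarrow> (\<forall>u\<in>verts \<Gamma>. f u * f u = 1) \<and> (\<forall>u v. {u, v} \<in> edges \<Gamma> \<longrightarrow> f u * f v = f v * f u)"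

definition trivial_word :: "'a graph \<Rightarrow> 'a list \<Rightarrow> bool" where
  "trivial_word \<Gamma> xs \<longleftrightarrow> (map (\<lambda>u. (u, True)) xs, []) \<in> pres_rel (verts \<Gamma>) (racg_relators \<Gamma>)"

lemma edge_verts:
  "simplicial_graph \<Gamma> \<Longrightarrow> {u, v} \<in> edges \<Gamma> \<Longrightarrow> u \<in> verts \<Gamma> \<and> v \<in> verts \<Gamma> \<and> u \<noteq> v"
  by (fastforce simp: simplicial_graph_def)

lemma pres_rel_word_val:
  assumes "(x, y) \<in> pres_rel (verts \<Gamma>) (racg_relators \<Gamma>)" "simplicial_graph \<Gamma>" "racg_map \<Gamma> f"
  shows "word_val f (map fst x) = word_val f (map fst y)"
  using assms(1)
proof induction
  case (cancel x y s b)
  then have "f s * (f s * z) = z" for z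
    using assms(3) by (simp add: racg_map_def flip: mult.assoc)
  then show ?case by simp
next
  case (relator x y r)
  have "word_val f (map fst r) = 1"
  proof -
    consider u where "u \<in> verts \<Gamma>" "r = [(u, True), (u, True)]"
      | u v where "{u, v} \<in> edges \<Gamma>" "r = [(u, True), (v, True), (u, False), (v, False)]"
      using relator(3) by (auto simp: racg_relators_def)
    then show ?thesis
    proof cases
      case 1
      then show ?thesis using assms(3) by (simp add: racg_map_def)
    next
      case 2
      then have "f u * f u = 1" "f v * f v = 1" "f u * f v = f v * f u"
        using assms(3) edge_verts[OF assms(2)] by (auto simp: racg_map_def)
      then show ?thesis
        using 2 by (simp) (metis mult.assoc mult.right_neutral)
    qed
  qed
  then show ?case by simp
qed auto

text \<open>\<open>faithful\<close> is stated on words of the presentation, so a model is any group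
  containing a copy of C(\<Gamma>) with \<open>gen u\<close> in the role of the generator
  \<open>u\<close>; the group may be larger than that copy.\<close>

locale racg_model =
  fixes \<Gamma> :: "'a graph" and gen :: "'a \<Rightarrow> 'g::mult_group"
  assumes simplicial: "simplicial_graph \<Gamma>"
    and gen_map: "racg_map \<Gamma> gen"
    and faithful: "xs \<in> lists (verts \<Gamma>) \<Longrightarrow> word_val gen xs = 1 \<Longrightarrow> trivial_word \<Gamma> xs"
begin

abbreviation "V \<equiv> verts \<Gamma>"
abbreviation "val \<equiv> word_val gen"

definition adj :: "'a \<Rightarrow> 'a \<Rightarrow> bool" where "adj a b \<longleftrightarrow> {a, b} \<in> edges \<Gamma>"

text \<open>Words without inverses give subgroups because the letters of
  \<open>L \<subseteq> V\<close> are involutions. These are the special subgroups, and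
  \<open>W\<close> is the whole copy of C(\<Gamma>).\<close>

definition span :: "'a set \<Rightarrow> 'g set" where "span L = val ` lists L"

abbreviation "W \<equiv> span V"

lemma adj_sym: "adj a b \<longleftrightarrow> adj b a"
  by (simp add: adj_def insert_commute)

lemma adj_verts: "adj a b \<Longrightarrow> a \<in> V \<and> b \<in> V \<and> a \<noteq> b"
  using edge_verts[OF simplicial] by (auto simp: adj_def)

lemma gen_sq [simp]: "s \<in> V \<Longrightarrow> gen s * gen s = 1"
  using gen_map by (simp add: racg_map_def)

lemma gen_gen [simp]: "s \<in> V \<Longrightarrow> gen s * (gen s * x) = x"
  by (simp flip: mult.assoc)

lemma inv_gen [simp]: "s \<in> V \<Longrightarrow> inverse (gen s) = gen s"
  by (rule inv_eqI) simp

lemma adj_commute: "adj a b \<Longrightarrow> gen a * gen b = gen b * gen a"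
  using gen_map unfolding racg_map_def adj_def by blast

lemma inv_val: "xs \<in> lists V \<Longrightarrow> inverse (val xs) = val (rev xs)"
  by (induction xs) auto

text \<open>The word \<open>rev xs @ ys\<close> has value 1, hence is trivial in the presentation,
  and relations pass to any assignment that satisfies them. A homomorphism on \<open>W\<close> can
  therefore be defined by evaluating an arbitrary word.\<close>

lemma universal:
  assumes f: "racg_map \<Gamma> f" and xs: "xs \<in> lists V" and ys: "ys \<in> lists V" and eq: "val xs = val ys"
  shows "word_val f xs = word_val (f :: 'a \<Rightarrow> 'h::mult_group) ys"
proof -
  have *: "word_val f (rev zs) * word_val f zs = 1" if "zs \<in> lists V" for zs
    using that
  proof (induction zs)
    case (Cons z zs)
    then have "f z * (f z * y) = y" for y
      using f by (simp add: racg_map_def flip: mult.assoc)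
    with Cons show ?case by (simp add: mult.assoc)
  qed simp
  have "val (rev xs @ ys) = 1"
    using eq xs inv_val[OF xs] by (metis left_inv map_append prod_list.append)
  then have "trivial_word \<Gamma> (rev xs @ ys)"
    using xs ys by (intro faithful) auto
  then have "word_val f (rev xs @ ys) = 1"
    using pres_rel_word_val[OF _ simplicial f] by (force simp: trivial_word_def comp_def)
  then have "word_val f (rev xs) * word_val f ys = word_val f (rev xs) * word_val f xs"
    using *[OF xs] by simp
  then show ?thesis by simp
qed

lemma one_span [simp]: "1 \<in> span L"
  unfolding span_def by (rule image_eqI[of _ _ "[]"]) auto

lemma gen_span [simp]: "s \<in> L \<Longrightarrow> gen s \<in> span L"
  unfolding span_def by (rule image_eqI[of _ _ "[s]"]) auto

lemma val_span [simp]: "xs \<in> lists L \<Longrightarrow> val xs \<in> span L"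
  unfolding span_def by blast

lemma mult_span [simp]: "x \<in> span L \<Longrightarrow> y \<in> span L \<Longrightarrow> x * y \<in> span L"
  unfolding span_def by (fastforce intro: image_eqI[of _ _ "_ @ _"])

lemma span_mono: "L \<subseteq> M \<Longrightarrow> span L \<subseteq> span M"
  unfolding span_def by (meson image_mono lists_mono)

lemma inv_span: "x \<in> span L \<Longrightarrow> L \<subseteq> V \<Longrightarrow> inverse x \<in> span L"
proof -
  assume "x \<in> span L" "L \<subseteq> V"
  then obtain xs where xs: "xs \<in> lists L" "x = val xs" "xs \<in> lists V"
    by (auto simp: span_def)
  then have "inverse x = val (rev xs)" using inv_val by blast
  then show ?thesis using xs val_span[of "rev xs" L] by (simp only: in_lists_conv_set set_rev)
qed

lemma inv_W [simp]: "x \<in> W \<Longrightarrow> inverse x \<in> W"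
  by (rule inv_span) auto

lemma span_commute:
  "x \<in> span L \<Longrightarrow> (\<And>s. s \<in> L \<Longrightarrow> gen s * y = y * gen s) \<Longrightarrow> x * y = y * x"
  by (auto simp: span_def intro!: word_val_in_commute)

lemma span_induct [consumes 1, case_names one mult]:
  assumes "x \<in> span L" "P 1" "\<And>s y. s \<in> L \<Longrightarrow> y \<in> span L \<Longrightarrow> P y \<Longrightarrow> P (gen s * y)"
  shows "P x"
proof -
  obtain xs where "xs \<in> lists L" "x = val xs" using assms(1) by (auto simp: span_def)
  then show ?thesis by (induction xs arbitrary: x) (auto intro!: assms(2,3) val_span simp: in_lists_conv_set)
qed

section \<open>The reflection cocycle and the colour of an element\<close>

text \<open>The group acts on sets of reflections by \<open>A \<mapsto> N x \<triangle> x A x\<inverse>\<close>; the action of a generator is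
  given below, and \<open>N x\<close> is recovered as the image of the empty set.\<close>

definition flip :: "'a \<Rightarrow> 'g set bijection" where
  "flip s = Bij (\<lambda>A. {t. (t = gen s) \<noteq> (gen s * t * gen s \<in> A)})"

text \<open>The inversion set of Coxeter theory: the reflections whose walls separate 1 from
  \<open>x\<close>. The choice of the word does not matter, by \<open>universal\<close>.\<close>

definition N :: "'g \<Rightarrow> 'g set" where
  "N x = app (word_val flip (SOME xs. xs \<in> lists V \<and> val xs = x)) {}"

lemma conj_gen_eq_iff:
  assumes "s \<in> V" shows "gen s * (t * gen s) = x \<longleftrightarrow> t = gen s * (x * gen s)"
  using assms by (metis gen_gen gen_sq mult.assoc mult.right_neutral)

lemma app_flip: "s \<in> V \<Longrightarrow> app (flip s) A = {t. (t = gen s) \<noteq> (gen s * t * gen s \<in> A)}"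
  unfolding flip_def by (subst app_Bij_invol) (auto simp: conj_gen_eq_iff mult.assoc)

lemma flip_map: "racg_map \<Gamma> flip"
  unfolding racg_map_def
proof (intro conjI ballI allI impI)
  fix u assume "u \<in> V"
  then show "flip u * flip u = 1"
    by (intro bijection_eqI) (auto simp: app_flip conj_gen_eq_iff mult.assoc)
next
  fix u v assume e: "{u, v} \<in> edges \<Gamma>"
  then have uv: "u \<in> V" "v \<in> V" using edge_verts[OF simplicial] by auto
  have c: "gen u * gen v = gen v * gen u" using e adj_commute by (simp add: adj_def)
  have c2: "gen u * (gen v * x) = gen v * (gen u * x)" for x
    using c by (metis mult.assoc)
  have c3: "gen v * gen u * gen v = gen u" "gen u * gen v * gen u = gen v"
    using c uv by (metis gen_gen mult.assoc)+
  show "flip u * flip v = flip v * flip u"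
    using uv by (intro bijection_eqI) (auto simp: app_flip conj_gen_eq_iff c3 mult.assoc c c2)
qed

lemma N_val: "xs \<in> lists V \<Longrightarrow> N (val xs) = app (word_val flip xs) {}"
proof -
  assume xs: "xs \<in> lists V"
  let ?ys = "SOME ys. ys \<in> lists V \<and> val ys = val xs"
  have "?ys \<in> lists V \<and> val ?ys = val xs" by (rule someI) (use xs in auto)
  then have "word_val flip ?ys = word_val flip xs"
    using universal[OF flip_map] xs by blast
  then show ?thesis by (simp add: N_def)
qed

lemma N_one [simp]: "N 1 = {}"
  using N_val[of "[]"] by simp

lemma N_gen [simp]: "s \<in> V \<Longrightarrow> N (gen s) = {gen s}"
  using N_val[of "[s]"] by (simp add: app_flip)

lemma N_gen_mult: "s \<in> V \<Longrightarrow> y \<in> W \<Longrightarrow> t \<in> N (gen s * y) \<longleftrightarrow> (t = gen s) \<noteq> (gen s * t * gen s \<in> N y)"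
proof -
  assume s: "s \<in> V" and "y \<in> W"
  then obtain xs where xs: "xs \<in> lists V" "y = val xs" by (auto simp: span_def)
  have "N (gen s * y) = app (word_val flip (s # xs)) {}"
    using xs s N_val[of "s # xs"] by simp
  then show ?thesis using xs s by (simp add: N_val app_flip)
qed

text \<open>The cocycle identity: a path from 1 to \<open>x * y\<close> through \<open>x\<close>
  crosses a wall an odd number of times exactly when one, but not both, of its two parts
  does.\<close>

lemma N_mult:
  assumes "x \<in> W" "y \<in> W"
  shows "t \<in> N (x * y) \<longleftrightarrow> (t \<in> N x) \<noteq> (inverse x * t * x \<in> N y)"
  using assms(1)
proof (induction arbitrary: t rule: span_induct)
  case (mult s z)
  then show ?case
    using N_gen_mult[of s "z * y" t] N_gen_mult[of s z t] assms(2)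
    by (auto simp: mult.assoc)
qed simp

text \<open>The image in the abelianisation, which is a power of the group of order 2: the letters
  that occur an odd number of times in any word for the element.\<close>

definition colour :: "'g \<Rightarrow> 'a set" where
  "colour x = app (word_val (\<lambda>s. Bij (\<lambda>A. {c. (c = s) \<noteq> (c \<in> A)})) (SOME xs. xs \<in> lists V \<and> val xs = x)) {}"

lemma colour_mult:
  "x \<in> W \<Longrightarrow> y \<in> W \<Longrightarrow> c \<in> colour (x * y) \<longleftrightarrow> (c \<in> colour x) \<noteq> (c \<in> colour y)"
    and colour_one [simp]: "colour 1 = {}"
    and colour_gen [simp]: "s \<in> V \<Longrightarrow> colour (gen s) = {s}"
proof -
  define h :: "'a \<Rightarrow> 'a set bijection" where h_def: "h = (\<lambda>s. Bij (\<lambda>A. {c. (c = s) \<noteq> (c \<in> A)}))"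
  have app_h: "app (h s) A = {c. (c = s) \<noteq> (c \<in> A)}" for s A
    unfolding h_def by (subst app_Bij_invol) auto
  have map: "racg_map \<Gamma> h"
    unfolding racg_map_def by (auto intro!: bijection_eqI simp: app_h)
  have col: "colour (val xs) = app (word_val h xs) {}" if xs: "xs \<in> lists V" for xs
  proof -
    let ?ys = "SOME ys. ys \<in> lists V \<and> val ys = val xs"
    have "?ys \<in> lists V \<and> val ?ys = val xs" by (rule someI) (use xs in auto)
    then have "word_val h ?ys = word_val h xs"
      using universal[OF map] xs by blast
    then show ?thesis by (simp only: colour_def h_def)
  qed
  show "colour 1 = {}" using col[of "[]"] by simp
  show "colour (gen s) = {s}" if "s \<in> V" using that col[of "[s]"] by (simp add: app_h)
  have h: "c \<in> app (word_val h xs) A \<longleftrightarrow> (c \<in> app (word_val h xs) {}) \<noteq> (c \<in> A)" for xs A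
  proof (induction xs)
    case (Cons s xs)
    have "c \<in> app (word_val h (s # xs)) B \<longleftrightarrow> (c = s) \<noteq> (c \<in> app (word_val h xs) B)" for B
      by (simp add: app_h)
    then show ?case using Cons.IH by blast
  qed simp
  assume "x \<in> W" "y \<in> W"
  then obtain xs ys where *: "xs \<in> lists V" "ys \<in> lists V" "x = val xs" "y = val ys"
    by (auto simp: span_def)
  then have "colour (x * y) = app (word_val h (xs @ ys)) {}" using col[of "xs @ ys"] by simp
  moreover have "app (word_val h (xs @ ys)) {} = app (word_val h xs) (app (word_val h ys) {})"
    by simp
  ultimately show "c \<in> colour (x * y) \<longleftrightarrow> (c \<in> colour x) \<noteq> (c \<in> colour y)"
    using h[of xs "app (word_val h ys) {}"] * col by simp
qed

end

lemma conj_eq_iff: "inverse g * t * g = x \<longleftrightarrow> t = g * x * inverse (g :: 'g::mult_group)"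
  by (metis inv_mult_cancel mult.assoc mult.right_neutral right_inv left_inv)

context racg_model
begin

section \<open>Reflections and word length\<close>

lemma span_W: "L \<subseteq> V \<Longrightarrow> x \<in> span L \<Longrightarrow> x \<in> W"
  using span_mono by blast

lemma inj_gen: "a \<in> V \<Longrightarrow> b \<in> V \<Longrightarrow> gen a = gen b \<longleftrightarrow> a = b"
  using colour_gen by (metis singleton_inject)

lemma colour_inv: "x \<in> W \<Longrightarrow> colour (inverse x) = colour x"
proof -
  assume x: "x \<in> W"
  have "c \<in> colour (inverse x) \<longleftrightarrow> c \<in> colour x" for c
    using colour_mult[of "inverse x" x c] x by simp
  then show ?thesis by auto
qed

lemma colour_conj: "g \<in> W \<Longrightarrow> x \<in> W \<Longrightarrow> colour (g * x * inverse g) = colour x"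
  by (auto simp: colour_mult colour_inv)

lemma colour_span: "x \<in> span L \<Longrightarrow> L \<subseteq> V \<Longrightarrow> colour x \<subseteq> L"
proof (induction rule: span_induct)
  case (mult s y)
  then have "s \<in> V" "y \<in> W" using span_W by auto
  then show ?case using mult colour_mult[of "gen s" y] by auto
qed auto

definition refls :: "'g set" where
  "refls = {g * gen a * inverse g | g a. g \<in> W \<and> a \<in> V}"

lemma reflI: "g \<in> W \<Longrightarrow> a \<in> V \<Longrightarrow> g * gen a * inverse g \<in> refls"
  by (auto simp: refls_def)

lemma gen_refl [simp]: "a \<in> V \<Longrightarrow> gen a \<in> refls"
  using reflI[of 1 a] by simp

lemma reflE:
  assumes "t \<in> refls" obtains g a where "g \<in> W" "a \<in> V" "t = g * gen a * inverse g"
  using assms by (auto simp: refls_def)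

lemma refl_W [simp]: "t \<in> refls \<Longrightarrow> t \<in> W"
  by (auto elim!: reflE)

lemma refl_sq [simp]: "t \<in> refls \<Longrightarrow> t * t = 1"
  by (auto elim!: reflE simp: mult.assoc)

lemma refl_refl [simp]: "t \<in> refls \<Longrightarrow> t * (t * x) = x"
  by (simp flip: mult.assoc)

lemma inv_refl [simp]: "t \<in> refls \<Longrightarrow> inverse t = t"
  by (rule inv_eqI) simp

lemma conj_refl: "t \<in> refls \<Longrightarrow> g \<in> W \<Longrightarrow> g * t * inverse g \<in> refls"
proof (elim reflE)
  fix h a assume *: "g \<in> W" "h \<in> W" "a \<in> V" "t = h * gen a * inverse h"
  then have "g * t * inverse g = (g * h) * gen a * inverse (g * h)" by (simp add: mult.assoc)
  then show ?thesis using * reflI by (metis mult_span)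
qed

lemma conj_refl': "t \<in> refls \<Longrightarrow> g \<in> W \<Longrightarrow> inverse g * t * g \<in> refls"
  using conj_refl[of t "inverse g"] by simp

lemma colour_refl: "t \<in> refls \<Longrightarrow> \<exists>a\<in>V. colour t = {a}"
  by (auto elim!: reflE simp: colour_conj)

lemma refl_not_one: "t \<in> refls \<Longrightarrow> t \<noteq> 1"
  by (auto dest: colour_refl)

lemma N_inv: "x \<in> W \<Longrightarrow> t \<in> N (inverse x) \<longleftrightarrow> x * t * inverse x \<in> N x"
  using N_mult[of "inverse x" x t] by auto

lemma refl_in_own: "t \<in> refls \<Longrightarrow> t \<in> N t"
proof (elim reflE)
  fix g a assume *: "g \<in> W" "a \<in> V" "t = g * gen a * inverse g"
  then have "t \<in> N t \<longleftrightarrow> (t \<in> N (g * gen a)) \<noteq> (inverse (g * gen a) * t * (g * gen a) \<in> N (inverse g))"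
    using N_mult[of "g * gen a" "inverse g" t] by simp
  then show ?thesis using * by (simp add: N_mult N_inv mult.assoc)
qed

lemma N_refl_mult: "t \<in> refls \<Longrightarrow> x \<in> W \<Longrightarrow> t \<in> N (t * x) \<longleftrightarrow> t \<notin> N x"
  by (simp add: N_mult refl_in_own mult.assoc)

lemma N_gen_right:
  "g \<in> W \<Longrightarrow> a \<in> V \<Longrightarrow> t \<in> N (g * gen a) \<longleftrightarrow> (t \<in> N g) \<noteq> (t = g * gen a * inverse g)"
  using conj_eq_iff[of g t "gen a"] by (simp add: N_mult)

lemma N_split:
  "xs \<in> lists V \<Longrightarrow> t \<in> N (val xs) \<Longrightarrow>
    \<exists>ys s zs. xs = ys @ s # zs \<and> t = val ys * gen s * inverse (val ys)"
proof (induction xs rule: rev_induct)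
  case (snoc a xs)
  then have xs: "xs \<in> lists V" "a \<in> V" by auto
  show ?case
  proof (cases "t \<in> N (val xs)")
    case True
    then obtain ys s zs where "xs = ys @ s # zs" "t = val ys * gen s * inverse (val ys)"
      using snoc.IH xs by blast
    then show ?thesis by (intro exI[of _ ys] exI[of _ s] exI[of _ "zs @ [a]"]) auto
  next
    case False
    then have "t = val xs * gen a * inverse (val xs)"
      using snoc.prems xs N_gen_right[of "val xs" a t] by simp
    then show ?thesis by blast
  qed
qed simp

lemma N_subset_refls: "x \<in> W \<Longrightarrow> N x \<subseteq> refls"
proof
  fix t assume "x \<in> W" "t \<in> N x"
  then obtain xs where "xs \<in> lists V" "t \<in> N (val xs)" by (auto simp: span_def)
  then obtain ys s zs where "xs = ys @ s # zs" "t = val ys * gen s * inverse (val ys)"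
    using N_split by blast
  then show "t \<in> refls" using \<open>xs \<in> lists V\<close> by (simp add: reflI)
qed

definition len :: "'g \<Rightarrow> nat" where
  "len x = (LEAST n. \<exists>xs\<in>lists V. length xs = n \<and> val xs = x)"

lemma len_le: "xs \<in> lists V \<Longrightarrow> len (val xs) \<le> length xs"
  unfolding len_def by (rule Least_le) auto

lemma reduced_word:
  assumes "x \<in> W" obtains xs where "xs \<in> lists V" "val xs = x" "length xs = len x"
proof -
  obtain ys where ys: "ys \<in> lists V" "val ys = x" using assms by (auto simp: span_def)
  have "\<exists>xs\<in>lists V. length xs = len x \<and> val xs = x"
    unfolding len_def by (rule LeastI[where k = "length ys"]) (use ys in blast)
  then show ?thesis using that by blast
qed

lemma len_one [simp]: "len 1 = 0"
  using len_le[of "[]"] by simp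

lemma len_mult: "x \<in> W \<Longrightarrow> y \<in> W \<Longrightarrow> len (x * y) \<le> len x + len y"
proof -
  assume "x \<in> W" "y \<in> W"
  then obtain xs ys where "xs \<in> lists V" "val xs = x" "length xs = len x"
    "ys \<in> lists V" "val ys = y" "length ys = len y" by (metis reduced_word)
  then show ?thesis using len_le[of "xs @ ys"] by auto
qed

lemma len_inv: "x \<in> W \<Longrightarrow> len (inverse x) = len x"
proof -
  have le: "len (inverse x) \<le> len x" if x: "x \<in> W" for x
  proof -
    obtain xs where "xs \<in> lists V" "val xs = x" "length xs = len x" using reduced_word x by blast
    then show ?thesis using len_le[of "rev xs"] inv_val[of xs]
      by (metis in_lists_conv_set length_rev set_rev)
  qed
  show "x \<in> W \<Longrightarrow> len (inverse x) = len x"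
    using le[of x] le[of "inverse x"] by simp
qed

text \<open>The strong exchange condition: \<open>t\<close> undoes the letter at which the word
  crosses its wall, so that this letter can be deleted.\<close>

lemma exchange:
  assumes "xs \<in> lists V" "t \<in> N (val xs)"
  shows "\<exists>ys s zs. xs = ys @ s # zs \<and> t * val xs = val (ys @ zs)"
proof -
  obtain ys s zs where "xs = ys @ s # zs" "t = val ys * gen s * inverse (val ys)"
    using N_split assms by blast
  then show ?thesis
    using assms by (intro exI[of _ ys] exI[of _ s] exI[of _ zs]) (simp add: mult.assoc)
qed

lemma len_refl_less:
  assumes "x \<in> W" "t \<in> N x" shows "len (t * x) < len x"
proof -
  obtain xs where xs: "xs \<in> lists V" "val xs = x" "length xs = len x" using reduced_word assms by blast
  then obtain ys s zs where "xs = ys @ s # zs" "t * x = val (ys @ zs)" using exchange[of xs t] assms by blast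
  then show ?thesis using len_le[of "ys @ zs"] xs by auto
qed

lemma gen_notin_N:
  "s \<in> V \<Longrightarrow> y \<in> W \<Longrightarrow> gen s \<notin> N y \<Longrightarrow> len (gen s * y) = Suc (len y)"
proof -
  assume *: "s \<in> V" "y \<in> W" "gen s \<notin> N y"
  have "len (gen s) \<le> 1" using len_le[of "[s]"] * by simp
  then have "len (gen s * y) \<le> Suc (len y)" using len_mult[of "gen s" y] * by simp
  moreover have "len y < len (gen s * y)"
    using len_refl_less[of "gen s * y" "gen s"] * by (simp add: N_refl_mult)
  ultimately show ?thesis by simp
qed

lemma gen_in_N:
  "s \<in> V \<Longrightarrow> y \<in> W \<Longrightarrow> gen s \<in> N y \<Longrightarrow> len y = Suc (len (gen s * y))"
  using gen_notin_N[of s "gen s * y"] by (simp add: N_refl_mult)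

text \<open>Putting a letter of \<open>L\<close> in front of a reduced word over \<open>L\<close>
  either lengthens it or, by \<open>exchange\<close>, deletes one of its letters, so shortest words
  never need to leave \<open>L\<close>.\<close>

lemma reduced_word_span:
  assumes "x \<in> span L" "L \<subseteq> V"
  shows "\<exists>xs\<in>lists L. val xs = x \<and> length xs = len x"
  using assms
proof (induction rule: span_induct)
  case one
  then show ?case by (intro bexI[of _ "[]"]) auto
next
  case (mult s y)
  then obtain ys where ys: "ys \<in> lists L" "val ys = y" "length ys = len y" by blast
  have s: "s \<in> V" and y: "y \<in> W" and ysV: "ys \<in> lists V" using mult ys span_W by auto
  show ?case
  proof (cases "gen s \<in> N y")
    case False
    then show ?thesis using ys mult gen_notin_N[OF s y] by (intro bexI[of _ "s # ys"]) auto
  next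
    case True
    then obtain as b bs where *: "ys = as @ b # bs" "gen s * y = val (as @ bs)"
      using exchange[of ys "gen s"] ys ysV by blast
    then show ?thesis using ys gen_in_N[OF s y True] by (intro bexI[of _ "as @ bs"]) auto
  qed
qed

lemma reduced_Cons:
  "a # ys \<in> lists V \<Longrightarrow> len (val (a # ys)) = length (a # ys) \<Longrightarrow>
    len (val ys) = length ys \<and> gen a \<notin> N (val ys)"
proof -
  assume *: "a # ys \<in> lists V" "len (val (a # ys)) = length (a # ys)"
  then have a: "a \<in> V" "ys \<in> lists V" by auto
  then have le: "len (val ys) \<le> length ys" by (intro len_le)
  show ?thesis
  proof (cases "gen a \<in> N (val ys)")
    case True
    then have "len (val ys) = Suc (len (gen a * val ys))" using a by (intro gen_in_N) auto
    then show ?thesis using * le by simp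
  next
    case False
    then have "len (gen a * val ys) = Suc (len (val ys))" using a by (intro gen_notin_N) auto
    then show ?thesis using * False by simp
  qed
qed

lemma span_first:
  assumes "x \<in> span L" "L \<subseteq> V" "x \<noteq> 1"
  shows "\<exists>s\<in>L. gen s \<in> N x"
proof -
  obtain xs where xs: "xs \<in> lists L" "val xs = x" "length xs = len x"
    using reduced_word_span assms by blast
  then obtain a ys where [simp]: "xs = a # ys" using assms by (cases xs) auto
  have "a # ys \<in> lists V" using xs assms by auto
  then have "gen a \<notin> N (val ys)" "a \<in> V" "val ys \<in> W" using reduced_Cons[of a ys] xs by auto
  then have "gen a \<in> N (gen a * val ys)" by (simp only: N_refl_mult gen_refl not_False_eq_True)
  then have "gen a \<in> N x" using xs by simp
  then show ?thesis using xs by auto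
qed

lemma N_span: "x \<in> span L \<Longrightarrow> L \<subseteq> V \<Longrightarrow> t \<in> N x \<Longrightarrow> t \<in> span L"
proof -
  assume *: "x \<in> span L" "L \<subseteq> V" "t \<in> N x"
  then obtain xs where xs: "xs \<in> lists L" "x = val xs" "xs \<in> lists V" by (auto simp: span_def)
  then obtain ys s zs where "xs = ys @ s # zs" "t = val ys * gen s * inverse (val ys)"
    using N_split * by blast
  then show ?thesis using xs * by (auto intro!: mult_span inv_span val_span)
qed

lemma len_induct [consumes 1, case_names less]:
  assumes "x \<in> W" "\<And>x. x \<in> W \<Longrightarrow> (\<And>y. y \<in> W \<Longrightarrow> len y < len x \<Longrightarrow> P y) \<Longrightarrow> P x"
  shows "P x"
  using assms(1)
proof (induction "len x" arbitrary: x rule: less_induct)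
  case less
  then show ?case using assms(2) by blast
qed

lemma N_finite_card: "x \<in> W \<Longrightarrow> finite (N x) \<and> card (N x) = len x"
proof (induction rule: len_induct)
  case (less x)
  show ?case
  proof (cases "x = 1")
    case False
    then obtain s where s: "s \<in> V" "gen s \<in> N x" using span_first less by blast
    let ?y = "gen s * x"
    have y: "?y \<in> W" "len x = Suc (len ?y)" using s less gen_in_N by auto
    then have IH: "finite (N ?y)" "card (N ?y) = len ?y" using less.IH by auto
    have "gen s \<notin> N ?y" using s less by (simp add: N_refl_mult)
    moreover have "N x = insert (gen s) ((\<lambda>t. gen s * (t * gen s)) ` N ?y)"
    proof -
      have "t \<in> N x \<longleftrightarrow> (t = gen s) \<noteq> (gen s * (t * gen s) \<in> N ?y)" for t
        using N_mult[of "gen s" ?y t] s less by (simp add: mult.assoc)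
      moreover have "gen s * (t * gen s) \<in> N ?y \<longleftrightarrow> t \<in> (\<lambda>t. gen s * (t * gen s)) ` N ?y" for t
        using s by (auto simp: image_iff conj_gen_eq_iff mult.assoc intro!: bexI[of _ "gen s * (t * gen s)"])
      ultimately show ?thesis using \<open>gen s \<notin> N ?y\<close> s by (auto simp: conj_gen_eq_iff)
    qed
    moreover have "gen s \<notin> (\<lambda>t. gen s * (t * gen s)) ` N ?y"
      using \<open>gen s \<notin> N ?y\<close> s by (auto simp: conj_gen_eq_iff[of s _ "gen s", symmetric]) (metis conj_gen_eq_iff gen_sq gen_gen mult.right_neutral)
    moreover have "inj_on (\<lambda>t. gen s * (t * gen s)) (N ?y)" by (auto simp: inj_on_def)
    ultimately show ?thesis using IH y by (simp add: card_image)
  qed simp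
qed

lemma len_mult_disjoint:
  assumes "x \<in> W" "y \<in> W" "N (inverse x) \<inter> N y = {}"
  shows "len (x * y) = len x + len y"
proof -
  let ?c = "\<lambda>t. x * t * inverse x"
  have "t \<in> N (x * y) \<longleftrightarrow> t \<in> N x \<union> ?c ` N y" and "t \<notin> N x \<inter> ?c ` N y" for t
  proof -
    have 1: "inverse x * t * x \<in> N y \<longleftrightarrow> t \<in> ?c ` N y"
      by (auto simp: image_iff mult.assoc intro!: bexI[of _ "inverse x * (t * x)"])
    have 2: "t \<in> N x \<longleftrightarrow> inverse x * t * x \<in> N (inverse x)"
      using assms(1) by (simp add: N_inv mult.assoc)
    show "t \<in> N (x * y) \<longleftrightarrow> t \<in> N x \<union> ?c ` N y" "t \<notin> N x \<inter> ?c ` N y"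
      using 1 2 assms N_mult[of x y t] by auto
  qed
  then have "N (x * y) = N x \<union> ?c ` N y" "N x \<inter> ?c ` N y = {}" by auto
  moreover have "inj_on ?c (N y)" by (auto simp: inj_on_def)
  ultimately show ?thesis
    using assms N_finite_card[of x] N_finite_card[of y] N_finite_card[of "x * y"]
    by (simp add: card_Un_disjoint card_image)
qed

text \<open>Otherwise \<open>t\<close> would shorten the prefix \<open>x\<close> and yet lengthen
  \<open>x * y\<close>.\<close>

lemma N_prefix:
  assumes "x \<in> W" "y \<in> W" "len (x * y) = len x + len y" "t \<in> N x"
  shows "t \<in> N (x * y)"
proof (rule ccontr)
  assume "t \<notin> N (x * y)"
  moreover have t: "t \<in> refls" using N_subset_refls assms by blast
  ultimately have "t \<in> N (t * (x * y))" using assms by (simp add: N_refl_mult)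
  then have "len (x * y) < len ((t * x) * y)"
    using len_refl_less[of "t * (x * y)" t] assms t by (simp add: mult.assoc)
  also have "\<dots> \<le> len (t * x) + len y" using assms t by (intro len_mult) auto
  also have "\<dots> < len x + len y" using len_refl_less assms by simp
  finally show False using assms by simp
qed

section \<open>Special subgroups\<close>

text \<open>\<open>w\<close> is a shortest element of the coset \<open>span L * y\<close>: a
  reflection of \<open>span L\<close> separating it from 1 would shorten it further.\<close>

lemma span_decomp:
  assumes y: "y \<in> W" and L: "L \<subseteq> V"
  shows "\<exists>p w. p \<in> span L \<and> w \<in> W \<and> y = p * w \<and> N w \<inter> span L = {}"
proof -
  obtain x where x: "x \<in> span L" and min: "\<And>z. z \<in> span L \<Longrightarrow> len (x * y) \<le> len (z * y)"
    using arg_min_nat_lemma[of "\<lambda>z. z \<in> span L" 1 "\<lambda>z. len (z * y)"] by auto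
  have xW: "x \<in> W" using x L span_W by blast
  have "N (x * y) \<inter> span L = {}"
  proof (rule ccontr)
    assume "\<not> ?thesis"
    then obtain t where t: "t \<in> N (x * y)" "t \<in> span L" by blast
    then have "len ((t * x) * y) < len (x * y)" using len_refl_less[of "x * y" t] xW y by (simp add: mult.assoc)
    then show False using min[of "t * x"] t x by simp
  qed
  then show ?thesis using x xW y L by (intro exI[of _ "inverse x"] exI[of _ "x * y"]) (auto intro: inv_span)
qed

text \<open>Passes from the letters of \<open>L\<close> to all reflections in \<open>span L\<close>:
  if the part of \<open>w\<close> in \<open>span L\<close> were nontrivial, its initial letter would
  also be one of \<open>w\<close>.\<close>

lemma N_coset_disjoint:
  assumes w: "w \<in> W" and L: "L \<subseteq> V" and no: "\<And>s. s \<in> L \<Longrightarrow> gen s \<notin> N w"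
  shows "N w \<inter> span L = {}"
proof -
  obtain p y where py: "p \<in> span L" "y \<in> W" "w = p * y" "N y \<inter> span L = {}"
    using span_decomp[OF w L] by blast
  have "p = 1"
  proof (rule ccontr)
    assume "p \<noteq> 1"
    then obtain s where s: "s \<in> L" "gen s \<in> N p" using span_first py L by blast
    have "inverse p * gen s * p \<in> span L" using s py L by (simp add: inv_span)
    then have "inverse p * gen s * p \<notin> N y" using py by blast
    then have "gen s \<in> N w" using N_mult[of p y "gen s"] s py span_W[OF L] by simp
    then show False using no s by simp
  qed
  then show ?thesis using py by simp
qed

end

section \<open>Walls and half-spaces\<close>

text \<open>The infinite dihedral group acting on the integers: for distinct \<open>a\<close> and
  \<open>b\<close> these letters act as the reflections in -1/2 and 1/2, all others trivially.
  Non-adjacency of \<open>a\<close> and \<open>b\<close> lets the action respect the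
  relations.\<close>

definition dihedral :: "'a \<Rightarrow> 'a \<Rightarrow> 'a \<Rightarrow> int bijection" where
  "dihedral a b s = (if s = a then Bij (\<lambda>n. -1 - n) else if s = b then Bij (\<lambda>n. 1 - n) else 1)"

lemma app_dihedral:
  "app (dihedral a b a) = (\<lambda>n. -1 - n)"
  "a \<noteq> b \<Longrightarrow> app (dihedral a b b) = (\<lambda>n. 1 - n)"
  "s \<noteq> a \<Longrightarrow> s \<noteq> b \<Longrightarrow> dihedral a b s = 1"
  by (auto simp: dihedral_def app_Bij_invol)

lemma dihedral_sq: "dihedral a b s * dihedral a b s = 1"
  by (intro bijection_eqI) (auto simp: dihedral_def app_Bij_invol)

lemma dihedral_map: "{a, b} \<notin> edges \<Gamma> \<Longrightarrow> racg_map \<Gamma> (dihedral a b)"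
  unfolding racg_map_def
  by (auto simp: dihedral_sq doubleton_eq_iff) (auto simp: dihedral_def insert_commute)

context racg_model
begin

lemma distinct_adj_reduced:
  "xs \<in> lists V \<Longrightarrow> len (val xs) = length xs \<Longrightarrow> distinct_adj xs"
proof (induction xs)
  case (Cons a xs)
  have "len (val xs) = length xs" "gen a \<notin> N (val xs)" using reduced_Cons Cons.prems by auto
  moreover have "a \<noteq> hd xs" if ne: "xs \<noteq> []"
  proof
    assume "a = hd xs"
    then obtain ys where xs: "xs = a # ys" using ne by (cases xs) auto
    then have "gen a \<notin> N (val ys)" using reduced_Cons[of a ys] Cons.prems calculation by auto
    moreover have "a \<in> V" "val ys \<in> W" using Cons.prems xs by auto
    ultimately have "gen a \<in> N (gen a * val ys)" by (simp only: N_refl_mult gen_refl not_False_eq_True)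
    then show False using \<open>gen a \<notin> N (val xs)\<close> xs by simp
  qed
  ultimately show ?case using Cons by (cases xs) auto
qed simp

text \<open>Applied from the right end, the alternating letters push the base point 0 ever further
  out, changing sides each time; the head is applied last and decides the side.\<close>

lemma dihedral_sign:
  assumes "a \<noteq> b"
  shows "xs \<in> lists {a, b} \<Longrightarrow> distinct_adj xs \<Longrightarrow> xs \<noteq> [] \<Longrightarrow>
    (if hd xs = a then app (word_val (dihedral a b) xs) 0 < 0 else app (word_val (dihedral a b) xs) 0 > 0)"
proof (induction xs)
  case (Cons s xs)
  then show ?case using assms
    by (cases xs) (auto simp: app_dihedral split: if_splits)
qed simp

text \<open>If \<open>a\<close> and \<open>b\<close> were not adjacent, the part of \<open>y\<close>
  in the infinite dihedral group \<open>span {a, b}\<close> would have a reduced word beginning with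
  \<open>a\<close> and another beginning with \<open>b\<close>, against
  \<open>dihedral_sign\<close>.\<close>

lemma simple_in_N_adj:
  assumes y: "y \<in> W" and ab: "a \<in> V" "b \<in> V" "a \<noteq> b" "gen a \<in> N y" "gen b \<in> N y"
  shows "adj a b"
proof (rule ccontr)
  assume "\<not> adj a b"
  then have map: "racg_map \<Gamma> (dihedral a b)" by (intro dihedral_map) (simp add: adj_def)
  have L: "{a, b} \<subseteq> V" using ab by auto
  obtain p w where pw: "p \<in> span {a, b}" "w \<in> W" "y = p * w" "N w \<inter> span {a, b} = {}"
    using span_decomp[OF y L] by auto
  have p: "p \<in> W" using pw L span_W by blast
  have inp: "gen s \<in> N p" if "s \<in> {a, b}" for s
  proof -
    have "inverse p * gen s * p \<in> span {a, b}" using that pw L by (simp add: inv_span)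
    then have "inverse p * gen s * p \<notin> N w" using pw by blast
    then show ?thesis using N_mult[of p w "gen s"] pw p that ab by auto
  qed
  have *: "\<exists>xs \<in> lists {a, b}. val xs = p \<and> distinct_adj xs \<and> xs \<noteq> [] \<and> hd xs = s" if s: "s \<in> {a, b}" for s
  proof -
    have sV: "s \<in> V" using s ab by auto
    have "gen s * p \<in> span {a, b}" using s pw by simp
    then obtain xs where xs: "xs \<in> lists {a, b}" "val xs = gen s * p" "length xs = len (gen s * p)"
      using reduced_word_span L by blast
    have "val (s # xs) = p" using xs sV by simp
    moreover have "length (s # xs) = len p" using xs gen_in_N[OF sV p inp[OF s]] by simp
    moreover have "s # xs \<in> lists {a, b}" using xs s by auto
    ultimately show ?thesis using distinct_adj_reduced[of "s # xs"] L
      by (intro bexI[of _ "s # xs"]) (use lists_mono[OF L] in auto)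
  qed
  obtain xs ys where "xs \<in> lists {a, b}" "val xs = p" "distinct_adj xs" "xs \<noteq> []" "hd xs = a"
    and "ys \<in> lists {a, b}" "val ys = p" "distinct_adj ys" "ys \<noteq> []" "hd ys = b"
    using *[of a] *[of b] by auto
  moreover from this have "word_val (dihedral a b) xs = word_val (dihedral a b) ys"
    using L lists_mono[OF L] by (intro universal[OF map]) auto
  ultimately show False
    using dihedral_sign[OF ab(3), of xs] dihedral_sign[OF ab(3), of ys] ab(3) by auto
qed

section \<open>Centralisers of generators\<close>

definition star :: "'a \<Rightarrow> 'a set" where "star b = {s \<in> V. s = b \<or> adj b s}"

lemma star_V: "star b \<subseteq> V"
  by (auto simp: star_def)

lemma star_commute: "s \<in> star b \<Longrightarrow> gen s * gen b = gen b * gen s"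
  using adj_commute[of b s] by (auto simp: star_def)

lemma span_star_commute: "x \<in> span (star b) \<Longrightarrow> x * gen b = gen b * x"
  by (erule span_commute) (rule star_commute)

text \<open>If \<open>b\<close> is not an initial letter of \<open>x\<close>, it is one of
  \<open>x * gen b = gen b * x\<close>, and so is every initial letter \<open>c\<close> of
  \<open>x\<close>. Hence \<open>c\<close> is adjacent to \<open>b\<close>, can be stripped, and the
  rest still commutes with \<open>gen b\<close>.\<close>

lemma centralizer_gen:
  assumes "x \<in> W" "b \<in> V" "x * gen b = gen b * x"
  shows "x \<in> span (star b)"
  using assms(1,3)
proof (induction rule: len_induct)
  case (less x)
  have rec: "x \<in> span (star b)" if c: "c \<in> star b" and cN: "gen c \<in> N x" for c
  proof -
    have cV: "c \<in> V" using c star_V by blast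
    have "(gen c * x) * gen b = gen b * (gen c * x)"
      using less.prems c star_commute[of c b] by (metis mult.assoc)
    moreover have "len (gen c * x) < len x" using gen_in_N[OF cV _ cN] less by simp
    ultimately have "gen c * x \<in> span (star b)" using less cV by simp
    then have "gen c * (gen c * x) \<in> span (star b)" using mult_span[OF gen_span[OF c]] by blast
    then show ?thesis using cV by simp
  qed
  show ?case
  proof (cases "x = 1")
    case False
    then obtain c where c: "c \<in> V" "gen c \<in> N x" using span_first less by blast
    have bs: "b \<in> star b" using assms by (simp add: star_def)
    show ?thesis
    proof (cases "gen b \<in> N x")
      case False
      have "x * gen b * inverse x = gen b" using less.prems by (simp add: mult.assoc)
      then have "gen b \<in> N (x * gen b)" "gen c \<in> N (x * gen b)"
        using N_gen_right[of x b] less c False assms by (auto simp: inj_gen)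
      then have "c = b \<or> adj c b" using simple_in_N_adj[of "x * gen b" c b] less assms c by auto
      then show ?thesis using rec[of c] c by (auto simp: star_def adj_sym)
    qed (use rec bs in auto)
  qed simp
qed

section \<open>Half-spaces and the relative position of two walls\<close>

definition half :: "'g \<Rightarrow> 'g set" where "half r = {x \<in> W. r \<in> N x}"

text \<open>A geodesic from \<open>x\<close> to \<open>y\<close> crosses the wall of
  \<open>t\<close> along some edge from \<open>z\<close> to \<open>z * gen b\<close>, but never the
  wall of \<open>r\<close>, because a geodesic crosses no wall that fails to separate its
  ends.\<close>

lemma wall_edge:
  assumes "r \<in> refls" "t \<in> refls" "x \<in> W" "y \<in> W" "r \<in> N x \<longleftrightarrow> r \<in> N y" "(t \<in> N x) \<noteq> (t \<in> N y)"
  shows "\<exists>z\<in>W. \<exists>b\<in>V. t = z * gen b * inverse z \<and> (r \<in> N z \<longleftrightarrow> r \<in> N x)"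
proof -
  let ?d = "inverse x * y"
  have side: "inverse x * s * x \<in> N ?d \<longleftrightarrow> (s \<in> N x) \<noteq> (s \<in> N y)" for s
    using N_mult[of x ?d s] assms by auto
  obtain ws where ws: "ws \<in> lists V" "val ws = ?d" "length ws = len ?d"
    using reduced_word[of ?d] assms by auto
  have "inverse x * t * x \<in> N (val ws)" using side assms ws by simp
  then obtain us b vs where uv: "ws = us @ b # vs" "inverse x * t * x = val us * gen b * inverse (val us)"
    using N_split ws by blast
  have in_lists: "us \<in> lists V" "b \<in> V" "b # vs \<in> lists V" using uv ws by auto
  have W: "val us \<in> W" "val (b # vs) \<in> W" using in_lists val_span by blast+
  have "len ?d = len (val us) + len (val (b # vs))"
  proof -
    have "val us * val (b # vs) = ?d" using ws uv by simp
    then have "len ?d \<le> len (val us) + len (val (b # vs))" using len_mult[OF W] by simp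
    moreover have "len (val us) \<le> length us" "len (val (b # vs)) \<le> length (b # vs)"
      using len_le in_lists by blast+
    ultimately show ?thesis using ws uv by simp
  qed
  moreover have "val us * val (b # vs) = ?d" using ws uv by simp
  ultimately have sub: "N (val us) \<subseteq> N ?d" using N_prefix[OF W] by auto
  have "inverse x * r * x \<notin> N (val us)" using side[of r] assms sub by blast
  then have "r \<in> N (x * val us) \<longleftrightarrow> r \<in> N x" using N_mult[of x "val us" r] W assms by auto
  moreover have "t = x * (val us * gen b * inverse (val us)) * inverse x"
    using uv(2) conj_eq_iff[of x t] by metis
  then have "t = (x * val us) * gen b * inverse (x * val us)" by (simp add: mult.assoc)
  ultimately show ?thesis using W in_lists assms by (intro bexI[of _ "x * val us"] bexI[of _ b]) auto
qed

lemma conj_commute_cancel: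
  "(inverse g * x * g) * (inverse g * y * g) = (inverse g * y * g) * (inverse g * x * g)
   \<longleftrightarrow> x * y = y * (x :: 'g)"
  using conj_commute_iff[of "inverse g" x y] by simp

text \<open>As 1 lies in the fourth quadrant of the two walls, all four are inhabited, and the wall
  of \<open>t\<close> has edges on both sides of the wall of \<open>r\<close>. The element carrying
  one of these edges to the other centralises a generator; it lies in the special subgroup of a
  star, which then also contains the conjugate of \<open>r\<close> that it crosses.\<close>

lemma crossing_commute:
  assumes r: "r \<in> refls" and t: "t \<in> refls"
    and "x \<in> half r \<inter> half t" "y \<in> half r - half t" "z \<in> half t - half r"
  shows "r * t = t * r"
proof -
  have xyz: "x \<in> W" "y \<in> W" "z \<in> W" "r \<in> N x" "t \<in> N x" "r \<in> N y" "t \<notin> N y" "t \<in> N z" "r \<notin> N z"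
    using assms by (auto simp: half_def)
  obtain u b where u: "u \<in> W" "b \<in> V" "t = u * gen b * inverse u" "r \<notin> N u"
    using wall_edge[OF r t, of 1 z] xyz by auto
  obtain v c where v: "v \<in> W" "c \<in> V" "t = v * gen c * inverse v" "r \<in> N v"
    using wall_edge[OF r t, of x y] xyz by auto
  have "b = c" using colour_conj[of u "gen b"] colour_conj[of v "gen c"] u v by simp
  let ?e = "inverse u * v"
  have "?e * gen b = gen b * ?e"
  proof -
    have "u * gen b * inverse u = v * gen b * inverse v" using u v \<open>b = c\<close> by simp
    then have "inverse u * (u * gen b * inverse u) * v = inverse u * (v * gen b * inverse v) * v" by simp
    then show ?thesis by (simp add: mult.assoc)
  qed
  then have e: "?e \<in> span (star b)" using u v by (intro centralizer_gen) auto
  have "inverse u * r * u \<in> N ?e" using N_mult[of u ?e r] u v by simp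
  then have "inverse u * r * u \<in> span (star b)" using N_span e star_V by blast
  then have "(inverse u * r * u) * gen b = gen b * (inverse u * r * u)" by (rule span_star_commute)
  moreover have "gen b = inverse u * t * u" using u by (simp add: mult.assoc)
  ultimately show ?thesis using conj_commute_cancel by metis
qed

lemma half_trichotomy:
  "r \<in> refls \<Longrightarrow> t \<in> refls \<Longrightarrow> r * t \<noteq> t * r \<Longrightarrow>
    half r \<inter> half t = {} \<or> half r \<subseteq> half t \<or> half t \<subseteq> half r"
  using crossing_commute by blast

lemma commute_notin_N:
  assumes "r \<in> refls" "t \<in> refls" "r \<noteq> t" "r * t = t * r" shows "r \<notin> N t"
proof -
  obtain g a where *: "g \<in> W" "a \<in> V" "t = g * gen a * inverse g" using assms by (auto elim: reflE)
  have "inverse g * r * g \<in> N (inverse g * t * g) \<longleftrightarrow> False"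
  proof -
    have "inverse g * t * g = gen a" using * by (simp add: mult.assoc)
    moreover have "inverse g * r * g \<noteq> gen a" using * assms conj_eq_iff by metis
    ultimately show ?thesis using * by simp
  qed
  moreover have "r \<in> N t \<longleftrightarrow> inverse g * r * g \<in> N (inverse g * t * g)"
  proof -
    have 1: "r \<in> N t \<longleftrightarrow> (r \<in> N (t * g)) \<noteq> (inverse (t * g) * r * (t * g) \<in> N (inverse g))"
      using N_mult[of "t * g" "inverse g" r] * assms by (simp add: mult.assoc)
    have 2: "inverse (t * g) * r * (t * g) = inverse g * r * g"
      using assms by (simp add: mult.assoc) (metis mult.assoc refl_refl)
    have 3: "inverse g * r * g \<in> N (inverse g * t * g) \<longleftrightarrow> (inverse g * r * g \<in> N (inverse g)) \<noteq> (r \<in> N (t * g))"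
      using N_mult[of "inverse g" "t * g" "inverse g * r * g"] * assms by (simp add: mult.assoc)
    show ?thesis using 1 2 3 by auto
  qed
  ultimately show ?thesis by simp
qed

lemma commute_half_iff:
  assumes "r \<in> refls" "t \<in> refls" "r \<noteq> t" "r * t = t * r" "x \<in> W"
  shows "t * x \<in> half r \<longleftrightarrow> x \<in> half r"
proof -
  have "t * r * t = r" using assms by (metis mult.assoc refl_sq mult.right_neutral)
  then show ?thesis using assms commute_notin_N[of r t] by (auto simp: half_def N_mult)
qed

lemma own_half_iff: "r \<in> refls \<Longrightarrow> x \<in> W \<Longrightarrow> r * x \<in> half r \<longleftrightarrow> x \<notin> half r"
  by (simp add: half_def N_refl_mult)

lemma own_half: "r \<in> refls \<Longrightarrow> r \<in> half r"
  by (simp add: half_def refl_in_own)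

lemma one_notin_half [simp]: "1 \<notin> half r"
  by (simp add: half_def)

lemma crossing_corners:
  assumes "r \<in> refls" "t \<in> refls" "r \<noteq> t" "r * t = t * r"
  shows "r * t \<in> half r \<inter> half t" "r \<in> half r - half t"
proof -
  have "t \<notin> half r" using commute_half_iff[OF assms, of 1] by simp
  then have "r * t \<in> half r" using own_half_iff[of r t] assms(1,2) by (simp only: refl_W not_False_eq_True)
  moreover have "r \<notin> half t" using commute_half_iff[of t r 1] assms by simp
  then have "t * r \<in> half t" using own_half_iff[of t r] assms(1,2) by (simp only: refl_W not_False_eq_True)
  ultimately show "r * t \<in> half r \<inter> half t" "r \<in> half r - half t"
    using assms own_half \<open>r \<notin> half t\<close> by auto
qed

text \<open>A conjugation may swap the sides of a wall, as \<open>half r\<close> is always the side not containing 1;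
  a single point \<open>p\<close> decides.\<close>

lemma half_conj:
  assumes r: "r \<in> refls" and g: "g \<in> W" and x: "x \<in> W"
    and p: "p \<in> W" "p \<in> half r \<longleftrightarrow> g * p \<in> half (g * r * inverse g)"
  shows "g * x \<in> half (g * r * inverse g) \<longleftrightarrow> x \<in> half r"
proof -
  have "g * y \<in> half (g * r * inverse g) \<longleftrightarrow> (g * r * inverse g \<in> N g) \<noteq> (y \<in> half r)" if "y \<in> W" for y
    using N_mult[of g y "g * r * inverse g"] g that by (simp add: half_def mult.assoc)
  then show ?thesis using p x by blast
qed

lemma half_refl_conj_subset:
  assumes r: "r \<in> refls" and t: "t \<in> refls" and dis: "half r \<inter> half t = {}"
  shows "half (r * t * r) \<subseteq> half r"
proof
  fix y assume y: "y \<in> half (r * t * r)"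
  then have yW: "y \<in> W" "r * t * r \<in> N y" by (auto simp: half_def)
  show "y \<in> half r"
  proof (rule ccontr)
    assume "y \<notin> half r"
    then have "r * y \<in> half r" using own_half_iff r yW by simp
    moreover have "t \<notin> N r" using refl_in_own[OF r] dis refl_W[OF r] by (auto simp: half_def)
    then have "r * y \<in> half t" using N_mult[of r y t] r yW by (simp add: half_def)
    ultimately show False using dis by blast
  qed
qed


section \<open>Double cosets of special subgroups\<close>

text \<open>Here \<open>w\<close> is shortest in its double coset. Comparing lengths shows that the
  conjugate by \<open>w\<close> of an initial letter \<open>s\<close> of \<open>x\<close> has length
  1, so it is a generator; colours force it to be \<open>gen s\<close> itself, where a general
  Coxeter group would allow another letter.\<close>

lemma double_coset_commute:
  assumes L: "L \<subseteq> V" and w: "w \<in> W" "N w \<inter> span L = {}" "N (inverse w) \<inter> span L = {}"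
    and x: "x \<in> span L" "inverse w * x * w \<in> span L"
  shows "x \<in> span {s \<in> L. gen s * w = w * gen s}"
proof -
  let ?Z = "{s \<in> L. gen s * w = w * gen s}"
  have "x \<in> W" using x L span_W by blast
  then show ?thesis using x
  proof (induction rule: len_induct)
    case (less x)
    show ?case
    proof (cases "x = 1")
      case False
      then obtain s where s: "s \<in> L" "gen s \<in> N x" using span_first less L by blast
      have sV: "s \<in> V" using s L by blast
      let ?x' = "inverse w * x * w"
      have x': "?x' \<in> W" using less w by simp
      have eq: "x * w = w * ?x'" by (simp add: mult.assoc)
      have "inverse x * gen s * x \<in> span L" using s less.prems L by (simp add: inv_span)
      then have "inverse x * gen s * x \<notin> N w" using w by blast
      then have "gen s \<in> N (x * w)" using N_mult[of x w "gen s"] s less w by simp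
      moreover have "gen s \<notin> N w" using w s by auto
      ultimately have r: "inverse w * gen s * w \<in> N ?x'"
        using N_mult[of w ?x' "gen s"] eq w x' by simp
      let ?r = "inverse w * gen s * w"
      have rr: "?r \<in> refls" using r N_subset_refls x' by blast
      have rL: "?r \<in> span L" using r N_span less.prems L by blast
      have "N (inverse w) \<inter> N ?r = {}" using N_span[OF rL L] w by blast
      then have "len (w * ?r) = len w + len ?r" using w rr by (intro len_mult_disjoint) auto
      moreover have "w * ?r = gen s * w" by (simp add: mult.assoc)
      moreover have "len (gen s * w) = Suc (len w)" using gen_notin_N[of s w] sV w \<open>gen s \<notin> N w\<close> by simp
      ultimately have "len ?r = 1" by simp
      then obtain as where as: "as \<in> lists V" "val as = ?r" "length as = 1"
        using reduced_word[of ?r] rr by (metis refl_W)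
      then obtain a where a: "a \<in> V" "?r = gen a" by (cases as) auto
      have "colour ?r = {s}" using colour_conj[of "inverse w" "gen s"] w sV by simp
      then have "a = s" using a by simp
      then have comm: "gen s * w = w * gen s" using a conj_eq_iff[of w "gen s"]
        by (metis \<open>w * ?r = gen s * w\<close>)
      have "inverse w * (gen s * x) * w = gen s * ?x'"
      proof -
        have "inverse w * (gen s * x) * w = (inverse w * gen s * w) * ?x'" by (simp add: mult.assoc)
        then show ?thesis using a \<open>a = s\<close> by simp
      qed
      then have "inverse w * (gen s * x) * w \<in> span L" using less.prems s mult_span[of "gen s" L ?x'] by simp
      moreover have "len (gen s * x) < len x" using gen_in_N[of s x] sV less s by simp
      ultimately have "gen s * x \<in> span ?Z" using less s sV by simp
      moreover have "gen s \<in> span ?Z" using s comm by simp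
      ultimately have "gen s * (gen s * x) \<in> span ?Z" using mult_span by blast
      then show ?thesis using sV by simp
    qed simp
  qed
qed

text \<open>The part of \<open>p\<close> commuting with \<open>w\<close> is moved across
  \<open>w\<close> into \<open>q\<close>. What is left on the two sides of \<open>w\<close>
  multiplies with it without cancellation, and the product of the two remainders is still
  \<open>p * q\<close>.\<close>

lemma double_coset_len:
  assumes L: "L \<subseteq> V" and w: "w \<in> W" "N w \<inter> span L = {}" "N (inverse w) \<inter> span L = {}"
    and pq: "p \<in> span L" "q \<in> span L"
  shows "len (p * q) + len w \<le> len (p * w * q)"
proof -
  let ?Z = "{s \<in> L. gen s * w = w * gen s}"
  have Z: "?Z \<subseteq> V" "span ?Z \<subseteq> span L" using L span_mono[of ?Z L] by auto
  have pW: "p \<in> W" "q \<in> W" using pq L span_W by auto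
  obtain z u where zu: "z \<in> span ?Z" "u \<in> W" "inverse p = z * u" "N u \<inter> span ?Z = {}"
    using span_decomp[of "inverse p" ?Z] pW Z by auto
  let ?p = "inverse u" and ?z = "inverse z"
  have p: "p = ?p * ?z" using arg_cong[OF zu(3), of inverse] by simp
  have z: "?z \<in> span ?Z" "?z \<in> span L" "z \<in> span L" using inv_span zu Z by auto
  have zW: "z \<in> W" "?z \<in> W" using z L span_W by auto
  have zw: "?z * w = w * ?z" using z(1) by (rule span_commute) auto
  have p': "u \<in> span L"
  proof -
    have "u = ?z * inverse p" using zu by simp
    then show ?thesis using z inv_span pq L by simp
  qed
  let ?q = "?z * q"
  have q: "?q \<in> span L" "?q \<in> W" using z pq zW pW by auto
  have "N (inverse w) \<inter> N ?q = {}" using N_span[OF q(1) L] w by blast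
  then have 1: "len (w * ?q) = len w + len ?q" using w q by (intro len_mult_disjoint) auto
  have "N u \<inter> N (w * ?q) = {}"
  proof (rule ccontr)
    assume "\<not> ?thesis"
    then obtain t where t: "t \<in> N u" "t \<in> N (w * ?q)" by blast
    have tL: "t \<in> span L" using N_span p' L t by blast
    then have "t \<notin> N w" using w by blast
    then have "inverse w * t * w \<in> N ?q" using N_mult[of w ?q t] t w q by simp
    then have "inverse w * t * w \<in> span L" using N_span q L by blast
    then have "t \<in> span ?Z" using double_coset_commute[OF L w tL] by blast
    then show False using zu t by blast
  qed
  then have "len (?p * (w * ?q)) = len ?p + len (w * ?q)" using zu w q by (intro len_mult_disjoint) auto
  moreover have "?p * (w * ?q) = p * w * q" using p zw by (metis mult.assoc)
  moreover have "len (p * q) \<le> len ?p + len ?q" using len_mult[of ?p ?q] zu q p by (simp add: mult.assoc)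
  ultimately show ?thesis using 1 by simp
qed

section \<open>Involutions\<close>

lemma commuting_simple_involution:
  assumes "y \<in> W" "y * y = 1" "\<And>s. s \<in> V \<Longrightarrow> gen s \<in> N y \<Longrightarrow> gen s * y = y * gen s"
  shows "\<exists>C\<subseteq>V. (\<forall>a\<in>C. gen a \<in> N y) \<and> y \<in> span C \<and> colour y = C"
  using assms
proof (induction rule: len_induct)
  case (less y)
  show ?case
  proof (cases "y = 1")
    case True
    then show ?thesis by (intro exI[of _ "{}"]) auto
  next
    case False
    then obtain s where s: "s \<in> V" "gen s \<in> N y" using span_first less by blast
    let ?z = "gen s * y"
    have sy: "gen s * y = y * gen s" using less s by simp
    have z: "?z \<in> W" "len ?z < len y" using less s gen_in_N[of s y] by auto
    have zz: "?z * ?z = 1" using sy less s by (metis gen_sq mult.assoc mult.right_neutral)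
    have snz: "gen s \<notin> N ?z" using N_refl_mult[OF gen_refl[OF s(1)] \<open>y \<in> W\<close>] s by blast
    have Nz: "gen t \<in> N y" if t: "t \<in> V" "gen t \<in> N ?z" for t
    proof -
      have "gen t \<noteq> gen s" using t snz by auto
      have "gen t \<in> N (y * gen s)" using t sy by simp
      then have "gen t \<in> N y \<or> gen t = y * gen s * inverse y" using N_gen_right less s by blast
      moreover have "y * gen s * inverse y = gen s" using sy by (simp add: mult.assoc flip: sy)
      ultimately show ?thesis using \<open>gen t \<noteq> gen s\<close> by simp
    qed
    have "gen t * ?z = ?z * gen t" if t: "t \<in> V" "gen t \<in> N ?z" for t
    proof -
      have ty: "gen t * y = y * gen t" using Nz t less by simp
      have "t \<noteq> s" using t snz by auto
      then have "adj t s" using simple_in_N_adj[of y t s] Nz t s less by simp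
      then show ?thesis using adj_commute ty by (metis mult.assoc)
    qed
    then obtain C where C: "C \<subseteq> V" "\<forall>a\<in>C. gen a \<in> N ?z" "?z \<in> span C" "colour ?z = C"
      using less.IH[OF z zz] by blast
    have "s \<notin> C" using C snz by auto
    have "?z \<in> span (insert s C)" using C(3) span_mono[of C "insert s C"] by blast
    then have "gen s * ?z \<in> span (insert s C)" by (rule mult_span[OF gen_span[OF insertI1]])
    then have "y \<in> span (insert s C)" using gen_gen[OF s(1), of y] by simp
    moreover have "colour y = insert s C"
    proof -
      have "c \<in> colour (gen s * ?z) \<longleftrightarrow> (c = s) \<noteq> (c \<in> C)" for c
        using colour_mult[of "gen s" ?z c] s z C by simp
      then show ?thesis using s \<open>s \<notin> C\<close> by auto
    qed
    moreover have "\<forall>a\<in>insert s C. gen a \<in> N y" using C Nz s by blast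
    ultimately show ?thesis using C s by (intro exI[of _ "insert s C"]) auto
  qed
qed

text \<open>A conjugate of minimal length of an involution commutes with all of its initial letters.\<close>

lemma involution_conj:
  assumes "x \<in> W" "x * x = 1"
  shows "\<exists>g\<in>W. \<exists>y\<in>W. \<exists>C\<subseteq>V. x = g * y * inverse g \<and> y \<in> span C \<and> colour y = C \<and>
    (\<forall>a\<in>C. \<forall>b\<in>C. a \<noteq> b \<longrightarrow> adj a b)"
proof -
  obtain g where g: "g \<in> W" and min: "\<And>h. h \<in> W \<Longrightarrow> len (inverse g * x * g) \<le> len (inverse h * x * h)"
    using arg_min_nat_lemma[of "\<lambda>g. g \<in> W" 1 "\<lambda>g. len (inverse g * x * g)"] by auto
  let ?y = "inverse g * x * g"
  have y: "?y \<in> W" using g assms by simp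
  have "?y * ?y = inverse g * (x * x) * g" by (simp only: mult.assoc mult_inv_cancel)
  then have yy: "?y * ?y = 1" using assms by simp
  then have inv: "inverse ?y = ?y" by (rule inv_eqI)
  have comm: "gen s * ?y = ?y * gen s" if s: "s \<in> V" "gen s \<in> N ?y" for s
  proof (rule ccontr)
    assume nc: "gen s * ?y \<noteq> ?y * gen s"
    let ?z = "?y * gen s"
    have "?y * gen s * inverse ?y \<noteq> gen s"
      using nc by (metis conj_eq_iff inv_mult_cancel mult.assoc mult_inv_cancel)
    then have "gen s \<in> N ?z" using N_gen_right[of ?y s "gen s"] y s by auto
    then have "len (gen s * ?z) < len ?z" using gen_in_N[of s ?z] s y by simp
    moreover have "len ?z = len (gen s * ?y)"
      using len_inv[of ?z] inv y s by (metis gen_span inv_gen inv_mult mult_span)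
    moreover have "len (gen s * ?y) < len ?y" using gen_in_N[of s ?y] s y by simp
    moreover have "gen s * ?z = inverse (g * gen s) * x * (g * gen s)" using s by (simp add: mult.assoc)
    ultimately show False using min[of "g * gen s"] g s by simp
  qed
  obtain C where "C \<subseteq> V" "\<forall>a\<in>C. gen a \<in> N ?y" "?y \<in> span C" "colour ?y = C"
    using commuting_simple_involution[OF y yy comm] by blast
  moreover from this have "\<forall>a\<in>C. \<forall>b\<in>C. a \<noteq> b \<longrightarrow> adj a b"
    using simple_in_N_adj y by blast
  moreover have "x = g * ?y * inverse g" by (simp add: mult.assoc)
  ultimately show ?thesis using g y by blast
qed

lemma involution_colour_trivial:
  assumes "x \<in> W" "x * x = 1" "colour x = {}" shows "x = 1"
proof -
  obtain g y C where *: "g \<in> W" "y \<in> W" "x = g * y * inverse g" "y \<in> span C" "colour y = C"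
    using involution_conj[OF assms(1,2)] by blast
  then have "C = {}" using colour_conj assms by simp
  then have "y = 1" using *(4) by (simp add: span_def)
  then show ?thesis using * by simp
qed

lemma involution_colour_clique:
  assumes "x \<in> W" "x * x = 1" "a \<in> colour x" "b \<in> colour x" "a \<noteq> b" shows "adj a b"
proof -
  obtain g y C where *: "g \<in> W" "y \<in> W" "x = g * y * inverse g" "colour y = C"
    "\<forall>a\<in>C. \<forall>b\<in>C. a \<noteq> b \<longrightarrow> adj a b"
    using involution_conj[OF assms(1,2)] by blast
  then show ?thesis using colour_conj assms by auto
qed

text \<open>The product is an involution without colour, so it is 1. Two distinct walls of one
  colour thus never cross, which is what nests the chain of walls used for shrinking.\<close>

lemma commuting_refls_colour:
  assumes "r \<in> refls" "t \<in> refls" "r * t = t * r" "colour r = colour t" shows "r = t"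
proof -
  have "(r * t) * (r * t) = 1" using assms by (metis mult.assoc refl_sq mult.right_neutral)
  moreover have "colour (r * t) = {}" using assms by (auto simp: colour_mult)
  ultimately have "r * t = 1" using involution_colour_trivial[of "r * t"] assms by simp
  then show ?thesis using inv_eqI assms inv_refl by metis
qed

lemma span_pair:
  assumes "adj a b" "x \<in> span {a, b}" shows "x \<in> {1, gen a, gen b, gen a * gen b}"
  using assms(2)
proof (induction rule: span_induct)
  case (mult s y)
  have ab: "a \<in> V" "b \<in> V" using assms(1) adj_verts by auto
  have c: "gen b * gen a = gen a * gen b" using adj_commute[of a b] assms(1) by simp
  then have "gen b * (gen a * gen b) = gen a" using ab by (metis gen_sq mult.assoc mult.right_neutral)
  then show ?case using mult ab c by auto
qed simp

text \<open>An element commuting with \<open>ab\<close> normalises the clique subgroup it generates without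
  permuting its letters, since conjugation preserves colours.\<close>

lemma commute_edge:
  assumes ab: "adj a b" and g: "g \<in> W" and y: "y \<in> W"
    and c: "y * (g * (gen a * gen b) * inverse g) = (g * (gen a * gen b) * inverse g) * y"
    and s: "s \<in> {a, b}"
  shows "y * (g * gen s * inverse g) = (g * gen s * inverse g) * y"
proof -
  let ?L = "{a, b}" and ?x = "gen a * gen b" and ?u = "inverse g * y * g"
  have V: "a \<in> V" "b \<in> V" "a \<noteq> b" using ab adj_verts by auto
  have L: "?L \<subseteq> V" using V by auto
  have comm: "p * q = q * p" if "p \<in> span ?L" "q \<in> span ?L" for p q
  proof (rule span_commute[OF that(1)])
    fix s assume s: "s \<in> ?L"
    have "q * gen s = gen s * q" by (rule span_commute[OF that(2)]) (use s ab adj_commute[of a b] in auto)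
    then show "gen s * q = q * gen s" by simp
  qed
  have x: "?x \<in> span ?L" by simp
  have u: "?u \<in> W" using g y by simp
  have ux: "?u * ?x = ?x * ?u"
    using c conj_commute_iff[of "inverse g" y "g * ?x * inverse g"] by (simp add: mult.assoc)
  obtain p v where pv: "p \<in> span ?L" "v \<in> W" "?u = p * v" "N v \<inter> span ?L = {}"
    using span_decomp[OF u L] by auto
  obtain q w where qw: "q \<in> span ?L" "w \<in> W" "inverse v = q * w" "N w \<inter> span ?L = {}"
    using span_decomp[of "inverse v" ?L] L pv by auto
  have q': "inverse q \<in> span ?L" using inv_span qw L by blast
  have v: "v = inverse w * inverse q" using arg_cong[OF qw(3), of inverse] by simp
  \<comment> \<open>Removing \<open>q\<close> must not spoil minimality on the other side: a letter
    separating 1 from \<open>inverse w\<close> but not from \<open>v\<close> would give a reflection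
    lying both in \<open>N w\<close> and in \<open>span ?L\<close>.\<close>
  have Nw': "N (inverse w) \<inter> span ?L = {}"
  proof (rule N_coset_disjoint)
    fix s assume s: "s \<in> ?L"
    have sV: "s \<in> V" using s L by blast
    show "gen s \<notin> N (inverse w)"
    proof
      assume sw: "gen s \<in> N (inverse w)"
      have "gen s \<notin> N v" using pv s by auto
      then have r: "w * gen s * inverse w \<in> N (inverse q)"
        using N_mult[of "inverse w" "inverse q" "gen s"] v sw qw q' span_W[OF L] by auto
      then have "w * gen s * inverse w \<in> span ?L" using N_span[OF q' L] by blast
      moreover have "w * gen s * inverse w \<in> N w" using sw N_inv qw by blast
      ultimately show False using qw by blast
    qed
  qed (use L qw in auto)
  have "?x * ?u = ?u * ?x" using ux by simp
  then have "inverse p * (?x * ?u) * q = inverse p * (?u * ?x) * q" by simp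
  moreover have "inverse p * ?x = ?x * inverse p" "?x * q = q * ?x"
    using comm[of "inverse p" ?x] comm[of ?x q] pv(1) qw(1) x inv_span[OF pv(1) L] by blast+
  ultimately have wx: "?x * inverse w = inverse w * ?x"
    unfolding pv(3) v by (metis inv_mult_cancel left_inv mult.assoc mult.right_neutral)
  have wx': "w * ?x * inverse w \<in> span ?L"
    using wx x by (metis mult.assoc mult_inv_cancel)
  have "?x \<in> span {s \<in> ?L. gen s * inverse w = inverse w * gen s}"
    using double_coset_commute[of ?L "inverse w" ?x] L qw Nw' x wx' by simp
  \<comment> \<open>Both letters belong to the colour of the product, so membership in the special
    subgroup of the letters commuting with \<open>inverse w\<close> forces each of them to commute
    with it.\<close>
  then have "colour ?x \<subseteq> {s \<in> ?L. gen s * inverse w = inverse w * gen s}"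
    by (rule colour_span) (use L in auto)
  moreover have "colour ?x = ?L" using colour_mult[of "gen a" "gen b"] V by auto
  ultimately have "gen s * inverse w = inverse w * gen s" using s by blast
  moreover have "gen s * p = p * gen s" "gen s * inverse q = inverse q * gen s"
    using comm[of "gen s" p] comm[of "gen s" "inverse q"] pv q' s by auto
  ultimately have "?u * gen s = gen s * ?u"
    unfolding pv(3) v by (metis mult.assoc)
  then show ?thesis
    using conj_commute_iff[of g ?u "gen s"] by (simp add: mult.assoc)
qed

end

section \<open>Presented groups\<close>

lemma pres_rel_gwords: "(x, y) \<in> pres_rel S R \<Longrightarrow> x \<in> gwords S \<and> y \<in> gwords S"
  by (induction rule: pres_rel.induct) (auto simp: gwords_def)

lemma gwords_append [simp]: "x @ y \<in> gwords S \<longleftrightarrow> x \<in> gwords S \<and> y \<in> gwords S"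
  by (auto simp: gwords_def)

lemma gwords_Nil [simp]: "[] \<in> gwords S"
  by (simp add: gwords_def)

lemma gwords_Cons [simp]: "(s, b) # x \<in> gwords S \<longleftrightarrow> s \<in> S \<and> x \<in> gwords S"
  by (auto simp: gwords_def)

lemma equiv_pres_rel: "equiv (gwords S) (pres_rel S R)"
proof (rule equivI)
  show "pres_rel S R \<subseteq> gwords S \<times> gwords S" by (auto dest: pres_rel_gwords)
  show "refl_on (gwords S) (pres_rel S R)"
    by (auto intro!: refl_onI pres_rel.refl dest: pres_rel_gwords)
  show "sym (pres_rel S R)" by (rule symI) (rule pres_rel.sym)
  show "trans (pres_rel S R)" by (rule transI) (rule pres_rel.trans)
qed

lemma pres_rel_context:
  "(x, y) \<in> pres_rel S R \<Longrightarrow> u \<in> gwords S \<Longrightarrow> v \<in> gwords S \<Longrightarrow> (u @ x @ v, u @ y @ v) \<in> pres_rel S R"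
proof (induction rule: pres_rel.induct)
  case (cancel x y s b)
  then show ?case using pres_rel.cancel[of "u @ x" S "y @ v" s b R] by simp
next
  case (relator x y r)
  then show ?case using pres_rel.relator[of "u @ x" S "y @ v" r R] by simp
qed (auto intro: pres_rel.intros)

lemma pres_rel_append:
  assumes "(x, x') \<in> pres_rel S R" "(y, y') \<in> pres_rel S R"
  shows "(x @ y, x' @ y') \<in> pres_rel S R"
proof -
  have "([] @ x @ y, [] @ x' @ y) \<in> pres_rel S R" "(x' @ y @ [], x' @ y' @ []) \<in> pres_rel S R"
    using pres_rel_context[OF assms(1), of "[]" y] pres_rel_context[OF assms(2), of x' "[]"]
      assms[THEN pres_rel_gwords] by simp_all
  then show ?thesis using pres_rel.trans by fastforce
qed

abbreviation pres_class :: "'a set \<Rightarrow> 'a gword set \<Rightarrow> 'a gword \<Rightarrow> 'a gword set" where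
  "pres_class S R x \<equiv> pres_rel S R `` {x}"

lemma pres_class_eq_iff:
  "x \<in> gwords S \<Longrightarrow> y \<in> gwords S \<Longrightarrow> pres_class S R x = pres_class S R y \<longleftrightarrow> (x, y) \<in> pres_rel S R"
  by (simp add: eq_equiv_class_iff[OF equiv_pres_rel])

lemma carrier_presented_group: "carrier (presented_group S R) = pres_class S R ` gwords S"
  by (auto simp: presented_group_def quotient_def)

lemma mult_presented_group:
  assumes "x \<in> gwords S" "y \<in> gwords S"
  shows "pres_class S R x \<otimes>\<^bsub>presented_group S R\<^esub> pres_class S R y = pres_class S R (x @ y)"
proof -
  have "pres_class S R (x' @ y') = pres_class S R (x @ y)"
    if "(x, x') \<in> pres_rel S R" "(y, y') \<in> pres_rel S R" for x' y'
    using that pres_rel_append[OF that] assms pres_rel_gwords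
    by (metis equiv_class_eq equiv_pres_rel)
  then have "(\<Union>x'\<in>pres_class S R x. \<Union>y'\<in>pres_class S R y. pres_class S R (x' @ y'))
      = (\<Union>x'\<in>pres_class S R x. \<Union>y'\<in>pres_class S R y. pres_class S R (x @ y))"
    by (intro SUP_cong refl) auto
  also have "\<dots> = pres_class S R (x @ y)"
    using assms pres_rel.refl[of x S R] pres_rel.refl[of y S R] by auto
  finally show ?thesis by (simp add: presented_group_def)
qed

lemma one_presented_group: "\<one>\<^bsub>presented_group S R\<^esub> = pres_class S R []"
  by (simp add: presented_group_def)

lemma group_presented_group: "group (presented_group S R)"
proof (rule groupI)
  have inv: "\<exists>y\<in>gwords S. (y @ x, []) \<in> pres_rel S R" if "x \<in> gwords S" for x
    using that
  proof (induction x)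
    case (Cons a x)
    obtain s b where a: "a = (s, b)" by (cases a)
    obtain y where y: "y \<in> gwords S" "(y @ x, []) \<in> pres_rel S R" using Cons a by auto
    have "((y @ [(s, \<not> b)]) @ a # x, y @ x) \<in> pres_rel S R"
      using pres_rel.cancel[of y S x s "\<not> b" R] y Cons.prems a by simp
    then show ?case using y Cons.prems a
      by (intro bexI[of _ "y @ [(s, \<not> b)]"]) (auto intro: pres_rel.trans)
  qed (use pres_rel.refl in force)
  fix X assume "X \<in> carrier (presented_group S R)"
  then obtain x where x: "x \<in> gwords S" "X = pres_class S R x" by (auto simp: carrier_presented_group)
  then obtain y where "y \<in> gwords S" "(y @ x, []) \<in> pres_rel S R" using inv by blast
  then show "\<exists>Y\<in>carrier (presented_group S R). Y \<otimes>\<^bsub>presented_group S R\<^esub> X = \<one>\<^bsub>presented_group S R\<^esub>"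
    using x by (intro bexI[of _ "pres_class S R y"])
      (auto simp: mult_presented_group one_presented_group carrier_presented_group pres_class_eq_iff)
qed (auto simp: carrier_presented_group mult_presented_group one_presented_group)

section \<open>Faithful images of Coxeter groups\<close>

definition regular_rep :: "('x, 'm) monoid_scheme \<Rightarrow> 'x \<Rightarrow> 'x bijection" where
  "regular_rep G x = Bij (\<lambda>y. if y \<in> carrier G then x \<otimes>\<^bsub>G\<^esub> y else y)"

lemma (in group) app_regular_rep:
  assumes x: "x \<in> carrier G"
  shows "app (regular_rep G x) = (\<lambda>y. if y \<in> carrier G then x \<otimes> y else y)"
proof -
  let ?f = "\<lambda>x y. if y \<in> carrier G then x \<otimes> y else y"
  have "?f (inv x) (?f x y) = y" "?f x (?f (inv x) y) = y" for y
    using x by (auto simp: m_assoc[symmetric])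
  then have "bij (?f x)" by (intro o_bij[of "?f (inv x)"]) (auto simp: fun_eq_iff)
  then show ?thesis unfolding regular_rep_def by (rule app_Bij)
qed

lemma (in group) regular_rep_mult:
  "x \<in> carrier G \<Longrightarrow> y \<in> carrier G \<Longrightarrow> regular_rep G (x \<otimes> y) = regular_rep G x * regular_rep G y"
  by (intro bijection_eqI) (auto simp: app_regular_rep m_assoc)

lemma (in group) regular_rep_inj: "inj_on (regular_rep G) (carrier G)"
proof (rule inj_onI)
  fix x y assume "x \<in> carrier G" "y \<in> carrier G" "regular_rep G x = regular_rep G y"
  then show "x = y" using app_regular_rep[of x] app_regular_rep[of y]
    by (metis one_closed r_one)
qed

definition mult_on :: "('x, 'm) monoid_scheme \<Rightarrow> ('x \<Rightarrow> 'g::monoid_mult) \<Rightarrow> bool" where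
  "mult_on G h \<longleftrightarrow> (\<forall>x\<in>carrier G. \<forall>y\<in>carrier G. h (x \<otimes>\<^bsub>G\<^esub> y) = h x * h y)"

lemma (in group) mult_on_one:
  fixes h :: "'a \<Rightarrow> 'g::mult_group"
  assumes "mult_on G h" shows "h \<one> = 1"
proof -
  have "h \<one> * h \<one> = h \<one> * 1" using assms by (auto simp: mult_on_def) (metis l_one one_closed)
  then show ?thesis by (simp only: left_cancel)
qed

abbreviation racg_class :: "'a graph \<Rightarrow> 'a gword \<Rightarrow> 'a gword set" where
  "racg_class \<Gamma> \<equiv> pres_class (verts \<Gamma>) (racg_relators \<Gamma>)"

lemma group_racg: "group (racg \<Gamma>)"
  by (simp add: racg_def group_presented_group)

lemma racg_gen_carrier: "u \<in> verts \<Gamma> \<Longrightarrow> racg_gen \<Gamma> u \<in> carrier (racg \<Gamma>)"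
  by (auto simp: racg_def carrier_presented_group racg_gen_def)

lemma word_val_racg_class:
  assumes h: "mult_on (racg \<Gamma>) (h :: 'a gword set \<Rightarrow> 'g::mult_group)" and xs: "xs \<in> lists (verts \<Gamma>)"
  shows "word_val (\<lambda>u. h (racg_gen \<Gamma> u)) xs = h (racg_class \<Gamma> (map (\<lambda>u. (u, True)) xs))"
  using xs
proof (induction xs)
  case Nil
  then show ?case using group.mult_on_one[OF group_racg h] by (simp add: racg_def one_presented_group)
next
  case (Cons u xs)
  let ?w = "map (\<lambda>u. (u, True)) xs"
  have w: "?w \<in> gwords (verts \<Gamma>)" "[(u, True)] \<in> gwords (verts \<Gamma>)"
    using Cons by (auto simp: gwords_def)
  then have c: "racg_class \<Gamma> ?w \<in> carrier (racg \<Gamma>)" by (auto simp: racg_def carrier_presented_group)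
  have "h (racg_class \<Gamma> (map (\<lambda>u. (u, True)) (u # xs))) = h (racg_gen \<Gamma> u \<otimes>\<^bsub>racg \<Gamma>\<^esub> racg_class \<Gamma> ?w)"
    using w by (simp add: racg_gen_def racg_def mult_presented_group)
  also have "\<dots> = h (racg_gen \<Gamma> u) * h (racg_class \<Gamma> ?w)"
    using h c racg_gen_carrier[of u \<Gamma>] Cons.hyps unfolding mult_on_def by blast
  finally show ?case using Cons by simp
qed

text \<open>The relator \<open>s s\<close> identifies the formal inverse of a letter with the letter
  itself, so positive words represent all elements, as \<open>trivial_word\<close>
  presupposes.\<close>

lemma pres_rel_positive:
  assumes "x \<in> gwords (verts \<Gamma>)"
  shows "(x, map (\<lambda>u. (u, True)) (map fst x)) \<in> pres_rel (verts \<Gamma>) (racg_relators \<Gamma>)"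
  using assms
proof (induction x)
  case (Cons a x)
  let ?R = "pres_rel (verts \<Gamma>) (racg_relators \<Gamma>)"
  obtain s b where a: "a = (s, b)" by (cases a)
  then have s: "s \<in> verts \<Gamma>" "x \<in> gwords (verts \<Gamma>)" using Cons by auto
  have "([(s, b)], [(s, True)]) \<in> ?R"
  proof (cases b)
    case False
    have "([(s, False)] @ [(s, True), (s, True)] @ [], [(s, False)] @ []) \<in> ?R"
      using s by (intro pres_rel.relator) (auto simp: racg_relators_def)
    moreover have "([] @ [(s, False), (s, \<not> False)] @ [(s, True)], [] @ [(s, True)]) \<in> ?R"
      using s by (intro pres_rel.cancel) auto
    ultimately show ?thesis using False by (auto intro: pres_rel.trans pres_rel.sym)
  qed (use s in \<open>auto intro: pres_rel.refl\<close>)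
  then have "([(s, b)] @ x, [(s, True)] @ map (\<lambda>u. (u, True)) (map fst x)) \<in> ?R"
    using Cons.IH s by (intro pres_rel_append) auto
  then show ?case using a by simp
qed (auto intro: pres_rel.refl)

lemma racg_model_of_mult_on:
  assumes simp: "simplicial_graph \<Gamma>" and h: "mult_on (racg \<Gamma>) (h :: 'a gword set \<Rightarrow> 'g::mult_group)"
    and inj: "inj_on h (carrier (racg \<Gamma>))"
  shows "racg_model \<Gamma> (\<lambda>u. h (racg_gen \<Gamma> u))"
proof
  let ?R = "pres_rel (verts \<Gamma>) (racg_relators \<Gamma>)" and ?f = "\<lambda>u. h (racg_gen \<Gamma> u)"
  let ?p = "map (\<lambda>u. (u, True))"
  have val: "word_val ?f xs = word_val ?f ys"
    if "xs \<in> lists (verts \<Gamma>)" "ys \<in> lists (verts \<Gamma>)" "(?p xs, ?p ys) \<in> ?R" for xs ys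
    unfolding word_val_racg_class[OF h that(1)] word_val_racg_class[OF h that(2)]
    using that(3) equiv_class_eq[OF equiv_pres_rel] by metis
  show "racg_map \<Gamma> ?f"
    unfolding racg_map_def
  proof (intro conjI ballI allI impI)
    fix u assume u: "u \<in> verts \<Gamma>"
    then have "([] @ [(u, True), (u, True)] @ [], [] @ []) \<in> ?R"
      by (intro pres_rel.relator) (auto simp: racg_relators_def)
    then show "?f u * ?f u = 1" using val[of "[u, u]" "[]"] u by simp
  next
    fix u v assume e: "{u, v} \<in> edges \<Gamma>"
    then have uv: "u \<in> verts \<Gamma>" "v \<in> verts \<Gamma>" using edge_verts[OF simp] by auto
    have "([] @ [(u, True), (v, True), (u, False), (v, False)] @ [(v, True), (u, True)], [] @ [(v, True), (u, True)]) \<in> ?R"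
      using e uv by (intro pres_rel.relator) (auto simp: racg_relators_def)
    moreover have "([(u, True), (v, True), (u, False)] @ [(v, False), (v, \<not> False)] @ [(u, True)],
        [(u, True), (v, True), (u, False)] @ [(u, True)]) \<in> ?R"
      using uv by (intro pres_rel.cancel) auto
    moreover have "([(u, True), (v, True)] @ [(u, False), (u, \<not> False)] @ [], [(u, True), (v, True)] @ []) \<in> ?R"
      using uv by (intro pres_rel.cancel) auto
    ultimately have "(?p [u, v], ?p [v, u]) \<in> ?R"
      by simp (meson pres_rel.sym pres_rel.trans)
    then show "?f u * ?f v = ?f v * ?f u" using val[of "[u, v]" "[v, u]"] uv by simp
  qed
  fix xs assume xs: "xs \<in> lists (verts \<Gamma>)" "word_val ?f xs = 1"
  have g: "?p xs \<in> gwords (verts \<Gamma>)" using xs by (auto simp: gwords_def)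
  have "h (racg_class \<Gamma> (?p xs)) = h (racg_class \<Gamma> [])"
    using word_val_racg_class[OF h xs(1)] word_val_racg_class[OF h, of "[]"] xs by simp
  then have "racg_class \<Gamma> (?p xs) = racg_class \<Gamma> []"
    using inj g by (auto simp: inj_on_def racg_def carrier_presented_group)
  then show "trivial_word \<Gamma> xs" using g by (simp add: trivial_word_def pres_class_eq_iff)
qed (rule simp)

lemma canonical_racg_model:
  assumes "simplicial_graph \<Gamma>"
  shows "racg_model \<Gamma> (\<lambda>u. regular_rep (racg \<Gamma>) (racg_gen \<Gamma> u))"
proof -
  interpret group "racg \<Gamma>" by (rule group_racg)
  show ?thesis
    by (rule racg_model_of_mult_on[OF assms]) (auto simp: mult_on_def regular_rep_mult regular_rep_inj)
qed

context racg_model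
begin

text \<open>Converse of \<open>racg_model_of_mult_on\<close>. Injectivity is tested in the regular
  representation, to which \<open>universal\<close> carries the equality of two values.\<close>

lemma mult_on_of_racg_model:
  "\<exists>h. mult_on (racg \<Gamma>) h \<and> inj_on h (carrier (racg \<Gamma>)) \<and> h ` carrier (racg \<Gamma>) = W \<and>
    (\<forall>u\<in>V. h (racg_gen \<Gamma> u) = gen u)"
proof -
  let ?R = "pres_rel V (racg_relators \<Gamma>)"
  define h where "h X = val (map fst (SOME x. x \<in> X))" for X :: "'a gword set"
  have h: "h (racg_class \<Gamma> x) = val (map fst x)" if "x \<in> gwords V" for x
  proof -
    have "(SOME y. y \<in> racg_class \<Gamma> x) \<in> racg_class \<Gamma> x"
      by (rule someI[of _ x]) (use that pres_rel.refl in auto)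
    then show ?thesis
      using pres_rel_word_val[OF _ simplicial gen_map] unfolding h_def by fastforce
  qed
  have lists: "map fst x \<in> lists V" if "x \<in> gwords V" for x
    using that by (force simp: gwords_def)
  have carrier: "carrier (racg \<Gamma>) = racg_class \<Gamma> ` gwords V"
    by (simp add: racg_def carrier_presented_group)
  have "mult_on (racg \<Gamma>) h"
    by (auto simp: mult_on_def carrier h) (simp add: racg_def mult_presented_group h)
  moreover have "inj_on h (carrier (racg \<Gamma>))"
  proof (rule inj_onI)
    fix X Y assume "X \<in> carrier (racg \<Gamma>)" "Y \<in> carrier (racg \<Gamma>)" and eq: "h X = h Y"
    then obtain x y where xy: "x \<in> gwords V" "y \<in> gwords V" "X = racg_class \<Gamma> x" "Y = racg_class \<Gamma> y"
      by (auto simp: carrier)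
    let ?g = "\<lambda>u. regular_rep (racg \<Gamma>) (racg_gen \<Gamma> u)"
    interpret C: racg_model \<Gamma> ?g by (rule canonical_racg_model[OF simplicial])
    interpret G: group "racg \<Gamma>" by (rule group_racg)
    have "word_val ?g (map fst x) = word_val ?g (map fst y)"
      using eq xy lists h by (intro universal[OF C.gen_map]) auto
    moreover have m: "mult_on (racg \<Gamma>) (regular_rep (racg \<Gamma>))" by (auto simp: mult_on_def G.regular_rep_mult)
    ultimately have "regular_rep (racg \<Gamma>) (racg_class \<Gamma> (map (\<lambda>u. (u, True)) (map fst x)))
        = regular_rep (racg \<Gamma>) (racg_class \<Gamma> (map (\<lambda>u. (u, True)) (map fst y)))"
      using lists xy by (metis word_val_racg_class[OF m])
    moreover have "racg_class \<Gamma> (map (\<lambda>u. (u, True)) (map fst z)) = racg_class \<Gamma> z" if "z \<in> gwords V" for z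
      using equiv_class_eq[OF equiv_pres_rel pres_rel_positive[OF that]] by simp
    ultimately have "regular_rep (racg \<Gamma>) X = regular_rep (racg \<Gamma>) Y" using xy by simp
    then show "X = Y" using G.regular_rep_inj xy by (auto simp: inj_on_def carrier)
  qed
  moreover have "h ` carrier (racg \<Gamma>) = W"
  proof
    show "h ` carrier (racg \<Gamma>) \<subseteq> W"
      unfolding carrier by (auto simp only: image_iff h intro!: val_span lists)
    show "W \<subseteq> h ` carrier (racg \<Gamma>)"
    proof
      fix w assume "w \<in> W"
      then obtain xs where xs: "xs \<in> lists V" "w = val xs" by (auto simp: span_def)
      let ?x = "map (\<lambda>u. (u, True)) xs"
      have "?x \<in> gwords V" "map fst ?x = xs" using xs by (auto simp: gwords_def comp_def)
      then show "w \<in> h ` carrier (racg \<Gamma>)" using h[of ?x] xs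
        unfolding carrier by (intro image_eqI[of _ _ "racg_class \<Gamma> ?x"]) auto
    qed
  qed
  moreover have "\<forall>u\<in>V. h (racg_gen \<Gamma> u) = gen u" using h by (simp add: racg_gen_def)
  ultimately show ?thesis by blast
qed

lemma racg_model_transfer:
  assumes map: "racg_map \<Gamma> f"
    and lift: "\<And>xs. xs \<in> lists V \<Longrightarrow> word_val f xs = 1 \<Longrightarrow> val xs = 1"
  shows "racg_model \<Gamma> (f :: 'a \<Rightarrow> 'h::mult_group)"
  by unfold_locales (use map lift simplicial faithful in auto)


section \<open>Ping-pong\<close>

text \<open>Both letters are initial in their product, hence adjacent. A model therefore determines
  its graph as a commutation graph, which is what bases require.\<close>

lemma commute_adj:
  assumes "s \<in> V" "t \<in> V" "s \<noteq> t" "gen s * gen t = gen t * gen s" shows "adj s t"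
proof -
  have "gen s * gen t \<in> half (gen s) \<inter> half (gen t)"
    using crossing_corners(1)[of "gen s" "gen t"] assms by (simp add: inj_gen)
  then show ?thesis using simple_in_N_adj[of "gen s * gen t" s t] assms by (auto simp: half_def)
qed

definition ping_pong_system :: "'b graph \<Rightarrow> ('b \<Rightarrow> 'g) \<Rightarrow> bool" where
  "ping_pong_system \<Phi> t \<longleftrightarrow>
    (\<forall>v\<in>verts \<Phi>. t v \<in> refls) \<and>
    (\<forall>u v. {u, v} \<in> edges \<Phi> \<longrightarrow> t u \<noteq> t v \<and> t u * t v = t v * t u) \<and>
    (\<forall>u\<in>verts \<Phi>. \<forall>v\<in>verts \<Phi>. u \<noteq> v \<longrightarrow> {u, v} \<notin> edges \<Phi> \<longrightarrow> half (t u) \<inter> half (t v) = {})"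

text \<open>The point 1 lies in no half-space of the system; by induction on the length of \<open>x\<close>, the
  image of \<open>x\<close> lies in the half-space of \<open>s\<close> only if \<open>s\<close> is an initial letter of \<open>x\<close>.\<close>

theorem racg_model_ping_pong:
  fixes \<Phi> :: "'b graph"
  assumes simp: "simplicial_graph \<Phi>" and pp: "ping_pong_system \<Phi> t"
  shows "racg_model \<Phi> t"
proof -
  interpret F: racg_model \<Phi> "\<lambda>u. regular_rep (racg \<Phi>) (racg_gen \<Phi> u)"
    by (rule canonical_racg_model[OF simp])
  let ?g = "\<lambda>u. regular_rep (racg \<Phi>) (racg_gen \<Phi> u)"
  have refl: "t v \<in> refls" if "v \<in> verts \<Phi>" for v using pp that by (auto simp: ping_pong_system_def)
  have adj: "t u \<noteq> t v" "t u * t v = t v * t u" if "{u, v} \<in> edges \<Phi>" for u v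
    using pp that unfolding ping_pong_system_def by blast+
  have non: "half (t u) \<inter> half (t v) = {}"
    if "u \<in> verts \<Phi>" "v \<in> verts \<Phi>" "u \<noteq> v" "{u, v} \<notin> edges \<Phi>" for u v
    using pp that by (auto simp: ping_pong_system_def)
  have map: "racg_map \<Phi> t"
    unfolding racg_map_def using refl adj by auto
  have tW: "word_val t xs \<in> W" if "xs \<in> lists (verts \<Phi>)" for xs
    using that by (induction xs) (auto simp: refl)
  have reduced: "\<exists>ys\<in>lists (verts \<Phi>). F.val ys = F.val xs \<and> word_val t ys = word_val t xs \<and>
      length ys = F.len (F.val xs) \<and> length ys \<le> length xs"
    if xs: "xs \<in> lists (verts \<Phi>)" for xs
  proof -
    obtain ys where "ys \<in> lists (verts \<Phi>)" "F.val ys = F.val xs" "length ys = F.len (F.val xs)"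
      using F.reduced_word[OF F.val_span[OF xs]] by blast
    then show ?thesis using F.universal[OF map, of ys xs] xs F.len_le[OF xs] by (intro bexI[of _ ys]) auto
  qed
  have key: "word_val t xs \<notin> half (t s)"
    if "xs \<in> lists (verts \<Phi>)" "s \<in> verts \<Phi>" "?g s \<notin> F.N (F.val xs)" for xs s
    using that
  proof (induction "length xs" arbitrary: xs s rule: less_induct)
    case less
    obtain ys where ys: "ys \<in> lists (verts \<Phi>)" "F.val ys = F.val xs" "word_val t ys = word_val t xs"
      "length ys = F.len (F.val xs)" "length ys \<le> length xs"
      using reduced less by blast
    show ?case
    proof (cases ys)
      case Nil
      then show ?thesis using ys by (metis list.map(1) one_notin_half prod_list.Nil)
    next
      case (Cons s' zs)
      have s': "s' \<in> verts \<Phi>" and zs: "zs \<in> lists (verts \<Phi>)" using ys Cons by auto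
      have n: "?g s' \<notin> F.N (F.val zs)" using F.reduced_Cons[of s' zs] ys Cons by simp
      have l: "length zs < length xs" using ys Cons by simp
      have eq: "F.val xs = ?g s' * F.val zs" "word_val t xs = t s' * word_val t zs" using ys Cons by auto
      have in': "t s' * word_val t zs \<in> half (t s')"
        using less.hyps[OF l zs s' n] own_half_iff[OF refl[OF s'] tW[OF zs]] by simp
      have "?g s' \<in> F.N (F.val xs)"
        unfolding eq using F.N_refl_mult[OF F.gen_refl[OF s'] F.val_span[OF zs]] n by simp
      then have ne: "s \<noteq> s'" using less by auto
      \<comment> \<open>The image lies in \<open>half (t s')\<close>. A non-adjacent
        \<open>s\<close> has a disjoint half-space; for an adjacent \<open>s\<close> the reflection
        \<open>t s'\<close> preserves \<open>half (t s)\<close>, and the shorter word is covered by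
        induction.\<close>
      show ?thesis
      proof (cases "{s, s'} \<in> edges \<Phi>")
        case False
        then show ?thesis using non[of s s'] less s' ne in' eq by auto
      next
        case True
        then have a: "F.adj s' s" by (simp add: F.adj_def insert_commute)
        have "?g s' * ?g s * ?g s' = ?g s"
          using F.adj_commute[OF a] s' by (metis F.gen_gen mult.assoc F.gen_sq mult.right_neutral)
        moreover have "?g s \<noteq> ?g s'" using F.inj_gen[of s s'] less s' ne by simp
        ultimately have "?g s \<notin> F.N (F.val zs)"
          using F.N_gen_mult[OF s' F.val_span[OF zs], of "?g s"] less.prems eq by simp
        then have "word_val t zs \<notin> half (t s)" using less.hyps[OF l zs] less.prems by blast
        then show ?thesis
          using commute_half_iff[of "t s" "t s'" "word_val t zs"] refl less.prems s' adj[OF True] tW[OF zs] eq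
          by simp
      qed
    qed
  qed
  show ?thesis
  proof (rule F.racg_model_transfer[OF map])
    fix xs assume xs: "xs \<in> lists (verts \<Phi>)" "word_val t xs = 1"
    obtain ys where ys: "ys \<in> lists (verts \<Phi>)" "F.val ys = F.val xs" "word_val t ys = word_val t xs"
      "length ys = F.len (F.val xs)"
      using reduced xs by blast
    show "F.val xs = 1"
    proof (cases ys)
      case Nil
      then show ?thesis using ys by simp
    next
      case (Cons s zs)
      have s: "s \<in> verts \<Phi>" and zs: "zs \<in> lists (verts \<Phi>)" using ys Cons by auto
      have "?g s \<notin> F.N (F.val zs)" using F.reduced_Cons[of s zs] ys Cons by simp
      then have "word_val t zs \<notin> half (t s)" using key s zs by blast
      then have "t s * word_val t zs \<in> half (t s)" using own_half_iff[OF refl[OF s] tW[OF zs]] by simp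
      then show ?thesis using ys Cons xs by simp
    qed
  qed
qed

section \<open>The distance from 1 to a wall\<close>

text \<open>Distance from 1 to the wall of \<open>t\<close>: \<open>g\<close> and
  \<open>g * gen a\<close> are the ends of an edge crossing the wall, and the least length belongs
  to a near end.\<close>

definition depth :: "'g \<Rightarrow> nat" where
  "depth t = (LEAST n. \<exists>g\<in>W. \<exists>a\<in>V. t = g * gen a * inverse g \<and> len g = n)"

lemma depth_le: "g \<in> W \<Longrightarrow> a \<in> V \<Longrightarrow> depth (g * gen a * inverse g) \<le> len g"
  unfolding depth_def by (rule Least_le) blast

lemma depthE:
  assumes "t \<in> refls"
  obtains g a where "g \<in> W" "a \<in> V" "t = g * gen a * inverse g" "len g = depth t"
proof -
  obtain h b where hb: "h \<in> W" "b \<in> V" "t = h * gen b * inverse h" using assms by (auto elim: reflE)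
  have "\<exists>g\<in>W. \<exists>a\<in>V. t = g * gen a * inverse g \<and> len g = depth t"
    unfolding depth_def by (rule LeastI[where k = "len h"]) (use hb in blast)
  then show ?thesis using that by blast
qed

lemma depth_conj_le:
  assumes "g \<in> W" "a \<in> V" "h \<in> W"
  shows "depth (h * (g * gen a * inverse g) * inverse h) \<le> len (h * g)"
  using depth_le[of "h * g" a] assms by (simp add: mult.assoc)

text \<open>A reflection commuting with \<open>t\<close> preserves its wall, so reflecting a
  shortest path in a wall that it crosses would give a shorter path to the wall of \<open>t\<close>.
  The case \<open>r = t\<close> is included: \<open>g\<close> stops in front of the wall.\<close>

lemma minimal_notin_N:
  assumes "g \<in> W" "a \<in> V" "t = g * gen a * inverse g" "len g = depth t"
    and r: "r \<in> N g"
  shows "r * t \<noteq> t * r"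
proof
  assume c: "r * t = t * r"
  have rr: "r \<in> refls" using N_subset_refls r assms by blast
  then have "t = r * t * inverse r" using c by (simp add: mult.assoc)
  then have "depth t \<le> len (r * g)" using depth_conj_le[of g a r] assms rr by simp
  then show False using len_refl_less[of g r] assms by simp
qed

lemma half_subset_in_N:
  assumes "g \<in> W" "a \<in> V" "t = g * gen a * inverse g" "len g = depth t"
    and "half t \<subseteq> half r" "r \<noteq> t"
  shows "r \<in> N g"
proof -
  have "t \<notin> N g" using minimal_notin_N[OF assms(1-4), of t] by blast
  then have "t \<in> N (g * gen a)" using N_gen_right assms by simp
  moreover have "g * gen a \<in> W" using assms by simp
  ultimately have "g * gen a \<in> half r" using assms(5) unfolding half_def by blast
  then show ?thesis using N_gen_right assms by (auto simp: half_def)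
qed

lemma depth_fold_less:
  assumes t: "t \<in> refls" and r: "r \<in> refls" and sub: "half t \<subseteq> half r" and ne: "r \<noteq> t"
  shows "depth (r * t * r) < depth t"
proof -
  obtain g a where ga: "g \<in> W" "a \<in> V" "t = g * gen a * inverse g" "len g = depth t"
    using depthE[OF t] .
  have "r \<in> N g" using half_subset_in_N[OF ga sub ne] .
  then have "len (r * g) < len g" using len_refl_less ga by blast
  moreover have "depth (r * t * inverse r) \<le> len (r * g)" using depth_conj_le[of g a r] ga r by simp
  ultimately show ?thesis using ga r by simp
qed

section \<open>Folding\<close>

text \<open>The words \<open>\<alpha>\<close> describe an endomorphism, which the two conditions make involutive.\<close>

lemma racg_model_twist:
  assumes map: "racg_map \<Gamma> f" and \<alpha>: "\<And>v. v \<in> V \<Longrightarrow> \<alpha> v \<in> lists V"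
    and f: "\<And>v. v \<in> V \<Longrightarrow> f v = val (\<alpha> v)" and gen: "\<And>v. v \<in> V \<Longrightarrow> gen v = word_val f (\<alpha> v)"
  shows "racg_model \<Gamma> (f :: 'a \<Rightarrow> 'g)"
proof (rule racg_model_transfer[OF map])
  fix xs assume xs: "xs \<in> lists V" "word_val f xs = 1"
  let ?ys = "concat (List.map \<alpha> xs)"
  have "set (\<alpha> v) \<subseteq> V" if "v \<in> V" for v using \<alpha>[OF that] by auto
  then have ys: "?ys \<in> lists V" using xs by fastforce
  have "word_val f xs = val ?ys" using xs(1) by (induction xs) (simp_all add: f)
  then have "word_val f ?ys = word_val f []" using universal[OF map ys, of "[]"] xs by simp
  moreover have "word_val f ?ys = val xs" using xs(1) by (induction xs) (simp_all add: gen)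
  ultimately show "val xs = 1" by simp
qed

definition refl_model :: "'b graph \<Rightarrow> ('b \<Rightarrow> 'g) \<Rightarrow> bool" where
  "refl_model \<Phi> f \<longleftrightarrow> racg_model \<Phi> f \<and> (\<forall>v\<in>verts \<Phi>. f v \<in> refls)"

text \<open>A failure of ping-pong yields two non-adjacent generators with nested half-spaces. The
  partial conjugation by the outer one makes shallower all generators not adjacent to it whose
  half-spaces lie inside its own.\<close>

lemma fold_step:
  fixes \<Phi> :: "'b graph"
  assumes fin: "finite (verts \<Phi>)" and f: "refl_model \<Phi> f" and npp: "\<not> ping_pong_system \<Phi> f"
  shows "\<exists>f'. refl_model \<Phi> f' \<and> (\<Sum>v\<in>verts \<Phi>. depth (f' v)) < (\<Sum>v\<in>verts \<Phi>. depth (f v))"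
proof -
  interpret F: racg_model \<Phi> f using f by (simp add: refl_model_def)
  have refl: "f v \<in> refls" if "v \<in> verts \<Phi>" for v using f that by (simp add: refl_model_def)
  have edge: "F.adj u v \<longleftrightarrow> {u, v} \<in> edges \<Phi>" for u v by (simp add: F.adj_def)
  have non: "f u * f v \<noteq> f v * f u" if "u \<in> verts \<Phi>" "v \<in> verts \<Phi>" "u \<noteq> v" "\<not> F.adj u v" for u v
    using F.commute_adj that by blast
  have adj: "f u \<noteq> f v \<and> f u * f v = f v * f u" if "F.adj u v" for u v
    using that F.adj_verts F.inj_gen F.adj_commute by metis
  obtain u w where uw: "u \<in> verts \<Phi>" "w \<in> verts \<Phi>" "u \<noteq> w" "\<not> F.adj u w" "half (f u) \<inter> half (f w) \<noteq> {}"
    using npp refl adj unfolding ping_pong_system_def edge by blast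
  have "half (f u) \<subseteq> half (f w) \<or> half (f w) \<subseteq> half (f u)"
    using half_trichotomy[OF refl refl non] uw by blast
  then obtain v z where vz: "v \<in> verts \<Phi>" "z \<in> verts \<Phi>" "z \<noteq> v" "\<not> F.adj v z" "half (f z) \<subseteq> half (f v)"
    using uw F.adj_sym by metis
  let ?r = "f v"
  \<comment> \<open>By \<open>comm\<close>, \<open>Z\<close> is a union of components of \<Phi>
    minus the star of \<open>v\<close>; this is why conjugating \<open>Z\<close> as a whole respects
    the relations.\<close>
  define Z where "Z = {z \<in> verts \<Phi>. z \<noteq> v \<and> \<not> F.adj v z \<and> half (f z) \<subseteq> half ?r}"
  define f' where "f' z = (if z \<in> Z then ?r * f z * ?r else f z)" for z
  \<comment> \<open>As \<open>v\<close> is not in \<open>Z\<close>, the same word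
    \<open>v z v\<close> expresses the new generator in the old ones and the old generator in the
    new ones.\<close>
  define \<alpha> where "\<alpha> z = (if z \<in> Z then [v, z, v] else [z])" for z
  have r: "?r \<in> refls" using refl vz by simp
  have vZ: "v \<notin> Z" by (simp add: Z_def)
  have comm: "?r * f y = f y * ?r" if x: "x \<in> Z" and y: "y \<in> verts \<Phi> - Z" and a: "F.adj x y" for x y
  proof (rule ccontr)
    assume nc: "\<not> ?thesis"
    then have "y \<noteq> v" "\<not> F.adj v y" using adj by auto
    then have nsub: "\<not> half (f y) \<subseteq> half ?r" using y by (simp add: Z_def)
    have X: "x \<in> verts \<Phi>" "half (f x) \<subseteq> half ?r" using x by (auto simp: Z_def)
    have xy: "f x * f y \<in> half (f x) \<inter> half (f y)" "f x \<in> half (f x) - half (f y)"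
      using crossing_corners[of "f x" "f y"] refl X y adj[OF a] by auto
    then have "half ?r \<inter> half (f y) \<noteq> {}" using X by blast
    then have "half ?r \<subseteq> half (f y)" using half_trichotomy[OF r refl[of y] nc] y nsub by blast
    then show False using xy X by blast
  qed
  have map: "racg_map \<Phi> f'"
    unfolding racg_map_def
  proof (intro conjI ballI allI impI)
    fix x assume x: "x \<in> verts \<Phi>"
    have "?r * f x * ?r * (?r * f x * ?r) = 1" using r refl x by (simp add: mult.assoc)
    then show "f' x * f' x = 1" using refl x by (simp add: f'_def)
  next
    fix x y assume "{x, y} \<in> edges \<Phi>"
    then have a: "F.adj x y" "F.adj y x" "x \<in> verts \<Phi>" "y \<in> verts \<Phi>"
      using F.adj_verts F.adj_sym unfolding edge[symmetric] by blast+
    have c: "f x * f y = f y * f x" using adj a by blast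
    have conj: "(?r * f x * ?r) * (?r * f y * ?r) = (?r * f y * ?r) * (?r * f x * ?r)"
      using conj_commute_iff[of ?r "f x" "f y"] c r by simp
    have fix': "?r * f z * ?r = f z" if "?r * f z = f z * ?r" for z
      using that r by (simp add: mult.assoc)
    show "f' x * f' y = f' y * f' x"
      using conj c fix' comm[of x y] comm[of y x] a unfolding f'_def by (smt (verit) DiffI)
  qed
  have "racg_model \<Phi> f'"
  proof (rule F.racg_model_twist[OF map])
    fix x assume x: "x \<in> verts \<Phi>"
    show "\<alpha> x \<in> lists (verts \<Phi>)" using x vz by (simp add: \<alpha>_def)
    show "f' x = F.val (\<alpha> x)" by (simp add: \<alpha>_def f'_def mult.assoc)
    show "f x = word_val f' (\<alpha> x)" using vZ r by (simp add: \<alpha>_def f'_def mult.assoc)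
  qed
  moreover have "f' x \<in> refls" if "x \<in> verts \<Phi>" for x
    using conj_refl[OF refl[OF that], of ?r] r refl that by (simp add: f'_def)
  moreover have less: "depth (f' x) < depth (f x)" if x: "x \<in> Z" for x
  proof -
    have X: "x \<in> verts \<Phi>" "x \<noteq> v" "half (f x) \<subseteq> half ?r" using x by (auto simp: Z_def)
    then have "?r \<noteq> f x" using F.inj_gen[of v x] vz by auto
    then show ?thesis using depth_fold_less[OF refl r] X x by (simp add: f'_def)
  qed
  then have "(\<Sum>v\<in>verts \<Phi>. depth (f' v)) < (\<Sum>v\<in>verts \<Phi>. depth (f v))"
  proof (intro sum_strict_mono_ex1[OF fin] ballI bexI[of _ z])
    fix x show "depth (f' x) \<le> depth (f x)" using less[of x] by (cases "x \<in> Z") (auto simp: f'_def)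
  qed (use vz less in \<open>auto simp: Z_def\<close>)
  ultimately show ?thesis by (auto simp: refl_model_def)
qed

lemma ping_pong_refl_model: "simplicial_graph \<Phi> \<Longrightarrow> ping_pong_system \<Phi> t \<Longrightarrow> refl_model \<Phi> t"
  using racg_model_ping_pong by (auto simp: refl_model_def ping_pong_system_def)


section \<open>Shrinking\<close>

text \<open>The lengths add up, so every prefix of the factorisation is reduced and the walls it
  crosses persist. The two walls have the same colour and cannot cross; the point just before
  \<open>K'\<close> lies beyond \<open>K\<close> only, and \<open>g\<close> beyond both, which
  leaves inclusion.\<close>

lemma nested_walls:
  assumes W: "u \<in> W" "w \<in> W" "v \<in> W" and c: "c \<in> V"
    and g: "g = u * (gen c * (w * (gen c * v)))" and l: "len g = len u + len w + len v + 2"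
    and K: "K = u * gen c * inverse u" and K': "K' = (u * gen c * w) * gen c * inverse (u * gen c * w)"
  shows "K \<in> N g" "K' \<in> N g" "K \<notin> N u" "K' \<notin> N (u * gen c * w)"
    "N u \<subseteq> N g" "N (u * gen c * w) \<subseteq> N g" "half K' \<subseteq> half K" "K \<noteq> K'"
proof -
  have c1: "len (gen c) \<le> 1" using len_le[of "[c]"] c by simp
  let ?p = "u * gen c * w" and ?uc = "u * gen c"
  have le: "len ?uc \<le> len u + 1" "len ?p \<le> len ?uc + len w" "len (?p * gen c) \<le> len ?p + 1"
    "len (gen c * v) \<le> 1 + len v" "len (w * (gen c * v)) \<le> len w + len (gen c * v)"
    "len (gen c * (w * (gen c * v))) \<le> 1 + len (w * (gen c * v))"
    using len_mult[of u "gen c"] len_mult[of ?uc w] len_mult[of ?p "gen c"] len_mult[of "gen c" v]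
      len_mult[of w "gen c * v"] len_mult[of "gen c" "w * (gen c * v)"] W c c1 by auto
  have split: "g = u * (gen c * (w * (gen c * v)))" "g = ?uc * (w * (gen c * v))"
    "g = ?p * (gen c * v)" "g = (?p * gen c) * v"
    using g by (simp_all add: mult.assoc)
  have ge: "len g \<le> len u + len (gen c * (w * (gen c * v)))" "len g \<le> len ?uc + len (w * (gen c * v))"
    "len g \<le> len ?p + len (gen c * v)" "len g \<le> len (?p * gen c) + len v"
    using len_mult[of u "gen c * (w * (gen c * v))"] len_mult[of ?uc "w * (gen c * v)"]
      len_mult[of ?p "gen c * v"] len_mult[of "?p * gen c" v] split W c by simp_all
  have eq: "len g = len u + len (gen c * (w * (gen c * v)))" "len g = len ?uc + len (w * (gen c * v))"
    "len g = len ?p + len (gen c * v)" "len g = len (?p * gen c) + len v"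
    "len ?uc = len u + 1" "len (?p * gen c) = len ?p + 1" "len ?p = len ?uc + len w"
    using ge le l by linarith+
  have pre: "N x \<subseteq> N g" if "x \<in> W" "y \<in> W" "g = x * y" "len g = len x + len y" for x y
    using N_prefix[OF that(1,2)] that by auto
  show sub: "N u \<subseteq> N g" "N ?p \<subseteq> N g"
    using pre[OF _ _ split(1) eq(1)] pre[OF _ _ split(3) eq(3)] W c by auto
  have sub': "N ?uc \<subseteq> N g" "N (?p * gen c) \<subseteq> N g" "N ?uc \<subseteq> N ?p"
    using pre[OF _ _ split(2) eq(2)] pre[OF _ _ split(4) eq(4)] N_prefix[of ?uc w] eq(7) W c by auto
  have KK: "K * u = ?uc" "K' * ?p = ?p * gen c" unfolding K K' by (simp_all add: mult.assoc)
  show notin: "K \<notin> N u" "K' \<notin> N ?p"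
    using len_refl_less[of u K] len_refl_less[of ?p K'] KK eq W c by auto
  have "K \<in> N ?uc" "K' \<in> N (?p * gen c)"
    using N_gen_right[of u c K] N_gen_right[of ?p c K'] notin K K' W c by auto
  then show in': "K \<in> N g" "K' \<in> N g" using sub' by auto
  have "K \<in> N ?p" using \<open>K \<in> N ?uc\<close> sub' by blast
  then show ne: "K \<noteq> K'" using notin by blast
  have r: "K \<in> refls" "K' \<in> refls" unfolding K K' by (rule reflI; use W c in simp)+
  have gW: "g \<in> W" using g W c by simp
  have "colour K = colour K'"
    unfolding K K' using colour_conj[of u "gen c"] colour_conj[of ?p "gen c"] W c by simp
  then have "K * K' \<noteq> K' * K" using commuting_refls_colour r ne by blast
  moreover have "g \<in> half K \<inter> half K'" "?p \<in> half K - half K'"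
    using in' gW \<open>K \<in> N ?p\<close> notin W c by (auto simp: half_def)
  ultimately show "half K' \<subseteq> half K" using half_trichotomy[OF r] by blast
qed

text \<open>Among all factorisations through the two walls, take one with \<open>w\<close> as short as possible.\<close>

lemma bridge_factorisation:
  assumes W: "u \<in> W" "w \<in> W" "v \<in> W" and c: "c \<in> V"
    and g: "g = u * (gen c * (w * (gen c * v)))" and l: "len g = len u + len w + len v + 2"
    and K: "K = u * gen c * inverse u" and K': "K' = (u * gen c * w) * gen c * inverse (u * gen c * w)"
  shows "\<exists>u\<in>W. \<exists>w\<in>W. \<exists>v\<in>W. g = u * (gen c * (w * (gen c * v))) \<and> len g = len u + len w + len v + 2 \<and>
    K = u * gen c * inverse u \<and> K' = (u * gen c * w) * gen c * inverse (u * gen c * w) \<and>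
    N w \<inter> span (star c) = {} \<and> N (inverse w) \<inter> span (star c) = {}"
proof -
  define fac where "fac p \<longleftrightarrow> (case p of (u, w, v) \<Rightarrow> u \<in> W \<and> w \<in> W \<and> v \<in> W \<and>
    g = u * (gen c * (w * (gen c * v))) \<and> len g = len u + len w + len v + 2 \<and>
    K = u * gen c * inverse u \<and> K' = (u * gen c * w) * gen c * inverse (u * gen c * w))" for p
  have "fac (u, w, v)" using assms by (simp add: fac_def)
  then obtain p where p: "fac p" and min: "\<And>q. fac q \<Longrightarrow> len (fst (snd p)) \<le> len (fst (snd q))"
    using arg_min_nat_lemma[of fac _ "\<lambda>q. len (fst (snd q))"] by blast
  obtain u w v where pu: "p = (u, w, v)" by (cases p)
  have f: "u \<in> W" "w \<in> W" "v \<in> W" "g = u * (gen c * (w * (gen c * v)))" "len g = len u + len w + len v + 2"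
    "K = u * gen c * inverse u" "K' = (u * gen c * w) * gen c * inverse (u * gen c * w)"
    using p unfolding fac_def pu by auto
  have bound: "len g \<le> len u' + len w' + len v' + 2"
    if "u' \<in> W" "w' \<in> W" "v' \<in> W" "g = u' * (gen c * (w' * (gen c * v')))" for u' w' v'
  proof -
    have "len (gen c) \<le> 1" using len_le[of "[c]"] c by simp
    then show ?thesis
      using len_mult[of u' "gen c * (w' * (gen c * v'))"] len_mult[of "gen c" "w' * (gen c * v')"]
        len_mult[of w' "gen c * v'"] len_mult[of "gen c" v'] that c by simp
  qed
  have short: "len g \<le> len a + 1 + len b" if "a \<in> W" "b \<in> W" "g = a * (gen c * b)" for a b
  proof -
    have "len (gen c) \<le> 1" using len_le[of "[c]"] c by simp
    then show ?thesis
      using len_mult[of a "gen c * b"] len_mult[of "gen c" b] that c by simp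
  qed
  have len_s: "len (x * gen s) \<le> len x + 1" "len (gen s * x) \<le> len x + 1" if "s \<in> V" "x \<in> W" for s x
    using len_le[of "[s]"] len_mult[of x "gen s"] len_mult[of "gen s" x] that by simp_all
  have "gen s \<notin> N w" if s: "s \<in> star c" for s
  proof
    assume sw: "gen s \<in> N w"
    have sV: "s \<in> V" using s star_V by blast
    let ?w = "gen s * w"
    have w': "?w \<in> W" "len w = Suc (len ?w)" using gen_in_N[OF sV f(2) sw] f sV by auto
    \<comment> \<open>For \<open>s = c\<close> two letters \<open>c\<close> cancel and
      \<open>g\<close> becomes too short. Any other letter of the star commutes with
      \<open>c\<close> and slides across the wall into \<open>u\<close>, leaving a shorter
      \<open>w\<close>.\<close>
    show False
    proof (cases "s = c")
      case True
      then have "g = (u * ?w) * (gen c * v)" using f c by (simp add: mult.assoc)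
      then have "len g \<le> len (u * ?w) + 1 + len v" using short[OF mult_span[OF f(1) w'(1)] f(3)] by blast
      then show False using len_mult[of u ?w] f w' by simp
    next
      case False
      have sc: "gen s * gen c = gen c * gen s" using star_commute s by blast
      have sc': "gen s * (gen c * x) = gen c * (gen s * x)" for x
        using sc by (metis mult.assoc)
      have us: "u * gen s \<in> W" using f sV by simp
      have "fac (u * gen s, ?w, v)"
        unfolding fac_def prod.case
      proof (intro conjI us w'(1) f(3))
        show eq: "g = u * gen s * (gen c * (?w * (gen c * v)))"
          using f sV by (simp add: mult.assoc sc')
        have "len g \<le> len (u * gen s) + len ?w + len v + 2" using bound[OF us w'(1) f(3) eq] .
        then show "len g = len (u * gen s) + len ?w + len v + 2"
          using f w' len_s(1)[OF sV f(1)] by simp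
        have e: "u * gen s * gen c * ?w = u * gen c * w" using sV by (simp add: mult.assoc sc')
        show "K' = u * gen s * gen c * ?w * gen c * inverse (u * gen s * gen c * ?w)"
          unfolding e by (rule f(7))
        show "K = u * gen s * gen c * inverse (u * gen s)"
          using f sV by (simp add: mult.assoc sc')
      qed
      then show False using min w' unfolding pu by fastforce
    qed
  qed
  then have 1: "N w \<inter> span (star c) = {}" using N_coset_disjoint f star_V by blast
  have "gen s \<notin> N (inverse w)" if s: "s \<in> star c" for s
  proof
    assume sw: "gen s \<in> N (inverse w)"
    have sV: "s \<in> V" using s star_V by blast
    let ?w = "w * gen s"
    have "len (inverse w) = Suc (len (gen s * inverse w))" using gen_in_N[OF sV _ sw] f by simp
    moreover have "len (gen s * inverse w) = len ?w" using len_inv[of ?w] f sV by simp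
    ultimately have w': "?w \<in> W" "len w = Suc (len ?w)" using f sV len_inv by auto
    show False
    proof (cases "s = c")
      case True
      then have "g = u * (gen c * (?w * v))" using f c by (simp add: mult.assoc)
      then have "len g \<le> len u + 1 + len (?w * v)" using short[OF f(1) mult_span[OF w'(1) f(3)]] by blast
      then show False using len_mult[of ?w v] f w' by simp
    next
      case False
      have sc: "gen s * gen c = gen c * gen s" using star_commute s by blast
      have sc': "gen s * (gen c * x) = gen c * (gen s * x)" for x
        using sc by (metis mult.assoc)
      have vs: "gen s * v \<in> W" using f sV by simp
      have "fac (u, ?w, gen s * v)"
        unfolding fac_def prod.case
      proof (intro conjI vs w'(1) f(1,6))
        show eq: "g = u * (gen c * (?w * (gen c * (gen s * v))))"
          using f sV by (simp add: mult.assoc sc'[symmetric])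
        have "len g \<le> len u + len ?w + len (gen s * v) + 2" using bound[OF f(1) w'(1) vs eq] .
        then show "len g = len u + len ?w + len (gen s * v) + 2"
          using f w' len_s(2)[OF sV f(3)] by simp
        show "K' = u * gen c * ?w * gen c * inverse (u * gen c * ?w)"
          using f sV by (simp add: mult.assoc sc')
      qed
      then show False using min w' unfolding pu by fastforce
    qed
  qed
  then have 2: "N (inverse w) \<inter> span (star c) = {}" using N_coset_disjoint f star_V by auto
  show ?thesis using f 1 2 by blast
qed

text \<open>A wall crossed by a shortest path does not commute with \<open>t v\<close>, so within
  the system it would belong to a non-adjacent vertex and have a disjoint half-space; but
  \<open>g * gen a\<close> would lie beyond both. The path thus avoids all half-spaces of the
  system, and its points can later decide orientations.\<close>

lemma system_notin_N:
  assumes pp: "ping_pong_system \<Phi> t" and v: "v \<in> verts \<Phi>" and x: "x \<in> verts \<Phi>"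
    and g: "g \<in> W" "a \<in> V" "t v = g * gen a * inverse g" "len g = depth (t v)"
  shows "t x \<notin> N g"
proof
  assume xN: "t x \<in> N g"
  have nc: "t x * t v \<noteq> t v * t x" using minimal_notin_N[OF g xN] .
  then have "x \<noteq> v" by auto
  moreover have "{x, v} \<notin> edges \<Phi>" using nc pp by (auto simp: ping_pong_system_def)
  ultimately have dis: "half (t x) \<inter> half (t v) = {}" using pp v x by (auto simp: ping_pong_system_def)
  have "t v \<notin> N g" using minimal_notin_N[OF g, of "t v"] by blast
  then have "g * gen a \<in> half (t v)" using N_gen_right[of g a "t v"] g by (auto simp: half_def)
  moreover have "t x \<noteq> t v" using nc by auto
  then have "g * gen a \<in> half (t x)" using N_gen_right[of g a "t x"] g xN by (simp add: half_def)
  ultimately show False using dis by blast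
qed

text \<open>The strip between two walls \<open>K\<close> and \<open>K'\<close> of the same colour is cut out: everything beyond
  \<open>K'\<close> is translated by \<open>\<tau>\<close>, which carries \<open>K'\<close> to \<open>K\<close> along a bridge and therefore fixes every
  wall crossing both.\<close>

lemma shrink_strip:
  fixes \<Phi> :: "'b graph"
  assumes simp: "simplicial_graph \<Phi>" and fin: "finite (verts \<Phi>)" and pp: "ping_pong_system \<Phi> t"
    and v0: "v0 \<in> verts \<Phi>"
    and ga: "g \<in> W" "a \<in> V" "t v0 = g * gen a * inverse g" "len g = depth (t v0)"
    and W: "u \<in> W" "w \<in> W" "v \<in> W" and c: "c \<in> V"
    and g: "g = u * (gen c * (w * (gen c * v)))" and l: "len g = len u + len w + len v + 2"
    and K: "K = u * gen c * inverse u" and K': "K' = (u * gen c * w) * gen c * inverse (u * gen c * w)"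
    and beyond: "\<And>x. x \<in> verts \<Phi> \<Longrightarrow> half (t x) \<subseteq> half K \<longleftrightarrow> half (t x) \<subseteq> half K'"
    and before: "\<And>x. x \<in> verts \<Phi> \<Longrightarrow> half (t x) \<inter> half K = {} \<longleftrightarrow> half (t x) \<inter> half K' = {}"
    and v0': "half (t v0) \<subseteq> half K'"
  shows "\<exists>t'. ping_pong_system \<Phi> t' \<and> (\<Sum>v\<in>verts \<Phi>. depth (t' v)) < (\<Sum>v\<in>verts \<Phi>. depth (t v))"
proof -
  obtain u w v where W: "u \<in> W" "w \<in> W" "v \<in> W"
    and g: "g = u * (gen c * (w * (gen c * v)))" and l: "len g = len u + len w + len v + 2"
    and K: "K = u * gen c * inverse u" and K': "K' = (u * gen c * w) * gen c * inverse (u * gen c * w)"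
    and wL: "N w \<inter> span (star c) = {}" "N (inverse w) \<inter> span (star c) = {}"
    using bridge_factorisation[OF W c g l K K'] by blast
  note nest = nested_walls[OF W c g l K K']
  let ?p = "u * gen c * w"
  \<comment> \<open>The solution of \<open>\<tau> * ?p = u\<close>: it takes the edge across
    \<open>K'\<close> starting at \<open>?p\<close> to the edge across \<open>K\<close> starting at
    \<open>u\<close>.\<close>
  define \<tau> where "\<tau> = u * inverse w * gen c * inverse u"
  have \<tau>W: "\<tau> \<in> W" "?p \<in> W" using W c by (auto simp: \<tau>_def)
  have \<tau>p: "\<tau> * ?p = u" using c by (simp add: \<tau>_def mult.assoc)
  have refl: "t x \<in> refls" if "x \<in> verts \<Phi>" for x using pp that by (auto simp: ping_pong_system_def)
  have Kr: "K \<in> refls" "K' \<in> refls" unfolding K K' by (rule reflI; use W c in simp)+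
  have notin: "t x \<notin> N g" "t x \<notin> N u" "t x \<notin> N ?p" "t x \<noteq> K" "t x \<noteq> K'" if "x \<in> verts \<Phi>" for x
    using system_notin_N[OF pp v0 that ga] nest by auto
  have \<tau>K: "\<tau> * K' * inverse \<tau> = K"
  proof -
    have "\<tau> * K' * inverse \<tau> = (\<tau> * ?p) * gen c * inverse (\<tau> * ?p)" unfolding K' by (simp add: mult.assoc)
    then show ?thesis unfolding \<tau>p K .
  qed
  have halfK: "\<tau> * x \<in> half K \<longleftrightarrow> x \<in> half K'" if "x \<in> W" for x
    using half_conj[OF Kr(2) \<tau>W(1) that \<tau>W(2)] nest unfolding \<tau>K \<tau>p by (simp add: half_def)
  let ?B = "{x \<in> verts \<Phi>. half (t x) \<subseteq> half K'}"
  define t' where "t' x = (if x \<in> ?B then \<tau> * t x * inverse \<tau> else t x)" for x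
  \<comment> \<open>The point that fixes the orientation is \<open>inverse \<tau>\<close>: it lies
    outside \<open>half K'\<close>, and its image 1 lies in no half-space.\<close>
  have halfB: "\<tau> * y \<in> half (\<tau> * t x * inverse \<tau>) \<longleftrightarrow> y \<in> half (t x)" if x: "x \<in> ?B" and y: "y \<in> W" for x y
  proof (rule half_conj[OF refl \<tau>W(1) y])
    show "inverse \<tau> \<in> W" using \<tau>W by simp
    have "inverse \<tau> \<notin> half K'" using halfK[of "inverse \<tau>"] \<tau>W by simp
    then show "inverse \<tau> \<in> half (t x) \<longleftrightarrow> \<tau> * inverse \<tau> \<in> half (\<tau> * t x * inverse \<tau>)" using x by auto
  qed (use x in auto)
  have halfB_K: "half (\<tau> * t x * inverse \<tau>) \<subseteq> half K" if x: "x \<in> ?B" for x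
  proof
    fix y assume y: "y \<in> half (\<tau> * t x * inverse \<tau>)"
    then have "y \<in> W" by (simp add: half_def)
    then have "inverse \<tau> * y \<in> half (t x)" using halfB[OF x, of "inverse \<tau> * y"] y \<tau>W by simp
    then have "inverse \<tau> * y \<in> half K'" using x by blast
    then show "y \<in> half K" using halfK[of "inverse \<tau> * y"] \<tau>W \<open>y \<in> W\<close> by simp
  qed
  \<comment> \<open>A wall neither beyond nor before \<open>K'\<close> is, by \<open>beyond\<close>
    and \<open>before\<close>, in the same position to \<open>K\<close>, and commutes with both.
    Seen from either end of the bridge \<open>w\<close>, it is in the centraliser of
    \<open>gen c\<close>; by \<open>double_coset_commute\<close> it commutes with \<open>w\<close>,
    too, and so with \<open>\<tau>\<close>.\<close>
  have crossing: "t x * \<tau> = \<tau> * t x" "\<And>y. y \<in> W \<Longrightarrow> \<tau> * y \<in> half (t x) \<longleftrightarrow> y \<in> half (t x)"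
    if x: "x \<in> verts \<Phi>" "x \<notin> ?B" "half (t x) \<inter> half K' \<noteq> {}" for x
  proof -
    have com: "t x * L = L * t x"
      if L: "L \<in> refls" "L \<in> N g" "\<not> half (t x) \<subseteq> half L" "half (t x) \<inter> half L \<noteq> {}" for L
    proof (rule ccontr)
      assume "t x * L \<noteq> L * t x"
      then have "half L \<subseteq> half (t x)" using half_trichotomy[OF refl[OF x(1)] L(1)] L by blast
      then have "g \<in> half (t x)" using L ga by (auto simp: half_def)
      then show False using notin x by (simp add: half_def)
    qed
    have cK: "t x * K = K * t x" using com[OF Kr(1) nest(1)] x beyond before by blast
    have cK': "t x * K' = K' * t x" using com[OF Kr(2) nest(2)] x by blast
    let ?d = "inverse u * t x * u"
    have txW: "t x \<in> W" using refl x by simp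
    have dW: "?d \<in> W" using txW W by simp
    have dc: "?d * gen c = gen c * ?d"
      using cK conj_commute_iff[of u ?d "gen c"] unfolding K by (simp add: mult.assoc)
    have d: "?d \<in> span (star c)" using centralizer_gen[OF dW c dc] .
    have d': "inverse w * ?d * w \<in> span (star c)"
    proof (rule centralizer_gen)
      show "inverse w * ?d * w \<in> W" using dW W by simp
      have "gen c * ?d * gen c = ?d" using dc c by (metis gen_sq mult.assoc mult.right_neutral)
      then have "inverse ?p * t x * ?p = inverse w * ?d * w"
        using c by (simp add: mult.assoc) (metis mult.assoc)
      moreover have "inverse ?p * t x * ?p * gen c = gen c * (inverse ?p * t x * ?p)"
        using cK' conj_commute_iff[of ?p "inverse ?p * t x * ?p" "gen c"] unfolding K'
        by (simp add: mult.assoc)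
      ultimately show "inverse w * ?d * w * gen c = gen c * (inverse w * ?d * w)" by simp
    qed (rule c)
    have "?d \<in> span {s \<in> star c. gen s * w = w * gen s}"
      by (rule double_coset_commute[OF star_V W(2) wL d d'])
    then have dw: "?d * w = w * ?d" by (rule span_commute) auto
    then have "?d * (inverse w * gen c) = (inverse w * gen c) * ?d"
      using dc commute_inv[of w ?d] by (metis mult.assoc)
    then show comm: "t x * \<tau> = \<tau> * t x"
      using conj_commute_iff[of u ?d "inverse w * gen c"] unfolding \<tau>_def by (simp add: mult.assoc)
    fix y assume y: "y \<in> W"
    have e: "\<tau> * t x * inverse \<tau> = t x" using comm by (simp add: mult.assoc flip: comm)
    show "\<tau> * y \<in> half (t x) \<longleftrightarrow> y \<in> half (t x)"
      using half_conj[OF refl[OF x(1)] \<tau>W(1) y \<tau>W(2)] notin[OF x(1)] unfolding e \<tau>p by (simp add: half_def)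
  qed
  \<comment> \<open>A shortest path \<open>h\<close> to a wall beyond \<open>K'\<close> crosses
    \<open>K\<close> at \<open>?y\<close> and \<open>K'\<close> at \<open>?z\<close>. These points
    differ from the ends of the bridge by elements \<open>?e\<close> and \<open>?e'\<close> of the
    centraliser of \<open>gen c\<close>, so \<open>double_coset_len\<close> bounds the piece between
    them from below. Translation by \<open>\<tau>\<close> replaces that piece by
    \<open>inverse ?e * ?e'\<close> and saves at least one letter.\<close>
  have depth: "depth (t' x) < depth (t x)" if x: "x \<in> ?B" for x
  proof -
    have xV: "x \<in> verts \<Phi>" and sub: "half (t x) \<subseteq> half K'" "half (t x) \<subseteq> half K" using x nest by auto
    obtain h b where hb: "h \<in> W" "b \<in> V" "t x = h * gen b * inverse h" "len h = depth (t x)"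
      using depthE[OF refl[OF xV]] .
    have Kh: "K \<in> N h" "K' \<in> N h"
      using half_subset_in_N[OF hb sub(2)] half_subset_in_N[OF hb sub(1)] notin[OF xV] by metis+
    have col: "s = c" if "p \<in> W" "s \<in> V" "q \<in> W" "p * gen s * inverse p = q * gen c * inverse q" for s p q
      using colour_conj[of p "gen s"] colour_conj[of q "gen c"] that c by simp
    obtain hs where hs: "hs \<in> lists V" "val hs = h" "length hs = len h" using reduced_word[OF hb(1)] by blast
    then obtain ys s zs where 1: "hs = ys @ s # zs" "K = val ys * gen s * inverse (val ys)"
      using N_split[of hs K] Kh by auto
    have ys: "ys \<in> lists V" "s \<in> V" "zs \<in> lists V" using hs 1 by auto
    have "s = c" using col[of "val ys" s u] 1 K ys W by simp
    let ?y = "val ys"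
    have yW: "?y \<in> W" "val zs \<in> W" using ys by auto
    have h1: "h = (?y * gen c) * val zs" using hs 1 \<open>s = c\<close> by (simp add: mult.assoc)
    have lz: "len (val zs) \<le> length zs" "len ?y \<le> length ys" using len_le ys by auto
    have "K \<notin> N ?y"
    proof
      assume "K \<in> N ?y"
      then have "len (K * ?y) < len ?y" using len_refl_less yW by blast
      moreover have "K * ?y = ?y * gen c" using 1 \<open>s = c\<close> by (simp add: mult.assoc)
      ultimately have "len h < len ?y + len (val zs)" using h1 len_mult[of "?y * gen c" "val zs"] yW c by simp
      then show False using lz hs 1 by simp
    qed
    then have "K' \<notin> N ?y" using nest(7) yW by (auto simp: half_def)
    moreover have "K' \<noteq> ?y * gen c * inverse ?y" using nest(8) 1 \<open>s = c\<close> by simp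
    ultimately have "K' \<notin> N (?y * gen c)" using N_gen_right yW c by simp
    then have "inverse (?y * gen c) * K' * (?y * gen c) \<in> N (val zs)"
      using Kh(2) N_mult[of "?y * gen c" "val zs" K'] h1 yW c by simp
    then obtain ms s' vs where 2: "zs = ms @ s' # vs"
      "inverse (?y * gen c) * K' * (?y * gen c) = val ms * gen s' * inverse (val ms)"
      using N_split ys by blast
    have ms: "ms \<in> lists V" "s' \<in> V" "vs \<in> lists V" using ys 2 by auto
    let ?z = "?y * gen c * val ms"
    have "K' = (?y * gen c) * (val ms * gen s' * inverse (val ms)) * inverse (?y * gen c)"
      using 2(2) conj_eq_iff[of "?y * gen c" K'] by metis
    then have K'z: "K' = ?z * gen s' * inverse ?z" by (simp add: mult.assoc)
    have zW: "?z \<in> W" "val ms \<in> W" "val vs \<in> W" using yW ms c by auto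
    have "s' = c" using col[of ?z s' ?p] K'z K' zW ms \<tau>W by simp
    have h2: "h = ?z * (gen c * val vs)" using h1 2 \<open>s' = c\<close> by (simp add: mult.assoc)
    let ?e = "inverse u * ?y" and ?e' = "inverse ?p * ?z"
    have comm: "inverse q * p * gen c = gen c * (inverse q * p)"
      if "p * gen c * inverse p = q * gen c * inverse q" for p q
    proof -
      have "inverse q * (p * gen c * inverse p) * p = inverse q * (q * gen c * inverse q) * p" using that by simp
      then show ?thesis by (simp add: mult.assoc)
    qed
    have ec: "?e * gen c = gen c * ?e" using comm[of ?y u] 1 K \<open>s = c\<close> by simp
    have e: "?e \<in> span (star c)" using centralizer_gen[OF _ c ec] W yW by simp
    have e'W: "?e' \<in> W" by (rule mult_span[OF inv_W[OF \<tau>W(2)] zW(1)])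
    have "?e' * gen c = gen c * ?e'" using comm[of ?z ?p] K'z K' \<open>s' = c\<close> by simp
    then have e': "?e' \<in> span (star c)" using centralizer_gen[OF e'W c] by blast
    have ie: "inverse ?e \<in> span (star c)" using inv_span e star_V by blast
    have "val ms = inverse ?e * w * ?e'"
    proof -
      have "inverse ?e * gen c = gen c * inverse ?e" using commute_inv ec by blast
      then have "inverse ?e * w = gen c * (inverse ?e * (gen c * w))"
        using c by (metis gen_gen mult.assoc)
      moreover have "gen c * (inverse ?e * (gen c * w)) * ?e' = val ms" using c by (simp add: mult.assoc)
      ultimately show ?thesis by simp
    qed
    then have lm: "len (inverse ?e * ?e') + len w \<le> len (val ms)"
      using double_coset_len[OF star_V W(2) wL ie e'] by simp
    have "\<tau> * h = ?y * (inverse ?e * ?e') * (gen c * val vs)"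
    proof -
      have "\<tau> * ?z = \<tau> * ?p * ?e'" by (simp add: mult.assoc)
      also have "\<dots> = ?y * (inverse ?e * ?e')" unfolding \<tau>p by (simp add: mult.assoc)
      finally show ?thesis using h2 by (metis mult.assoc)
    qed
    moreover have "len (gen c * val vs) \<le> 1 + length vs"
      using len_le[of "c # vs"] ms c by simp
    moreover have "len (?y * (inverse ?e * ?e') * (gen c * val vs))
        \<le> len ?y + len (inverse ?e * ?e') + len (gen c * val vs)"
      using len_mult[of "?y * (inverse ?e * ?e')" "gen c * val vs"] len_mult[of ?y "inverse ?e * ?e'"]
        yW zW W \<tau>W c by simp
    moreover have "len (val ms) \<le> length ms" using len_le ms by blast
    ultimately have "len (\<tau> * h) < len h" using lm lz hs 1 2 by simp
    moreover have "depth (t' x) \<le> len (\<tau> * h)" using depth_conj_le[of h b \<tau>] hb \<tau>W x by (simp add: t'_def)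
    ultimately show ?thesis using hb by simp
  qed
  have pair: "half (t' x) \<inter> half (t' y) = {}"
    if x: "x \<in> ?B" and y: "y \<in> verts \<Phi>" "y \<notin> ?B" and xy: "half (t x) \<inter> half (t y) = {}" for x y
  proof (cases "half (t y) \<inter> half K' = {}")
    case True
    then have "half (t y) \<inter> half K = {}" using before y by blast
    then show ?thesis using halfB_K[OF x] x y by (auto simp: t'_def)
  next
    case False
    show ?thesis
    proof (rule ccontr)
      assume "half (t' x) \<inter> half (t' y) \<noteq> {}"
      then obtain z where z: "z \<in> half (\<tau> * t x * inverse \<tau>)" "z \<in> half (t y)"
        using x y by (auto simp: t'_def)
      then have zW: "inverse \<tau> * z \<in> W" using \<tau>W by (simp add: half_def)
      have "inverse \<tau> * z \<in> half (t x)" using halfB[OF x zW] z by simp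
      moreover have "inverse \<tau> * z \<in> half (t y)" using crossing(2)[OF y False zW] z by simp
      ultimately show False using xy by blast
    qed
  qed
  \<comment> \<open>Distinct commuting walls have intersecting half-spaces, so a wall not beyond
    \<open>K'\<close> that commutes with one beyond it must cross \<open>K'\<close>, and is fixed
    under conjugation by \<open>\<tau>\<close>.\<close>
  have edge: "t' x \<noteq> t' y \<and> t' x * t' y = t' y * t' x"
    if x: "x \<in> ?B" and y: "y \<in> verts \<Phi>" "y \<notin> ?B" and xy: "t x \<noteq> t y" "t x * t y = t y * t x" for x y
  proof -
    have "half (t x) \<inter> half (t y) \<noteq> {}"
      using crossing_corners(1)[OF refl refl xy] x y by auto
    then have "half (t y) \<inter> half K' \<noteq> {}" using x by auto
    then have e: "t y = \<tau> * t y * inverse \<tau>"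
      using crossing(1)[OF y] by (metis conj_eq_iff inv_mult_cancel mult.assoc mult_inv_cancel right_inv mult.right_neutral)
    have "t' x = \<tau> * t x * inverse \<tau>" "t' y = \<tau> * t y * inverse \<tau>" using x y e by (simp_all add: t'_def)
    then show ?thesis using xy conj_commute_iff[of \<tau> "t x" "t y"] by (simp add: mult.assoc)
  qed
  have "ping_pong_system \<Phi> t'"
    unfolding ping_pong_system_def
  proof (intro conjI ballI allI impI)
    fix x assume "x \<in> verts \<Phi>"
    then show "t' x \<in> refls" using conj_refl[OF refl \<tau>W(1)] refl by (simp add: t'_def)
  next
    fix x y assume e: "{x, y} \<in> edges \<Phi>"
    then have xy: "x \<in> verts \<Phi>" "y \<in> verts \<Phi>" using edge_verts[OF simp] by auto
    have t: "t x \<noteq> t y" "t x * t y = t y * t x" using e pp unfolding ping_pong_system_def by blast+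
    have "t' x \<noteq> t' y \<and> t' x * t' y = t' y * t' x"
    proof (cases "x \<in> ?B")
      case True
      then show ?thesis
        using edge[of x y] xy t conj_commute_iff[of \<tau> "t x" "t y"]
        by (cases "y \<in> ?B") (auto simp: t'_def)
    next
      case False
      then show ?thesis using edge[of y x] xy t by (cases "y \<in> ?B") (auto simp: t'_def)
    qed
    then show "t' x \<noteq> t' y" "t' x * t' y = t' y * t' x" by auto
  next
    fix x y assume xy: "x \<in> verts \<Phi>" "y \<in> verts \<Phi>" "x \<noteq> y" "{x, y} \<notin> edges \<Phi>"
    then have d: "half (t x) \<inter> half (t y) = {}" using pp by (auto simp: ping_pong_system_def)
    consider "x \<in> ?B" "y \<in> ?B" | "x \<in> ?B" "y \<notin> ?B" | "x \<notin> ?B" "y \<in> ?B" | "x \<notin> ?B" "y \<notin> ?B" by blast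
    then show "half (t' x) \<inter> half (t' y) = {}"
    proof cases
      case 1
      show ?thesis
      proof (rule ccontr)
        assume "half (t' x) \<inter> half (t' y) \<noteq> {}"
        then obtain z where z: "z \<in> half (\<tau> * t x * inverse \<tau>)" "z \<in> half (\<tau> * t y * inverse \<tau>)"
          using 1 by (auto simp: t'_def)
        then have zW: "inverse \<tau> * z \<in> W" using \<tau>W by (simp add: half_def)
        then show False using halfB[OF 1(1) zW] halfB[OF 1(2) zW] z d by auto
      qed
    next
      case 4
      have "t' x = t x" "t' y = t y" using 4 unfolding t'_def by (simp_all only: if_False)
      then show ?thesis using d by simp
    qed (use pair[of x y] pair[of y x] xy d in blast)+
  qed
  moreover have "(\<Sum>v\<in>verts \<Phi>. depth (t' v)) < (\<Sum>v\<in>verts \<Phi>. depth (t v))"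
  proof (intro sum_strict_mono_ex1[OF fin] ballI bexI[of _ v0])
    fix x show "depth (t' x) \<le> depth (t x)" using depth[of x] by (cases "x \<in> ?B") (auto simp: t'_def)
  qed (use v0 v0' depth in auto)
  ultimately show ?thesis by blast
qed


lemma shrink_step:
  fixes \<Phi> :: "'b graph"
  assumes simp: "simplicial_graph \<Phi>" and fin: "finite (verts \<Phi>)" and finV: "finite V"
    and pp: "ping_pong_system \<Phi> t" and v0: "v0 \<in> verts \<Phi>"
    and large: "(1 + 2 * card (verts \<Phi>)) * card V < depth (t v0)"
  shows "\<exists>t'. ping_pong_system \<Phi> t' \<and> (\<Sum>v\<in>verts \<Phi>. depth (t' v)) < (\<Sum>v\<in>verts \<Phi>. depth (t v))"
proof -
  let ?m = "card (verts \<Phi>)"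
  have refl: "t x \<in> refls" if "x \<in> verts \<Phi>" for x using pp that by (auto simp: ping_pong_system_def)
  obtain g a where ga: "g \<in> W" "a \<in> V" "t v0 = g * gen a * inverse g" "len g = depth (t v0)"
    using depthE[OF refl[OF v0]] .
  obtain gs where gs: "gs \<in> lists V" "val gs = g" "length gs = len g" using reduced_word ga by blast
  define pos where "pos c = {i. i < length gs \<and> gs ! i = c}" for c
  have "\<exists>c\<in>V. 1 + 2 * ?m < card (pos c)"
  proof (rule ccontr)
    assume "\<not> ?thesis"
    then have le: "card (pos c) \<le> 1 + 2 * ?m" if "c \<in> V" for c using that by (meson not_less)
    have "{..<length gs} = (\<Union>c\<in>V. pos c)" using gs by (auto simp: pos_def)
    then have "length gs \<le> (\<Sum>c\<in>V. card (pos c))" using card_UN_le[OF finV, of pos] by (metis card_lessThan)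
    also have "\<dots> \<le> card V * (1 + 2 * ?m)" using sum_bounded_above[of V "\<lambda>c. card (pos c)" "1 + 2 * ?m"] le by simp
    finally show False using large gs ga by (simp add: mult.commute)
  qed
  then obtain c where c: "c \<in> V" "1 + 2 * ?m < card (pos c)" by blast
  define wall where "wall i = val (take i gs) * gen c * inverse (val (take i gs))" for i
  \<comment> \<open>Position of the wall of \<open>t x\<close>: 0 beyond, 1 crossing, 2 before. The
    total over the system has \<open>2 * ?m + 1\<close> possible values, fewer than there are walls
    of colour \<open>c\<close>. Since no position decreases along the nested chain, equal totals
    mean equal positions for every vertex.\<close>
  define \<sigma> :: "nat \<Rightarrow> 'b \<Rightarrow> nat" where
    "\<sigma> i x = of_bool (\<not> half (t x) \<subseteq> half (wall i)) + of_bool (half (t x) \<inter> half (wall i) = {})" for i x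
  have "(\<Sum>x\<in>verts \<Phi>. \<sigma> i x) \<in> {..2 * ?m}" for i
    using sum_bounded_above[of "verts \<Phi>" "\<sigma> i" 2] by (simp add: \<sigma>_def mult.commute)
  then have "card ((\<lambda>i. \<Sum>x\<in>verts \<Phi>. \<sigma> i x) ` pos c) \<le> card {..2 * ?m}"
    by (intro card_mono) auto
  then have "\<not> inj_on (\<lambda>i. \<Sum>x\<in>verts \<Phi>. \<sigma> i x) (pos c)" using c by (intro pigeonhole) simp
  then obtain i j where ij: "i \<in> pos c" "j \<in> pos c" "i < j" "(\<Sum>x\<in>verts \<Phi>. \<sigma> i x) = (\<Sum>x\<in>verts \<Phi>. \<sigma> j x)"
    unfolding inj_on_def by (metis linorder_neqE_nat)
  let ?u = "val (take i gs)" and ?mid = "drop (Suc i) (take j gs)" and ?rest = "drop (Suc j) gs"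
  let ?w = "val ?mid" and ?v = "val ?rest"
  have "take j gs = take i (take j gs) @ take j gs ! i # ?mid"
    by (rule id_take_nth_drop) (use ij in \<open>simp add: pos_def\<close>)
  then have tj: "take j gs = take i gs @ c # ?mid" using ij by (simp add: pos_def min_def)
  have "gs = take j gs @ gs ! j # ?rest"
    by (rule id_take_nth_drop) (use ij in \<open>simp add: pos_def\<close>)
  also have "gs ! j = c" using ij by (simp add: pos_def)
  finally have gs_eq: "gs = take i gs @ c # ?mid @ c # ?rest"
    using arg_cong[OF tj, of "\<lambda>l. l @ c # ?rest"] by (simp only: append_assoc append_Cons)
  have sub: "take k gs \<in> lists V" "drop k gs \<in> lists V" "drop k (take l gs) \<in> lists V" for k l
    using gs by (auto dest!: in_set_takeD in_set_dropD)
  have W: "?u \<in> W" "?w \<in> W" "?v \<in> W" using sub by (auto intro!: val_span)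
  have uj: "val (take j gs) = ?u * gen c * ?w" by (subst tj) (simp add: mult.assoc)
  have g: "g = ?u * (gen c * (?w * (gen c * ?v)))" by (subst gs(2)[symmetric], subst gs_eq) simp
  have "len (gen c) \<le> 1" using len_le[of "[c]"] c by simp
  then have "len g \<le> len ?u + len ?w + len ?v + 2"
    using len_mult[of ?u "gen c * (?w * (gen c * ?v))"] len_mult[of "gen c" "?w * (gen c * ?v)"]
      len_mult[of ?w "gen c * ?v"] len_mult[of "gen c" ?v] W c g by simp
  moreover have "length gs = length (take i gs) + length ?mid + length ?rest + 2"
    using arg_cong[OF gs_eq, of length] by simp
  moreover have "len ?u \<le> length (take i gs)" "len ?w \<le> length ?mid" "len ?v \<le> length ?rest"
    using len_le sub by blast+
  ultimately have l: "len g = len ?u + len ?w + len ?v + 2" using gs by linarith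
  have K: "wall i = ?u * gen c * inverse ?u"
    and K': "wall j = (?u * gen c * ?w) * gen c * inverse (?u * gen c * ?w)"
    unfolding wall_def uj by simp_all
  note nest = nested_walls[OF W c(1) g l K K']
  have mono: "\<sigma> i x \<le> \<sigma> j x" for x
    using nest(7) unfolding \<sigma>_def by (auto simp: of_bool_def)
  have eq: "\<sigma> i x = \<sigma> j x" if x: "x \<in> verts \<Phi>" for x
  proof (rule ccontr)
    assume "\<sigma> i x \<noteq> \<sigma> j x"
    then have "(\<Sum>x\<in>verts \<Phi>. \<sigma> i x) < (\<Sum>x\<in>verts \<Phi>. \<sigma> j x)"
      using mono x by (intro sum_strict_mono_ex1[OF fin]) (auto intro!: bexI[of _ x] simp: le_neq_implies_less)
    then show False using ij by simp
  qed
  have status: "half (t x) \<subseteq> half (wall i) \<longleftrightarrow> half (t x) \<subseteq> half (wall j)"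
    "half (t x) \<inter> half (wall i) = {} \<longleftrightarrow> half (t x) \<inter> half (wall j) = {}" if "x \<in> verts \<Phi>" for x
    using eq[OF that] nest(7) unfolding \<sigma>_def by (auto simp: of_bool_def split: if_splits)
  \<comment> \<open>\<open>g\<close> is beyond wall \<open>j\<close> but not beyond the wall of
    \<open>t v0\<close>, and \<open>g * gen a\<close> is beyond both; this is the only nesting
    left.\<close>
  have "half (t v0) \<subseteq> half (wall j)"
  proof -
    have notin: "t v0 \<notin> N g" using minimal_notin_N[OF ga, of "t v0"] by blast
    have nc: "wall j * t v0 \<noteq> t v0 * wall j" using minimal_notin_N[OF ga nest(2)] .
    have r: "wall j \<in> refls" unfolding wall_def using sub c by (intro reflI) auto
    have "g * gen a \<in> half (t v0)" using N_gen_right[of g a "t v0"] notin ga by (simp add: half_def)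
    moreover have "wall j \<noteq> t v0" using nc by auto
    then have "g * gen a \<in> half (wall j)" using N_gen_right[of g a "wall j"] nest(2) ga by (simp add: half_def)
    moreover have "g \<in> half (wall j)" "g \<notin> half (t v0)" using nest(2) notin ga by (simp_all add: half_def)
    ultimately show ?thesis using half_trichotomy[OF r refl[OF v0] nc] by blast
  qed
  then show ?thesis
    by (intro shrink_strip[OF simp fin pp v0 ga W c(1) g l K K']) (use status in blast)+
qed

text \<open>Descent on the total depth: folding applies when ping-pong fails, shrinking when it
  holds but some wall is too deep.\<close>

theorem bounded_refl_model:
  fixes \<Phi> :: "'b graph"
  assumes simp: "simplicial_graph \<Phi>" and fin: "finite (verts \<Phi>)" and finV: "finite V"
    and f: "refl_model \<Phi> f"
  shows "\<exists>t. refl_model \<Phi> t \<and> (\<forall>v\<in>verts \<Phi>. depth (t v) \<le> (1 + 2 * card (verts \<Phi>)) * card V)"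
  using f
proof (induction "\<Sum>v\<in>verts \<Phi>. depth (f v)" arbitrary: f rule: less_induct)
  case less
  show ?case
  proof (cases "ping_pong_system \<Phi> f")
    case False
    then show ?thesis using fold_step[OF fin less.prems] less.hyps by blast
  next
    case True
    show ?thesis
    proof (rule ccontr)
      assume none: "\<not> ?thesis"
      then obtain v where "v \<in> verts \<Phi>" "(1 + 2 * card (verts \<Phi>)) * card V < depth (f v)"
        using less.prems by (meson not_less)
      then obtain f' where "ping_pong_system \<Phi> f'"
        "(\<Sum>v\<in>verts \<Phi>. depth (f' v)) < (\<Sum>v\<in>verts \<Phi>. depth (f v))"
        using shrink_step[OF simp fin finV True] by blast
      then show False using less.hyps[of f'] ping_pong_refl_model[OF simp] none by blast
    qed
  qed
qed

end

section \<open>Getting rid of diagonal involutions\<close>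

context racg_model
begin

lemma half_gen_disjoint:
  "a \<in> V \<Longrightarrow> b \<in> V \<Longrightarrow> a \<noteq> b \<Longrightarrow> \<not> adj a b \<Longrightarrow> half (gen a) \<inter> half (gen b) = {}"
  using simple_in_N_adj by (auto simp: half_def)

lemma half_refl_conj_iff:
  assumes "r \<in> refls" "t \<in> refls" "half r \<inter> half t = {}" "y \<in> W"
  shows "r * y \<in> half t \<longleftrightarrow> y \<in> half (r * t * r)"
proof -
  have "t \<notin> N r" using refl_in_own[OF assms(1)] refl_W[OF assms(1)] assms(3) by (auto simp: half_def)
  then show ?thesis using assms N_mult[of r y t] by (simp add: half_def)
qed

lemma span_single: "a \<in> V \<Longrightarrow> x \<in> span {a} \<Longrightarrow> x = 1 \<or> x = gen a"
  by (erule span_induct) auto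

section \<open>Families of reflections with disjoint half-spaces\<close>

definition disjoint_refls :: "'g set \<Rightarrow> bool" where
  "disjoint_refls T \<longleftrightarrow> finite T \<and> T \<subseteq> refls \<and> pairwise (\<lambda>r t. half r \<inter> half t = {}) T"

lemma disjoint_refls_insert:
  assumes "disjoint_refls T" "r \<in> refls" "\<And>t. t \<in> T \<Longrightarrow> half r \<inter> half t = {}"
  shows "disjoint_refls (insert r T)" "card (insert r T) = Suc (card T)"
proof -
  have "r \<notin> T" using assms(2,3) own_half by blast
  then show "disjoint_refls (insert r T)" "card (insert r T) = Suc (card T)"
    using assms by (auto simp: disjoint_refls_def pairwise_insert Int_commute)
qed

lemma disjoint_refls_subset: "disjoint_refls T \<Longrightarrow> S \<subseteq> T \<Longrightarrow> disjoint_refls S"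
  unfolding disjoint_refls_def by (meson finite_subset pairwise_subset subset_trans)

text \<open>Reflecting two of at least three disjoint half-spaces into a third one yields one more.\<close>

lemma disjoint_refls_extend:
  assumes T: "disjoint_refls T" and card: "3 \<le> card T"
  shows "\<exists>T'. disjoint_refls T' \<and> card T' = Suc (card T)"
proof -
  obtain S where "S \<subseteq> T" "card S = 3" using obtain_subset_with_card_n[OF card] by blast
  then obtain x y z where xyz: "x \<in> T" "y \<in> T" "z \<in> T" "x \<noteq> y" "x \<noteq> z" "y \<noteq> z"
    by (auto simp: card_3_iff)
  have r: "x \<in> refls" "y \<in> refls" "z \<in> refls" using T xyz by (auto simp: disjoint_refls_def)
  have dis: "half s \<inter> half t = {}" if "s \<in> T" "t \<in> T" "s \<noteq> t" for s t
    using T that by (auto simp: disjoint_refls_def pairwise_def)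
  have sub: "half (z * x * z) \<subseteq> half z" "half (z * y * z) \<subseteq> half z"
    using half_refl_conj_subset r dis xyz by auto
  have "half (z * x * z) \<inter> half (z * y * z) = {}"
  proof (rule ccontr)
    assume "\<not> ?thesis"
    then obtain w where w: "w \<in> half (z * x * z)" "w \<in> half (z * y * z)" by blast
    then have "w \<in> W" by (simp add: half_def)
    then have "z * w \<in> half x \<inter> half y"
      using w half_refl_conj_iff[of z x w] half_refl_conj_iff[of z y w] r dis xyz by auto
    then show False using dis xyz by blast
  qed
  note new = this
  have zr: "z * x * z \<in> refls" "z * y * z \<in> refls"
    using conj_refl[of x z] conj_refl[of y z] r by auto
  have T0: "disjoint_refls (T - {z})" using disjoint_refls_subset[OF T] by blast
  have "half (z * x * z) \<inter> half t = {}" if "t \<in> T - {z}" for t using that sub dis xyz by blast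
  note T1 = disjoint_refls_insert[OF T0 zr(1) this]
  have "half (z * y * z) \<inter> half t = {}" if "t \<in> insert (z * x * z) (T - {z})" for t
    using that sub dis xyz new by blast
  note T2 = disjoint_refls_insert[OF T1(1) zr(2) this]
  have "finite T" using T by (simp add: disjoint_refls_def)
  then have "card T = Suc (card (T - {z}))" using xyz(3) by (rule card.remove)
  then show ?thesis using T1(2) T2 by metis
qed

lemma disjoint_refls_card:
  assumes "disjoint_refls T" "3 \<le> card T" "card T \<le> k"
  shows "\<exists>T'. disjoint_refls T' \<and> card T' = k"
  using assms(3)
proof (induction rule: dec_induct)
  case base
  then show ?case using assms by blast
next
  case (step n)
  then obtain T' where "disjoint_refls T'" "card T' = n" by blast
  then show ?case using disjoint_refls_extend[of T'] step assms by auto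
qed

text \<open>Conjugation by \<open>x\<close> or by \<open>y\<close> inverts every product of an even
  number of these letters, so one more letter in front makes the square trivial.\<close>

lemma odd_dihedral_word:
  assumes "x \<in> V" "y \<in> V" "ws \<in> lists {x, y}" "odd (length ws)"
  shows "val ws * val ws = 1"
proof -
  have "gen x * val es * gen x * val es = 1 \<and> gen y * val es * gen y * val es = 1"
    if "es \<in> lists {x, y}" "even (length es)" for es
    using that
  proof (induction es rule: induct_list012)
    case 1
    then show ?case using assms by simp
  next
    case (3 s t es)
    let ?e = "val es"
    have st: "s \<in> {x, y}" "t \<in> {x, y}" and "es \<in> lists {x, y}" "even (length es)" using 3 by auto
    then have "gen x * ?e * gen x * ?e = 1" "gen y * ?e * gen y * ?e = 1" using 3 by auto
    then have e: "gen x * (?e * gen x) = inverse ?e" "gen y * (?e * gen y) = inverse ?e"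
      by (metis inv_eqI inv_inv mult.assoc mult_inv_cancel mult.right_neutral right_cancel left_inv)+
    have e': "gen x * (?e * (gen x * z)) = inverse ?e * z" "gen y * (?e * (gen y * z)) = inverse ?e * z" for z
      using e by (metis mult.assoc)+
    have "inverse (gen x * (?e * gen x)) = ?e" "inverse (gen y * (?e * gen y)) = ?e" using e by auto
    then have i: "gen x * (inverse ?e * gen x) = ?e" "gen y * (inverse ?e * gen y) = ?e"
      using assms by (simp_all add: mult.assoc)
    have i': "gen x * (inverse ?e * (gen x * z)) = ?e * z" "gen y * (inverse ?e * (gen y * z)) = ?e * z" for z
      using i by (metis mult.assoc)+
    show ?case using st assms by (auto simp: mult.assoc e e' i i')
  qed simp
  moreover obtain s es where "ws = s # es" using assms by (cases ws) auto
  ultimately show ?thesis using assms by (auto simp: mult.assoc)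
qed

end

section \<open>Involutions over a triangle-free graph\<close>

locale triangle_free_racg_model = racg_model +
  assumes triangle_free: "triangle_free \<Gamma>"
begin

lemma no_triangle: "adj a b \<Longrightarrow> adj b c \<Longrightarrow> adj a c \<Longrightarrow> False"
  using triangle_free by (auto simp: triangle_free_def adj_def)

text \<open>The colour of an involution is a clique, so without triangles it has at most two
  letters.\<close>

lemma involution_cases:
  assumes "x \<in> W" "x * x = 1" "x \<noteq> 1"
  obtains "x \<in> refls" | g a b where "g \<in> W" "adj a b" "x = g * (gen a * gen b) * inverse g"
proof -
  obtain g y C where *: "g \<in> W" "y \<in> W" "C \<subseteq> V" "x = g * y * inverse g" "y \<in> span C" "colour y = C"
    "\<forall>a\<in>C. \<forall>b\<in>C. a \<noteq> b \<longrightarrow> adj a b"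
    using involution_conj[OF assms(1,2)] by blast
  have "C \<noteq> {}" using * assms by (auto simp: span_def)
  then obtain a where a: "a \<in> C" by blast
  show ?thesis
  proof (cases "C = {a}")
    case True
    then have "y = 1 \<or> y = gen a" using span_single[of a y] *(3,5) a by blast
    then have "y = gen a" using *(4) assms(3) by auto
    moreover have "a \<in> V" using *(3) a by blast
    ultimately have "x \<in> refls" using reflI[OF *(1), of a] *(4) by simp
    then show ?thesis by (rule that(1))
  next
    case False
    then obtain b where b: "b \<in> C" "b \<noteq> a" using a by blast
    have ab: "adj a b" using *(7) a b by metis
    have "C \<subseteq> {a, b}"
    proof
      fix c assume "c \<in> C"
      then show "c \<in> {a, b}" using no_triangle[of a b c] ab *(7) a b by (metis insertCI)
    qed
    then have C: "C = {a, b}" using a b by blast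
    then have "y \<in> {1, gen a, gen b, gen a * gen b}" using span_pair[OF ab] *(5) C by blast
    moreover have "y \<noteq> 1" "y \<noteq> gen a" "y \<noteq> gen b" using *(6) C b adj_verts[OF ab] by auto
    ultimately have "y = gen a * gen b" by blast
    then show ?thesis using that(2)[OF *(1) ab] *(4) by blast
  qed
qed

text \<open>The product of three distinct pairwise commuting reflections would be an involution with
  three colours, that is, a triangle.\<close>

lemma commuting_triple:
  assumes r: "A \<in> refls" "B \<in> refls" "C \<in> refls"
    and c: "A * B = B * A" "A * C = C * A" "B * C = C * B" and "A \<noteq> B"
  shows "C = A \<or> C = B"
proof (rule ccontr)
  assume ne: "\<not> ?thesis"
  obtain a b c where col: "colour A = {a}" "colour B = {b}" "colour C = {c}" using colour_refl r by meson
  have "a \<noteq> b" "a \<noteq> c" "b \<noteq> c"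
    using commuting_refls_colour[of A B] commuting_refls_colour[of A C] commuting_refls_colour[of B C]
      r c ne \<open>A \<noteq> B\<close> col by auto
  moreover have "d \<in> colour (A * B * C) \<longleftrightarrow> ((d = a) \<noteq> (d = b)) \<noteq> (d = c)" for d
    using r col by (auto simp: colour_mult)
  ultimately have d: "a \<in> colour (A * B * C)" "b \<in> colour (A * B * C)" "c \<in> colour (A * B * C)"
    "a \<noteq> b" "a \<noteq> c" "b \<noteq> c" by auto
  have "(A * B * C) * (A * B * C) = (A * A) * ((B * B) * (C * C))" using c by (metis mult.assoc)
  then have sq: "(A * B * C) * (A * B * C) = 1" using r by simp
  show False
    using no_triangle[of a b c] involution_colour_clique[OF _ sq] r d by simp
qed

text \<open>By \<open>involution_cases\<close>, a generator not sent to a reflection is sent to a product of two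
  commuting reflections; such generators are called diagonal.\<close>

lemma diagonal_neighbour:
  assumes f: "racg_model \<Phi> f" and fW: "f ` verts \<Phi> \<subseteq> W"
    and u: "f u \<notin> refls" and e: "{u, v} \<in> edges \<Phi>"
  shows "f v \<in> refls" "f u * f v \<in> refls" "{u, w} \<in> edges \<Phi> \<Longrightarrow> w = v"
proof -
  interpret F: racg_model \<Phi> f by (rule f)
  have inv: "f x \<in> W" "f x * f x = 1" "f x \<noteq> 1" if "x \<in> verts \<Phi>" for x
    using F.refl_not_one fW that by auto
  have uV: "u \<in> verts \<Phi>" using F.adj_verts e by (auto simp: F.adj_def)
  obtain g a b where gab: "g \<in> W" "adj a b" "f u = g * (gen a * gen b) * inverse g"
    using involution_cases[OF inv[OF uV]] u by blast
  let ?A = "g * gen a * inverse g" and ?B = "g * gen b * inverse g"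
  have ab: "a \<in> V" "b \<in> V" "a \<noteq> b" using adj_verts gab by auto
  have AB: "?A \<in> refls" "?B \<in> refls" "?A \<noteq> ?B" "?A * ?B = ?B * ?A" "f u = ?A * ?B"
    using gab ab reflI[of g a] reflI[of g b] inj_gen conj_commute_iff[of g "gen a" "gen b"] adj_commute[OF gab(2)]
    by (simp_all add: mult.assoc)
  have main: "f v = ?A \<or> f v = ?B" if e: "{u, v} \<in> edges \<Phi>" for v
  proof -
    have v: "v \<in> verts \<Phi>" "v \<noteq> u" using F.adj_verts e by (auto simp: F.adj_def)
    have "f v * f u = f u * f v" using F.adj_commute[of u v] e by (simp add: F.adj_def)
    moreover have "f v \<in> W" using fW v by blast
    ultimately have vA: "f v * ?A = ?A * f v" "f v * ?B = ?B * f v"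
      using commute_edge[OF gab(2,1), of "f v"] gab(3) by auto
    show ?thesis
    proof (cases rule: involution_cases[OF inv[OF v(1)]])
      case 1
      then show ?thesis using commuting_triple[OF AB(1,2) 1 AB(4) _ _ AB(3)] vA by simp
    next
      \<comment> \<open>If \<open>v\<close> were diagonal as well, its two factors would commute
        with those of \<open>u\<close>, hence be the same two, and \<open>f v = f u\<close>.\<close>
      case (2 h c d)
      let ?C = "h * gen c * inverse h" and ?D = "h * gen d * inverse h"
      have cd: "c \<in> V" "d \<in> V" "c \<noteq> d" using adj_verts 2 by auto
      have CD: "?C \<in> refls" "?D \<in> refls" "?C \<noteq> ?D" "f v = ?C * ?D"
        using 2 cd reflI inj_gen by (simp_all add: mult.assoc)
      have com: "X * (h * gen s * inverse h) = (h * gen s * inverse h) * X"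
        if "X \<in> {?A, ?B}" "s \<in> {c, d}" for X s
        by (rule commute_edge[OF 2(2,1) _ _ that(2)]) (use that AB vA 2(3) in auto)
      have "?C \<in> {?A, ?B}" "?D \<in> {?A, ?B}"
        using commuting_triple[OF AB(1,2) CD(1) AB(4) _ _ AB(3)]
          commuting_triple[OF AB(1,2) CD(2) AB(4) _ _ AB(3)] com by simp_all
      moreover have "x * y = p * q" if "x \<in> {p, q}" "y \<in> {p, q}" "x \<noteq> y" "p * q = q * p" for x y p q :: 'b
        using that by auto
      ultimately have "f v = f u" using CD(3,4) AB(4,5) by metis
      then show ?thesis using F.inj_gen v uV by blast
    qed
  qed
  show "f v \<in> refls" using main[OF e] AB by auto
  have "f u * ?A = ?B" "f u * ?B = ?A" using AB by (metis mult.assoc refl_sq mult.right_neutral)+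
  then show "f u * f v \<in> refls" using main[OF e] AB by auto
  \<comment> \<open>Two neighbours would be sent to the two factors of \<open>f u\<close>, making
    \<open>u\<close> the product of its neighbours in C(\<Phi>); the colours computed in that group
    exclude this.\<close>
  show "w = v" if e': "{u, w} \<in> edges \<Phi>"
  proof (rule ccontr)
    assume "w \<noteq> v"
    have vw: "v \<in> verts \<Phi>" "w \<in> verts \<Phi>" "v \<noteq> u" using F.adj_verts e e' by (auto simp: F.adj_def)
    then have "f w \<noteq> f v" using F.inj_gen \<open>w \<noteq> v\<close> by blast
    then have "f u = f v * f w" using main[OF e] main[OF e'] AB by auto
    then have "F.colour (f u) = F.colour (f v * f w)" by simp
    then have "v \<in> F.colour (f u)" using F.colour_mult[of "f v" "f w" v] vw \<open>w \<noteq> v\<close> by auto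
    then show False using uV vw by simp
  qed
qed

text \<open>The transvection multiplies each non-isolated diagonal vertex by its neighbour. It
  respects the relations because there is no other neighbour, and it is involutive because the
  neighbour is left alone. Only isolated vertices can remain diagonal.\<close>

lemma isolate_diagonals:
  assumes f: "racg_model \<Phi> f" and fW: "f ` verts \<Phi> \<subseteq> W"
  shows "\<exists>f'. racg_model \<Phi> f' \<and> (\<forall>v\<in>verts \<Phi>. f' v \<in> W) \<and>
    (\<forall>u v. {u, v} \<in> edges \<Phi> \<longrightarrow> f' u \<in> refls)"
proof -
  interpret F: racg_model \<Phi> f by (rule f)
  note diag = diagonal_neighbour[OF f fW]
  define Z where "Z = {u. f u \<notin> refls \<and> (\<exists>v. {u, v} \<in> edges \<Phi>)}"
  define nb where "nb u = (SOME v. {u, v} \<in> edges \<Phi>)" for u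
  define f' where "f' u = (if u \<in> Z then f u * f (nb u) else f u)" for u
  define \<alpha> where "\<alpha> u = (if u \<in> Z then [u, nb u] else [u])" for u
  have nb: "{u, nb u} \<in> edges \<Phi>" "f u \<notin> refls" if "u \<in> Z" for u
    using that someI_ex[of "\<lambda>v. {u, v} \<in> edges \<Phi>"] by (auto simp: Z_def nb_def)
  have edge: "u \<in> verts \<Phi>" "v \<in> verts \<Phi>" "f u * f v = f v * f u" if "{u, v} \<in> edges \<Phi>" for u v
    using F.adj_verts[of u v] F.adj_commute[of u v] that by (auto simp: F.adj_def)
  have nbZ: "nb u \<notin> Z" if "u \<in> Z" for u using diag(1)[OF nb(2,1)[OF that]] by (simp add: Z_def)
  have comm: "f' x * f' y = f' y * f' x" if e: "{x, y} \<in> edges \<Phi>" and x: "x \<in> Z" for x y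
  proof -
    have y: "y = nb x" using diag(3)[OF nb(2,1)[OF x] e] .
    have c: "f x * f y = f y * f x" using edge[OF e] by blast
    have "f' x = f x * f y" "f' y = f y" using x y nbZ[OF x] by (simp_all add: f'_def)
    then show ?thesis using c by (metis mult.assoc)
  qed
  have map: "racg_map \<Phi> f'"
    unfolding racg_map_def
  proof (intro conjI ballI allI impI)
    fix x assume x: "x \<in> verts \<Phi>"
    show "f' x * f' x = 1"
    proof (cases "x \<in> Z")
      case True
      then show ?thesis using diag(2)[OF nb(2,1)[OF True]] by (simp add: f'_def)
    qed (use x in \<open>simp add: f'_def\<close>)
  next
    fix x y assume e: "{x, y} \<in> edges \<Phi>"
    then have e': "{y, x} \<in> edges \<Phi>" by (simp add: insert_commute)
    consider "x \<in> Z" | "y \<in> Z" | "x \<notin> Z" "y \<notin> Z" by blast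
    then show "f' x * f' y = f' y * f' x"
      using comm[OF e] comm[OF e'] edge(3)[OF e] by cases (auto simp: f'_def)
  qed
  have "racg_model \<Phi> f'"
  proof (rule F.racg_model_twist[OF map])
    fix u assume u: "u \<in> verts \<Phi>"
    show "\<alpha> u \<in> lists (verts \<Phi>)" using u edge(2)[OF nb(1)] by (simp add: \<alpha>_def)
    show "f' u = F.val (\<alpha> u)" by (simp add: f'_def \<alpha>_def)
    show "f u = word_val f' (\<alpha> u)"
      using nbZ edge(2)[OF nb(1)] by (auto simp: f'_def \<alpha>_def mult.assoc)
  qed
  moreover have "f' v \<in> W" if "v \<in> verts \<Phi>" for v
  proof (cases "v \<in> Z")
    case True
    have "f v \<in> W" "f (nb v) \<in> W" using fW that edge(2)[OF nb(1)[OF True]] by blast+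
    then show ?thesis by (simp add: f'_def)
  qed (use fW that in \<open>auto simp: f'_def\<close>)
  moreover have "f' u \<in> refls" if "{u, v} \<in> edges \<Phi>" for u v
    using that diag(2)[OF nb(2,1)] by (auto simp: f'_def Z_def)
  ultimately show ?thesis by blast
qed

end

lemma square_mult_commute: "y * x = x * y \<Longrightarrow> x * y * (x * y) = (x * x) * (y * (y :: 'g::monoid_mult))"
  by (metis mult.assoc)

context triangle_free_racg_model
begin

text \<open>Ping-pong is played in C(\<Phi>) itself, with the half-spaces of \<open>F\<close>: a
  diagonal \<open>u\<close> is isolated, and the half-space of \<open>f u * f p * f u\<close> lies
  in that of \<open>f u\<close>, so disjointness is kept. The new generators are reflections of W
  because \<open>f p\<close> is one.\<close>

lemma refl_model_of_reflection:
  assumes f: "racg_model \<Phi> f" and fW: "f ` verts \<Phi> \<subseteq> W"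
    and e: "\<forall>u v. {u, v} \<in> edges \<Phi> \<longrightarrow> f u \<in> refls"
    and p: "p \<in> verts \<Phi>" "f p \<in> refls"
  shows "\<exists>t. refl_model \<Phi> t"
proof -
  interpret F: racg_model \<Phi> f by (rule f)
  define t where "t u = (if f u \<in> refls then f u else f u * f p * f u)" for u
  have iso: "F.half (f u) \<inter> F.half (f p) = {}" if "u \<in> verts \<Phi>" "f u \<notin> refls" for u
    using F.half_gen_disjoint[of u p] e that p by (auto simp: F.adj_def)
  have tr: "t u \<in> F.refls" if "u \<in> verts \<Phi>" for u
    using F.conj_refl[of "f p" "f u"] that p by (simp add: t_def)
  have sub: "F.half (t u) \<subseteq> F.half (f u)" if "u \<in> verts \<Phi>" for u
    using F.half_refl_conj_subset[OF _ _ iso] that p by (auto simp: t_def)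
  have "F.ping_pong_system \<Phi> t"
    unfolding F.ping_pong_system_def
  proof (intro conjI ballI allI impI tr)
    fix u v assume uv: "{u, v} \<in> edges \<Phi>"
    then have a: "F.adj u v" by (simp add: F.adj_def)
    have "{v, u} \<in> edges \<Phi>" using uv by (simp add: insert_commute)
    then have "f u \<in> refls" "f v \<in> refls" using e uv by blast+
    then have "t u = f u" "t v = f v" by (auto simp: t_def)
    then show "t u \<noteq> t v" "t u * t v = t v * t u"
      using F.adj_verts[OF a] F.adj_commute[OF a] F.inj_gen by auto
  next
    fix u v assume "u \<in> verts \<Phi>" "v \<in> verts \<Phi>" "u \<noteq> v" "{u, v} \<notin> edges \<Phi>"
    then show "F.half (t u) \<inter> F.half (t v) = {}"
      using F.half_gen_disjoint[of u v] sub[of u] sub[of v] by (auto simp: F.adj_def)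
  qed
  then have "racg_model \<Phi> t" by (rule F.racg_model_ping_pong[OF F.simplicial])
  moreover have "t u \<in> refls" if u: "u \<in> verts \<Phi>" for u
  proof (cases "f u \<in> refls")
    case False
    have "f u * f p * inverse (f u) \<in> refls" using conj_refl p fW u by blast
    then show ?thesis using False u by (simp add: t_def)
  qed (simp add: t_def)
  ultimately show ?thesis by (auto simp: refl_model_def)
qed

text \<open>If \<open>\<Gamma>\<close> contains neither three pairwise non-adjacent vertices nor a vertex non-adjacent to both
  ends of an edge, then \<open>W\<close> is a product of two dihedral groups, where a product of three diagonal
  involutions is again an involution.\<close>

lemma three_disjoint_refls:
  assumes f: "racg_model \<Phi> f" and fW: "f ` verts \<Phi> \<subseteq> W" and diag: "\<And>u. u \<in> verts \<Phi> \<Longrightarrow> f u \<notin> refls"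
    and u: "u1 \<in> verts \<Phi>" "u2 \<in> verts \<Phi>" "u3 \<in> verts \<Phi>" "u1 \<noteq> u2" "u1 \<noteq> u3" "u2 \<noteq> u3" "{u1, u2} \<notin> edges \<Phi>"
  shows "\<exists>T. disjoint_refls T \<and> card T = 3"
proof (rule ccontr)
  assume none: "\<not> ?thesis"
  have three: False if "r \<in> refls" "s \<in> refls" "t \<in> refls"
    "half r \<inter> half s = {}" "half r \<inter> half t = {}" "half s \<inter> half t = {}" for r s t
  proof -
    have T0: "disjoint_refls {}" by (simp add: disjoint_refls_def)
    note T1 = disjoint_refls_insert[OF T0 that(3), simplified]
    have "half s \<inter> half t' = {}" if "t' \<in> {t}" for t' using \<open>half s \<inter> half t = {}\<close> that by simp
    note T2 = disjoint_refls_insert[OF T1(1) that(2) this]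
    have "half r \<inter> half t' = {}" if "t' \<in> {s, t}" for t'
      using \<open>half r \<inter> half s = {}\<close> \<open>half r \<inter> half t = {}\<close> that by auto
    note T3 = disjoint_refls_insert[OF T2(1) that(1) this]
    show False using none T2(2) T3 by auto
  qed
  \<comment> \<open>Otherwise \<open>gen a\<close>, \<open>gen b * gen a * gen b\<close> and
    \<open>gen c\<close> would have disjoint half-spaces.\<close>
  have H1: "adj a b \<or> adj a c" if "a \<in> V" "a \<noteq> b" "a \<noteq> c" "adj b c" for a b c
  proof (rule ccontr)
    assume n: "\<not> ?thesis"
    have bc: "b \<in> V" "c \<in> V" "b \<noteq> c" using adj_verts that by auto
    have ab: "half (gen a) \<inter> half (gen b) = {}" and ac: "half (gen a) \<inter> half (gen c) = {}"
      using half_gen_disjoint n that bc by auto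
    have ba: "half (gen b) \<inter> half (gen a) = {}" using ab by blast
    have sub: "half (gen b * gen a * gen b) \<subseteq> half (gen b)"
      using half_refl_conj_subset[OF _ _ ba] that bc by simp
    have "half (gen b * gen a * gen b) \<inter> half (gen c) = {}"
    proof (rule ccontr)
      assume "\<not> ?thesis"
      then obtain y where y: "y \<in> half (gen b * gen a * gen b)" "y \<in> half (gen c)" by blast
      then have yW: "y \<in> W" by (simp add: half_def)
      have "gen b * y \<in> half (gen a)"
        using half_refl_conj_iff[OF _ _ ba yW] y that bc by simp
      moreover have "gen b * y \<in> half (gen c)"
        using commute_half_iff[of "gen c" "gen b" y] y yW adj_commute[OF that(4)] bc by (simp add: inj_gen)
      ultimately show False using ac by blast
    qed
    moreover have "gen b * gen a * gen b \<in> refls" using conj_refl[of "gen a" "gen b"] that bc by simp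
    ultimately show False
      using three[of "gen a" "gen b * gen a * gen b" "gen c"] ab ac sub that bc by auto
  qed
  have H2: "adj a b \<or> adj a c \<or> adj b c" if "a \<in> V" "b \<in> V" "c \<in> V" "a \<noteq> b" "a \<noteq> c" "b \<noteq> c" for a b c
    using three[of "gen a" "gen b" "gen c"] half_gen_disjoint that by auto
  interpret F: racg_model \<Phi> f by (rule f)
  have dg: "\<exists>g\<in>W. \<exists>a b. adj a b \<and> f v = g * (gen a * gen b) * inverse g" if v: "v \<in> verts \<Phi>" for v
  proof -
    have "f v \<in> W" "f v * f v = 1" "f v \<noteq> 1" using fW v F.refl_not_one by auto
    then show ?thesis using involution_cases[of "f v"] diag v by metis
  qed
  obtain x y where xy: "adj x y" using dg u by blast
  have xyV: "x \<in> V" "y \<in> V" "x \<noteq> y" "adj y x" using adj_verts[OF xy] xy adj_sym by auto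
  \<comment> \<open>Non-neighbours of the two ends of an edge, each set containing the end itself.
    By \<open>H1\<close> and the absence of triangles they partition \<open>V\<close>, are
    independent and completely joined to each other; \<open>H2\<close> leaves at most two letters in
    each.\<close>
  define X where "X = {s \<in> V. \<not> adj x s}"
  define Y where "Y = {s \<in> V. \<not> adj y s}"
  have XY: "s \<in> X \<longleftrightarrow> s \<notin> Y" if s: "s \<in> V" for s
  proof -
    have "\<not> (adj x s \<and> adj y s)" using no_triangle[of x y s] xy by blast
    moreover have "adj x s \<or> adj y s" using H1[of s x y] xy xyV s adj_sym by metis
    ultimately show ?thesis using s by (auto simp: X_def Y_def)
  qed
  have indep0: "\<not> adj s s'" if "z \<in> V" "\<not> adj z s" "\<not> adj z s'" for z s s'
  proof
    assume a: "adj s s'"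
    then have "z \<noteq> s" "z \<noteq> s'" using that adj_sym by auto
    then show False using H1[of z s s'] a that by blast
  qed
  have indep: "\<not> adj s s'" if "(s \<in> X \<and> s' \<in> X) \<or> (s \<in> Y \<and> s' \<in> Y)" for s s'
    using that indep0[of x s s'] indep0[of y s s'] xyV by (auto simp: X_def Y_def)
  have complete: "adj s s'" if s: "s \<in> X" "s' \<in> Y" for s s'
  proof -
    have sV: "s \<in> V" "s' \<in> V" "s \<noteq> s'" using s XY by (auto simp: X_def Y_def)
    then have xs': "adj x s'" using XY[of s'] s by (auto simp: X_def)
    show ?thesis using H1[of s x s'] xs' sV s adj_sym[of s x] by (auto simp: X_def)
  qed
  have small: "\<exists>q\<in>V. Z \<subseteq> {p, q}"
    if p: "p \<in> Z" "Z \<subseteq> V" and Z: "\<And>s s'. s \<in> Z \<Longrightarrow> s' \<in> Z \<Longrightarrow> \<not> adj s s'" for Z p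
  proof (cases "Z = {p}")
    case False
    then obtain q where "q \<in> Z" "q \<noteq> p" using p by blast
    then have "Z \<subseteq> {p, q}" using H2[of p q] p Z by blast
    then show ?thesis using \<open>q \<in> Z\<close> p by blast
  qed (use p in auto)
  have sub: "x \<in> X" "y \<in> Y" "X \<subseteq> V" "Y \<subseteq> V" using xyV adj_verts by (auto simp: X_def Y_def)
  obtain x' where x': "x' \<in> V" "X \<subseteq> {x, x'}" using small[OF sub(1,3)] indep by blast
  obtain y' where y': "y' \<in> V" "Y \<subseteq> {y, y'}" using small[OF sub(2,4)] indep by blast
  let ?X = "filter (\<lambda>s. s \<in> X)" and ?Y = "filter (\<lambda>s. s \<in> Y)"
  have comm: "val (?X ws) * gen s = gen s * val (?X ws)" if "s \<in> Y" for s ws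
    by (rule word_val_in_commute) (use that complete adj_commute in auto)
  have decomp: "val ws = val (?X ws) * val (?Y ws)" if "ws \<in> lists V" for ws
    using that
  proof (induction ws)
    case (Cons s ws)
    show ?case
    proof (cases "s \<in> X")
      case True
      then show ?thesis using Cons XY[of s] by (simp add: mult.assoc)
    next
      case False
      then have "s \<in> Y" using XY Cons by auto
      have "val (s # ws) = gen s * val (?X ws) * val (?Y ws)" using Cons by (simp add: mult.assoc)
      also have "\<dots> = val (?X ws) * gen s * val (?Y ws)" using comm[OF \<open>s \<in> Y\<close>, of ws] by simp
      finally show ?thesis using False \<open>s \<in> Y\<close> by (simp add: mult.assoc)
    qed
  qed simp
  \<comment> \<open>A conjugate of an edge product takes one letter from each side, and the
    conjugating word counts twice, so both parts are odd.\<close>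
  have word: "\<exists>ws\<in>lists V. val ws = f v \<and> odd (length (?X ws)) \<and> odd (length (?Y ws))" if v: "v \<in> verts \<Phi>" for v
  proof -
    obtain g a b where gab: "g \<in> W" "adj a b" "f v = g * (gen a * gen b) * inverse g" using dg v by blast
    obtain hs where hs: "hs \<in> lists V" "val hs = g" using gab by (auto simp: span_def)
    have ab: "a \<in> V" "b \<in> V" using adj_verts gab by auto
    have "(a \<in> X \<and> b \<in> Y) \<or> (a \<in> Y \<and> b \<in> X)" using indep gab XY ab by metis
    then have parity: "odd (length (?X (hs @ [a, b] @ rev hs)))" "odd (length (?Y (hs @ [a, b] @ rev hs)))"
      using XY ab by (auto simp flip: rev_filter)
    have "val (hs @ [a, b] @ rev hs) = f v" using gab hs inv_val[OF hs(1)] by (simp add: mult.assoc)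
    moreover have "hs @ [a, b] @ rev hs \<in> lists V" using hs ab by auto
    ultimately show ?thesis using parity by blast
  qed
  obtain w1 w2 w3 where w: "w1 \<in> lists V" "val w1 = f u1" "odd (length (?X w1))" "odd (length (?Y w1))"
    "w2 \<in> lists V" "val w2 = f u2" "odd (length (?X w2))" "odd (length (?Y w2))"
    "w3 \<in> lists V" "val w3 = f u3" "odd (length (?X w3))" "odd (length (?Y w3))"
    using word u by metis
  let ?w = "w1 @ w2 @ w3"
  let ?a = "val (?X ?w)" and ?b = "val (?Y ?w)"
  have wV: "?w \<in> lists V" using w by auto
  have "?X ?w \<in> lists {x, x'}" "?Y ?w \<in> lists {y, y'}" using x' y' by auto
  moreover have "odd (length (?X ?w))" "odd (length (?Y ?w))" using w by auto
  ultimately have sq: "?a * ?a = 1" "?b * ?b = 1" using odd_dihedral_word x' y' xyV by blast+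
  have "?b * ?a = ?a * ?b"
    by (rule word_val_in_commute) (use comm[of _ ?w] in auto)
  then have "?a * ?b * (?a * ?b) = (?a * ?a) * (?b * ?b)" by (rule square_mult_commute)
  then have "val ?w * val ?w = 1" using sq decomp[OF wV] by simp
  then have "word_val f [u1, u2, u3, u1, u2, u3] = 1" using w by (simp add: mult.assoc)
  \<comment> \<open>The third vertex acts trivially, while the first two generate an infinite
    dihedral group, in which the square of their product moves 0.\<close>
  then have "word_val (dihedral u1 u2) [u1, u2, u3, u1, u2, u3] = word_val (dihedral u1 u2) []"
    using u by (intro F.universal[OF dihedral_map]) auto
  then have "app (word_val (dihedral u1 u2) [u1, u2, u3, u1, u2, u3]) 0 = 0" by simp
  then show False using u by (simp add: app_dihedral)
qed

text \<open>If after isolating diagonals no image is a reflection, \<Phi> has no edges, and as many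
  disjoint half-spaces are needed in \<open>W\<close> as \<Phi> has vertices. Up to two are found
  directly, since the extension of a disjoint family starts at three.\<close>

theorem refl_model_exists:
  assumes fin: "finite (verts \<Phi>)" and f: "racg_model \<Phi> f" and fW: "f ` verts \<Phi> \<subseteq> W"
  shows "\<exists>t. refl_model \<Phi> t"
proof -
  obtain f where f: "racg_model \<Phi> f" and fW: "f ` verts \<Phi> \<subseteq> W"
    and e: "\<forall>u v. {u, v} \<in> edges \<Phi> \<longrightarrow> f u \<in> refls"
    using isolate_diagonals[OF f fW] by blast
  interpret F: racg_model \<Phi> f by (rule f)
  show ?thesis
  proof (cases "\<exists>p\<in>verts \<Phi>. f p \<in> refls")
    case True
    then show ?thesis using refl_model_of_reflection[OF f fW e] by blast
  next
    case False
    then have diag: "f u \<notin> refls" if "u \<in> verts \<Phi>" for u using that by blast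
    have edgeless: "{u, v} \<notin> edges \<Phi>" for u v
      using e diag F.adj_verts[of u v] by (auto simp: F.adj_def)
    have two: "\<exists>T. disjoint_refls T \<and> card T = 2"
      if uv: "u \<in> verts \<Phi>" "v \<in> verts \<Phi>" "u \<noteq> v" for u v
    proof -
      have "f u * f v \<noteq> f v * f u" using F.commute_adj edgeless uv by (auto simp: F.adj_def)
      moreover have "f u \<in> W" "f v \<in> W" using fW uv by auto
      ultimately obtain a where a: "a \<in> V" "gen a * f v \<noteq> f v * gen a" using span_commute[of "f u" V "f v"] by blast
      then obtain b where b: "b \<in> V" "gen b * gen a \<noteq> gen a * gen b"
        using span_commute[of "f v" V "gen a"] \<open>f v \<in> W\<close> by metis
      have "a \<noteq> b" "\<not> adj a b" using b adj_commute[of a b] by auto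
      then have d: "half (gen a) \<inter> half t = {}" if "t \<in> {gen b}" for t
        using half_gen_disjoint a b that by simp
      have "disjoint_refls {gen b}" using b by (simp add: disjoint_refls_def)
      from disjoint_refls_insert[OF this gen_refl[OF a(1)] d] show ?thesis
        by (intro exI[of _ "{gen a, gen b}"]) simp
    qed
    have "\<exists>T. disjoint_refls T \<and> card T = card (verts \<Phi>)"
    proof -
      consider "card (verts \<Phi>) = 0" | "card (verts \<Phi>) = 1" | "card (verts \<Phi>) = 2" | "3 \<le> card (verts \<Phi>)"
        by linarith
      then show ?thesis
      proof cases
        case 1
        then show ?thesis by (intro exI[of _ "{}"]) (simp add: disjoint_refls_def)
      next
        case 2
        then obtain u where u: "u \<in> verts \<Phi>" by (metis card_1_singletonE insertI1)
        have "f u \<noteq> 1" "f u \<in> W" using F.refl_not_one u fW by auto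
        then obtain a where "a \<in> V" using span_first[of "f u" V] by blast
        then show ?thesis using 2 by (intro exI[of _ "{gen a}"]) (simp add: disjoint_refls_def)
      next
        case 3
        then obtain u v where "verts \<Phi> = {u, v}" "u \<noteq> v" by (auto simp: card_2_iff)
        then have "\<exists>T. disjoint_refls T \<and> card T = 2" by (intro two) auto
        then show ?thesis by (simp only: 3)
      next
        case 4
        obtain S where "S \<subseteq> verts \<Phi>" "card S = 3" using obtain_subset_with_card_n[OF 4] by blast
        then obtain u1 u2 u3 where "u1 \<in> verts \<Phi>" "u2 \<in> verts \<Phi>" "u3 \<in> verts \<Phi>" "u1 \<noteq> u2" "u1 \<noteq> u3" "u2 \<noteq> u3"
          by (auto simp: card_3_iff)
        then obtain T where "disjoint_refls T" "card T = 3"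
          using three_disjoint_refls[OF f fW diag] edgeless by metis
        then show ?thesis using disjoint_refls_card[of T] 4 by simp
      qed
    qed
    then obtain T where T: "disjoint_refls T" "card T = card (verts \<Phi>)" by blast
    then obtain h where h: "bij_betw h (verts \<Phi>) T"
      using finite_same_card_bij[OF fin, of T] by (auto simp: disjoint_refls_def)
    have hT: "h u \<in> T" if "u \<in> verts \<Phi>" for u using bij_betwE[OF h] that by blast
    have "ping_pong_system \<Phi> h"
      unfolding ping_pong_system_def
    proof (intro conjI ballI allI impI)
      fix u assume "u \<in> verts \<Phi>"
      then show "h u \<in> refls" using T hT by (auto simp: disjoint_refls_def)
    next
      fix u v assume "u \<in> verts \<Phi>" "v \<in> verts \<Phi>" "u \<noteq> v"
      moreover from this have "h u \<noteq> h v" using h by (auto simp: bij_betw_def inj_on_def)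
      ultimately show "half (h u) \<inter> half (h v) = {}"
        using T hT by (auto simp: disjoint_refls_def pairwise_def)
    qed (use edgeless in blast)+
    then show ?thesis using ping_pong_refl_model[OF F.simplicial] by blast
  qed
qed

end

section \<open>Bases of subgroups\<close>

text \<open>Faithfulness for the new labels is tested in the regular representation of C(\<Delta>):
  pulled back along \<open>\<sigma>\<close> it satisfies the relations of \<open>\<Gamma>\<close>,
  so \<open>universal\<close> applies.\<close>

lemma (in racg_model) racg_model_relabel:
  fixes \<sigma> :: "'a \<Rightarrow> 'c" and k :: "'c \<Rightarrow> 'g"
  assumes simp: "simplicial_graph \<Delta>" and verts: "verts \<Delta> = \<sigma> ` V" and k: "\<And>u. u \<in> V \<Longrightarrow> k (\<sigma> u) = gen u"
    and edges: "\<And>u v. u \<in> V \<Longrightarrow> v \<in> V \<Longrightarrow> {\<sigma> u, \<sigma> v} \<in> edges \<Delta> \<longleftrightarrow> {u, v} \<in> edges \<Gamma>"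
  shows "racg_model \<Delta> k"
proof -
  let ?g = "\<lambda>u. regular_rep (racg \<Delta>) (racg_gen \<Delta> u)"
  interpret D: racg_model \<Delta> ?g by (rule canonical_racg_model[OF simp])
  have map: "racg_map \<Gamma> (\<lambda>u. ?g (\<sigma> u))"
    unfolding racg_map_def
  proof (intro conjI ballI allI impI)
    fix u assume "u \<in> V"
    then show "?g (\<sigma> u) * ?g (\<sigma> u) = 1" using verts by simp
  next
    fix u v assume e: "{u, v} \<in> edges \<Gamma>"
    then have "u \<in> V" "v \<in> V" using edge_verts[OF simplicial] by auto
    then show "?g (\<sigma> u) * ?g (\<sigma> v) = ?g (\<sigma> v) * ?g (\<sigma> u)"
      using D.adj_commute[of "\<sigma> u" "\<sigma> v"] edges e by (simp add: D.adj_def)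
  qed
  show ?thesis
  proof (rule D.racg_model_transfer)
    show "racg_map \<Delta> k"
      unfolding racg_map_def
    proof (intro conjI ballI allI impI)
      fix x assume "x \<in> verts \<Delta>"
      then show "k x * k x = 1" using verts k by auto
    next
      fix x y assume e: "{x, y} \<in> edges \<Delta>"
      then obtain u v where "u \<in> V" "v \<in> V" "x = \<sigma> u" "y = \<sigma> v"
        using edge_verts[OF simp e] verts by auto
      then show "k x * k y = k y * k x" using edges e adj_commute[of u v] k by (simp add: adj_def)
    qed
    fix xs assume xs: "xs \<in> lists (verts \<Delta>)" "word_val k xs = 1"
    let ?i = "inv_into V \<sigma>"
    have i: "?i x \<in> V" "\<sigma> (?i x) = x" if "x \<in> set xs" for x
      using that xs verts by (auto simp: in_lists_conv_set inv_into_into f_inv_into_f)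
    have "List.map gen (List.map ?i xs) = List.map k xs" using i k by auto metis
    then have "val (List.map ?i xs) = word_val k xs" by (rule arg_cong)
    moreover have ixs: "List.map ?i xs \<in> lists V" using i by auto
    ultimately have "val (List.map ?i xs) = val []" using xs by (simp only: list.map prod_list.Nil)
    then have "word_val (\<lambda>u. ?g (\<sigma> u)) (List.map ?i xs) = word_val (\<lambda>u. ?g (\<sigma> u)) []"
      using universal[OF map ixs, of "[]"] by simp
    moreover have "List.map (\<lambda>u. ?g (\<sigma> u)) (List.map ?i xs) = List.map ?g xs" using i by simp
    ultimately show "D.val xs = 1" by (metis list.map(1) prod_list.Nil)
  qed
qed

lemma edge_commutation_graph_iff:
  "{x, y} \<in> edges (commutation_graph H S) \<longleftrightarrow> x \<in> S \<and> y \<in> S \<and> x \<noteq> y \<and> x \<otimes>\<^bsub>H\<^esub> y = y \<otimes>\<^bsub>H\<^esub> x"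
  by (auto simp: commutation_graph_def doubleton_eq_iff)

lemma word_vals_racg:
  assumes h: "mult_on (racg \<Gamma>) (h :: 'a gword set \<Rightarrow> 'g::mult_group)"
  shows "word_val (\<lambda>u. h (racg_gen \<Gamma> u)) ` lists (verts \<Gamma>) = h ` carrier (racg \<Gamma>)"
proof
  let ?p = "map (\<lambda>u. (u, True))"
  have carrier: "carrier (racg \<Gamma>) = racg_class \<Gamma> ` gwords (verts \<Gamma>)"
    by (simp add: racg_def carrier_presented_group)
  show "word_val (\<lambda>u. h (racg_gen \<Gamma> u)) ` lists (verts \<Gamma>) \<subseteq> h ` carrier (racg \<Gamma>)"
  proof (rule image_subsetI)
    fix xs assume xs: "xs \<in> lists (verts \<Gamma>)"
    then have "?p xs \<in> gwords (verts \<Gamma>)" by (auto simp: gwords_def)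
    then show "word_val (\<lambda>u. h (racg_gen \<Gamma> u)) xs \<in> h ` carrier (racg \<Gamma>)"
      unfolding word_val_racg_class[OF h xs] carrier by blast
  qed
  show "h ` carrier (racg \<Gamma>) \<subseteq> word_val (\<lambda>u. h (racg_gen \<Gamma> u)) ` lists (verts \<Gamma>)"
    unfolding carrier
  proof (intro image_subsetI)
    fix X assume "X \<in> racg_class \<Gamma> ` gwords (verts \<Gamma>)"
    then obtain x where x: "x \<in> gwords (verts \<Gamma>)" "X = racg_class \<Gamma> x" by blast
    then have xs: "map fst x \<in> lists (verts \<Gamma>)" by (force simp: gwords_def)
    have "X = racg_class \<Gamma> (?p (map fst x))"
      using equiv_class_eq[OF equiv_pres_rel pres_rel_positive[OF x(1)]] x by simp
    then have "h X = word_val (\<lambda>u. h (racg_gen \<Gamma> u)) (map fst x)"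
      using word_val_racg_class[OF h xs] by simp
    then show "h X \<in> word_val (\<lambda>u. h (racg_gen \<Gamma> u)) ` lists (verts \<Gamma>)" using xs by blast
  qed
qed

section \<open>From bijections back to subgroups of an abstract group\<close>

context group
begin

lemma mult_on_regular_rep: "mult_on G (regular_rep G)"
  by (auto simp: mult_on_def regular_rep_mult)

lemma regular_rep_foldr:
  "set xs \<subseteq> carrier G \<Longrightarrow>
    foldr (\<otimes>) xs \<one> \<in> carrier G \<and> regular_rep G (foldr (\<otimes>) xs \<one>) = word_val (regular_rep G) xs"
  by (induction xs) (auto simp: regular_rep_mult mult_on_one[OF mult_on_regular_rep])

lemma racg_model_iso:
  assumes k: "racg_model \<Delta> k" and sub: "word_val k ` lists (verts \<Delta>) \<subseteq> regular_rep G ` carrier G"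
    and H: "H = {x \<in> carrier G. regular_rep G x \<in> word_val k ` lists (verts \<Delta>)}"
  shows "\<exists>\<phi>\<in>iso (racg \<Delta>) (G\<lparr>carrier := H\<rparr>). \<forall>u\<in>verts \<Delta>. regular_rep G (\<phi> (racg_gen \<Delta> u)) = k u"
proof -
  interpret K: racg_model \<Delta> k by (rule k)
  let ?\<rho> = "regular_rep G" and ?C = "carrier (racg \<Delta>)"
  obtain h where h: "mult_on (racg \<Delta>) h" "inj_on h ?C" "h ` ?C = K.W"
    "\<forall>u\<in>verts \<Delta>. h (racg_gen \<Delta> u) = k u"
    using K.mult_on_of_racg_model by blast
  have KW: "K.W = word_val k ` lists (verts \<Delta>)" by (simp add: K.span_def)
  define \<phi> where "\<phi> X = inv_into (carrier G) ?\<rho> (h X)" for X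
  have \<phi>: "\<phi> X \<in> carrier G" "?\<rho> (\<phi> X) = h X" if "X \<in> ?C" for X
  proof -
    have "h X \<in> ?\<rho> ` carrier G" using that h(3) sub KW by blast
    then show "\<phi> X \<in> carrier G" "?\<rho> (\<phi> X) = h X" by (simp_all add: \<phi>_def inv_into_into f_inv_into_f)
  qed
  have eqI: "x = y" if "x \<in> carrier G" "y \<in> carrier G" "?\<rho> x = ?\<rho> y" for x y
    using regular_rep_inj that by (auto simp: inj_on_def)
  have img: "\<phi> ` ?C = H"
  proof
    show "\<phi> ` ?C \<subseteq> H" using \<phi> h(3) KW H by auto
    show "H \<subseteq> \<phi> ` ?C"
    proof
      fix x assume x: "x \<in> H"
      then have "?\<rho> x \<in> h ` ?C" using H h(3) KW by auto
      then obtain X where X: "X \<in> ?C" "?\<rho> x = h X" by blast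
      then have "x = \<phi> X" using eqI[of x "\<phi> X"] \<phi> x H by auto
      then show "x \<in> \<phi> ` ?C" using X by blast
    qed
  qed
  interpret R: group "racg \<Delta>" by (rule group_racg)
  have "\<phi> (X \<otimes>\<^bsub>racg \<Delta>\<^esub> Y) = \<phi> X \<otimes> \<phi> Y" if "X \<in> ?C" "Y \<in> ?C" for X Y
    using that \<phi> h(1) by (intro eqI) (auto simp: regular_rep_mult mult_on_def)
  moreover have "inj_on \<phi> ?C" using h(2) \<phi>(2) by (metis inj_on_def)
  ultimately have "\<phi> \<in> iso (racg \<Delta>) (G\<lparr>carrier := H\<rparr>)"
    using img by (auto simp: iso_def hom_def bij_betw_def)
  moreover have "?\<rho> (\<phi> (racg_gen \<Delta> u)) = k u" if "u \<in> verts \<Delta>" for u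
    using \<phi>(2)[OF racg_gen_carrier[OF that]] h(4) that by simp
  ultimately show ?thesis by blast
qed

text \<open>The basis consists of the preimages of the \<open>t u\<close> under the regular
  representation. Distinct vertices of a model commute exactly when they are adjacent, so the
  commutation graph is \<Phi> with its vertices relabelled.\<close>

lemma racg_basis_of_racg_model:
  assumes k: "racg_model \<Phi> t" and t: "t ` verts \<Phi> \<subseteq> regular_rep G ` carrier G"
  shows "\<exists>H. subgroup H G \<and> racg \<Phi> \<cong> G\<lparr>carrier := H\<rparr> \<and>
    racg_basis (G\<lparr>carrier := H\<rparr>) {x \<in> carrier G. regular_rep G x \<in> t ` verts \<Phi>}"
proof -
  interpret K: racg_model \<Phi> t by (rule k)
  let ?\<rho> = "regular_rep G" and ?S = "{x \<in> carrier G. regular_rep G x \<in> t ` verts \<Phi>}"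
  have eqI: "x = y" if "x \<in> carrier G" "y \<in> carrier G" "?\<rho> x = ?\<rho> y" for x y
    using regular_rep_inj that by (auto simp: inj_on_def)
  define H where "H = {x \<in> carrier G. ?\<rho> x \<in> K.W}"
  let ?G = "G\<lparr>carrier := H\<rparr>"
  have one: "?\<rho> \<one> = 1" by (rule mult_on_one[OF mult_on_regular_rep])
  have inv: "?\<rho> (inv x) = inverse (?\<rho> x)" if "x \<in> carrier G" for x
    using that one regular_rep_mult[of x "inv x"] by (intro inv_eqI[symmetric]) simp
  have sub: "subgroup H G"
    by (rule subgroupI) (auto simp: H_def one regular_rep_mult inv intro!: exI[of _ \<one>])
  have KW: "K.W = word_val t ` lists (verts \<Phi>)" by (simp add: K.span_def)
  have WG: "K.W \<subseteq> ?\<rho> ` carrier G"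
  proof
    fix w assume "w \<in> K.W"
    then show "w \<in> ?\<rho> ` carrier G"
    proof (induction rule: K.span_induct)
      case one
      then show ?case using \<open>?\<rho> \<one> = 1\<close> by (metis imageI one_closed)
    next
      case (mult s y)
      then obtain a b where "a \<in> carrier G" "b \<in> carrier G" "t s = ?\<rho> a" "y = ?\<rho> b" using t by blast
      then show ?case by (intro image_eqI[of _ _ "a \<otimes> b"]) (auto simp: regular_rep_mult)
    qed
  qed
  have iso: "racg \<Phi> \<cong> ?G"
    using racg_model_iso[OF k _ , of H] WG H_def KW by (auto simp: is_iso_def)
  define \<sigma> where "\<sigma> u = inv_into (carrier G) ?\<rho> (t u)" for u
  have \<sigma>: "\<sigma> u \<in> carrier G" "?\<rho> (\<sigma> u) = t u" if "u \<in> verts \<Phi>" for u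
    using that t by (auto simp: \<sigma>_def inv_into_into f_inv_into_f image_subset_iff)
  have S: "?S = \<sigma> ` verts \<Phi>"
  proof (intro equalityI subsetI)
    fix x assume "x \<in> ?S"
    then obtain u where "u \<in> verts \<Phi>" "x \<in> carrier G" "?\<rho> x = t u" by blast
    then show "x \<in> \<sigma> ` verts \<Phi>" using eqI[of x "\<sigma> u"] \<sigma> by auto
  qed (use \<sigma> in auto)
  have SH: "?S \<subseteq> H" by (auto simp: H_def)
  let ?\<Delta> = "commutation_graph ?G ?S"
  have \<Delta>: "verts ?\<Delta> = \<sigma> ` verts \<Phi>" using S by (simp add: commutation_graph_def)
  have "racg_model ?\<Delta> ?\<rho>"
  proof (rule K.racg_model_relabel[OF _ \<Delta>])
    show "simplicial_graph ?\<Delta>"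
      by (auto simp: simplicial_graph_def commutation_graph_def card_insert_if)
    fix u v assume uv: "u \<in> verts \<Phi>" "v \<in> verts \<Phi>"
    have ne: "\<sigma> u \<noteq> \<sigma> v \<longleftrightarrow> u \<noteq> v" using \<sigma> uv K.inj_gen by metis
    have "\<sigma> u \<otimes> \<sigma> v = \<sigma> v \<otimes> \<sigma> u \<longleftrightarrow> t u * t v = t v * t u"
      using \<sigma> uv regular_rep_mult eqI by (metis m_closed)
    then have "{\<sigma> u, \<sigma> v} \<in> edges ?\<Delta> \<longleftrightarrow> u \<noteq> v \<and> t u * t v = t v * t u"
      using ne \<sigma> uv by (simp add: edge_commutation_graph_iff)
    also have "\<dots> \<longleftrightarrow> {u, v} \<in> edges \<Phi>"
      using K.commute_adj[of u v] K.adj_commute[of u v] K.adj_verts[of u v] uv by (auto simp: K.adj_def)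
    finally show "{\<sigma> u, \<sigma> v} \<in> edges ?\<Delta> \<longleftrightarrow> {u, v} \<in> edges \<Phi>" .
  qed (use \<sigma> in auto)
  note model = this
  have vals: "word_val ?\<rho> ` lists (verts ?\<Delta>) = K.W"
  proof
    show "word_val ?\<rho> ` lists (verts ?\<Delta>) \<subseteq> K.W"
    proof (rule image_subsetI)
      fix xs assume "xs \<in> lists (verts ?\<Delta>)"
      then show "word_val ?\<rho> xs \<in> K.W" unfolding \<Delta> by (induction xs) (auto simp: \<sigma>)
    qed
    show "K.W \<subseteq> word_val ?\<rho> ` lists (verts ?\<Delta>)"
    proof
      fix w assume "w \<in> K.W"
      then obtain xs where xs: "xs \<in> lists (verts \<Phi>)" "w = word_val t xs" by (auto simp: KW)
      have "map ?\<rho> (map \<sigma> xs) = map t xs" using xs \<sigma> by auto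
      then have "w = word_val ?\<rho> (map \<sigma> xs)" using xs(2) by (simp only:)
      moreover have "map \<sigma> xs \<in> lists (verts ?\<Delta>)" unfolding \<Delta> using xs by auto
      ultimately show "w \<in> word_val ?\<rho> ` lists (verts ?\<Delta>)" by (rule image_eqI)
    qed
  qed
  obtain \<phi> where \<phi>: "\<phi> \<in> iso (racg ?\<Delta>) ?G" "\<forall>s\<in>?S. ?\<rho> (\<phi> (racg_gen ?\<Delta> s)) = ?\<rho> s"
    using racg_model_iso[OF model, of H] WG H_def vals S \<Delta> by auto
  have "\<forall>s\<in>?S. \<phi> (racg_gen ?\<Delta> s) = s"
  proof
    fix s assume s: "s \<in> ?S"
    then have "racg_gen ?\<Delta> s \<in> carrier (racg ?\<Delta>)" using racg_gen_carrier[of s ?\<Delta>] \<Delta> S by blast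
    then have "\<phi> (racg_gen ?\<Delta> s) \<in> H" using \<phi>(1) by (auto simp: iso_def hom_def)
    then show "\<phi> (racg_gen ?\<Delta> s) = s" using \<phi>(2) s H_def eqI by blast
  qed
  moreover have "generate ?G ?S = H"
  proof
    interpret GH: group ?G using subgroup_imp_group[OF sub] .
    show "generate ?G ?S \<subseteq> H" using GH.generate_incl[of ?S] SH by simp
    show "H \<subseteq> generate ?G ?S"
    proof
      fix x assume x: "x \<in> H"
      then have "?\<rho> x \<in> word_val ?\<rho> ` lists (verts ?\<Delta>)" unfolding vals by (simp add: H_def)
      then obtain xs where "xs \<in> lists (verts ?\<Delta>)" "?\<rho> x = word_val ?\<rho> xs" by blast
      then have xs: "xs \<in> lists ?S" "?\<rho> x = word_val ?\<rho> xs" by (simp_all add: commutation_graph_def)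
      have "set xs \<subseteq> carrier G" using xs(1) by auto
      then have "x = foldr (\<otimes>) xs \<one>"
        using regular_rep_foldr[of xs] x xs(2) by (intro eqI) (auto simp: H_def)
      moreover have "foldr (\<otimes>) xs \<one> \<in> generate ?G ?S"
        using xs(1)
      proof (induction xs)
        case Nil
        then show ?case using generate.one[of ?G ?S] by simp
      next
        case (Cons s xs)
        then show ?case using generate.eng[OF generate.incl[of s ?S ?G]] by simp
      qed
      ultimately show "x \<in> generate ?G ?S" by simp
    qed
  qed
  ultimately have "racg_basis ?G ?S" using \<phi>(1) SH by (auto simp: racg_basis_def)
  then show ?thesis using sub iso by blast
qed

end

section \<open>The equivalence\<close>

theorem theorem1p8:
  fixes \<Phi> :: "'a graph" and \<Psi> :: "'b graph"
  assumes "finite_simplicial_graph \<Phi>"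
    and "finite_simplicial_graph \<Psi>"
    and "triangle_free \<Psi>"
  shows "(\<exists>H. subgroup H (racg \<Psi>) \<and> racg \<Phi> \<cong> (racg \<Psi>)\<lparr>carrier := H\<rparr>) \<longleftrightarrow>
    (\<exists>H S. subgroup H (racg \<Psi>) \<and> racg \<Phi> \<cong> (racg \<Psi>)\<lparr>carrier := H\<rparr> \<and>
       racg_basis ((racg \<Psi>)\<lparr>carrier := H\<rparr>) S \<and>
       S \<subseteq> racg_ball \<Psi> (2 * (1 + (1 + 2 * card (verts \<Phi>)) * card (verts \<Psi>))))"
proof
  assume "\<exists>H. subgroup H (racg \<Psi>) \<and> racg \<Phi> \<cong> (racg \<Psi>)\<lparr>carrier := H\<rparr>"
  then obtain H \<theta> where H: "subgroup H (racg \<Psi>)" and \<theta>: "\<theta> \<in> iso (racg \<Phi>) ((racg \<Psi>)\<lparr>carrier := H\<rparr>)"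
    by (auto simp: is_iso_def)
  have fin: "finite (verts \<Phi>)" "finite (verts \<Psi>)" "simplicial_graph \<Phi>" "simplicial_graph \<Psi>"
    using assms by (auto simp: finite_simplicial_graph_def)
  interpret G: group "racg \<Psi>" by (rule group_racg)
  let ?\<rho> = "regular_rep (racg \<Psi>)" and ?C = "carrier (racg \<Psi>)"
  interpret M: triangle_free_racg_model \<Psi> "\<lambda>u. ?\<rho> (racg_gen \<Psi> u)"
    using canonical_racg_model[OF fin(4)] assms(3)
    by (simp add: triangle_free_racg_model_def triangle_free_racg_model_axioms_def)
  have MW: "M.W = ?\<rho> ` ?C" using word_vals_racg[OF G.mult_on_regular_rep] by (simp add: M.span_def)
  have \<theta>H: "\<theta> X \<in> ?C" if "X \<in> carrier (racg \<Phi>)" for X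
    using \<theta> subgroup.subset[OF H] that by (auto simp: iso_def hom_def)
  have "mult_on (racg \<Phi>) (\<lambda>X. ?\<rho> (\<theta> X))"
    using \<theta> \<theta>H by (auto simp: mult_on_def iso_def hom_def G.regular_rep_mult)
  moreover have "inj_on (\<lambda>X. ?\<rho> (\<theta> X)) (carrier (racg \<Phi>))"
    using \<theta> \<theta>H G.regular_rep_inj by (fastforce simp: inj_on_def iso_def bij_betw_def)
  ultimately have "racg_model \<Phi> (\<lambda>u. ?\<rho> (\<theta> (racg_gen \<Phi> u)))" using racg_model_of_mult_on fin by blast
  moreover have "(\<lambda>u. ?\<rho> (\<theta> (racg_gen \<Phi> u))) ` verts \<Phi> \<subseteq> M.W"
    unfolding MW by (rule image_subsetI) (rule imageI[OF \<theta>H[OF racg_gen_carrier]])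
  ultimately have "\<exists>t. M.refl_model \<Phi> t" by (rule M.refl_model_exists[OF fin(1)])
  then obtain t where t: "M.refl_model \<Phi> t"
    and depth: "\<forall>v\<in>verts \<Phi>. M.depth (t v) \<le> (1 + 2 * card (verts \<Phi>)) * card (verts \<Psi>)"
    using M.bounded_refl_model[OF fin(3,1,2)] by blast
  have refl: "t v \<in> M.refls" if "v \<in> verts \<Phi>" for v using t that by (simp add: M.refl_model_def)
  let ?S = "{x \<in> ?C. ?\<rho> x \<in> t ` verts \<Phi>}"
  have "racg_model \<Phi> t" "t ` verts \<Phi> \<subseteq> ?\<rho> ` ?C"
    using t refl M.refl_W unfolding MW[symmetric] M.refl_model_def by blast+
  then obtain H where "subgroup H (racg \<Psi>)" "racg \<Phi> \<cong> (racg \<Psi>)\<lparr>carrier := H\<rparr>"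
    "racg_basis ((racg \<Psi>)\<lparr>carrier := H\<rparr>) ?S"
    using G.racg_basis_of_racg_model by blast
  moreover have "?S \<subseteq> racg_ball \<Psi> (2 * (1 + (1 + 2 * card (verts \<Phi>)) * card (verts \<Psi>)))"
  proof
    let ?n = "(1 + 2 * card (verts \<Phi>)) * card (verts \<Psi>)"
    fix x assume "x \<in> ?S"
    then obtain v where v: "v \<in> verts \<Phi>" "?\<rho> x = t v" and x: "x \<in> ?C" by blast
    obtain g a where g: "g \<in> M.W" "a \<in> verts \<Psi>" "t v = g * ?\<rho> (racg_gen \<Psi> a) * inverse g"
      "M.len g = M.depth (t v)"
      using M.depthE[OF refl[OF v(1)]] .
    obtain gs where gs: "gs \<in> lists (verts \<Psi>)" "M.val gs = g" "length gs = M.len g"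
      using M.reduced_word[OF g(1)] .
    \<comment> \<open>As letters are involutions, the conjugate of \<open>a\<close> by
      \<open>g\<close> is spelled by a palindrome of length \<open>2 * M.len g + 1\<close>, which
      the depth bound keeps within the radius.\<close>
    let ?ws = "map (racg_gen \<Psi>) (gs @ [a] @ rev gs)"
    have ws: "set ?ws \<subseteq> racg_gen \<Psi> ` verts \<Psi>" using gs g by auto
    have len: "length ?ws \<le> 2 * (1 + ?n)" using gs(3) g(4) bspec[OF depth v(1)] by simp
    have "racg_gen \<Psi> ` verts \<Psi> \<subseteq> ?C" by (rule image_subsetI) (rule racg_gen_carrier)
    with ws have wsC: "set ?ws \<subseteq> ?C" by (rule subset_trans)
    have "?\<rho> (foldr (\<otimes>\<^bsub>racg \<Psi>\<^esub>) ?ws \<one>\<^bsub>racg \<Psi>\<^esub>) = word_val ?\<rho> ?ws"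
      using G.regular_rep_foldr[OF wsC] by blast
    also have "\<dots> = M.val (gs @ [a] @ rev gs)" by (simp add: comp_def)
    also have "\<dots> = ?\<rho> x" using gs g v M.inv_val[OF gs(1)] by (simp add: mult.assoc)
    finally have "foldr (\<otimes>\<^bsub>racg \<Psi>\<^esub>) ?ws \<one>\<^bsub>racg \<Psi>\<^esub> = x"
      using G.regular_rep_inj G.regular_rep_foldr[OF wsC] x by (auto simp: inj_on_def)
    then have "word_length (racg \<Psi>) (racg_gen \<Psi> ` verts \<Psi>) x \<le> length ?ws"
      unfolding word_length_def using ws by (intro Least_le exI[of _ ?ws]) auto
    then have "word_length (racg \<Psi>) (racg_gen \<Psi> ` verts \<Psi>) x \<le> 2 * (1 + ?n)" using len by linarith
    then show "x \<in> racg_ball \<Psi> (2 * (1 + ?n))"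
      using x by (simp add: racg_ball_def word_ball_def word_dist_def)
  qed
  ultimately show "\<exists>H S. subgroup H (racg \<Psi>) \<and> racg \<Phi> \<cong> (racg \<Psi>)\<lparr>carrier := H\<rparr> \<and>
       racg_basis ((racg \<Psi>)\<lparr>carrier := H\<rparr>) S \<and>
       S \<subseteq> racg_ball \<Psi> (2 * (1 + (1 + 2 * card (verts \<Phi>)) * card (verts \<Psi>)))"
    by blast
qed blast

end
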